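(* Fix an integer $C\ge 2$. For each $d,N$, let $X_N=(x_1,\dots,x_N)\in\mathbb{R}^{d\times N}$ have i.i.d. $\mathcal N(0,1)$ entries, and let $V\in\mathbb{R}^{C\times d}$, with rows $v_1^\top,\dots,v_C^\top$, be independent of $X_N$ with i.i.d. $\mathcal N(0,1/d)$ entries. Let $\frac{\partial^2\ell_{\mathrm{CE}}(V)}{\partial v_i\partial v_i^\top}$ and $\frac{\partial^2\ell_{\mathrm{CE}}(V)}{\partial v_i\partial v_j^\top}$ be the Hessian blocks of the cross-entropy loss of the linear model, as given in the context. Suppose $d,N\to\infty$ with $d/N\to\gamma\in(0,+\infty)$. Then, almost surely, $$\lim_{d,N\to\infty}\frac1d\left\|\frac{\partial^2\ell_{\mathrm{CE}}(V)}{\partial v_i\partial v_i^\top}\right\|_{\mathrm F}^2=g_{ii}(\gamma,C)\quad\text{for all } i\in[C],$$ $$\lim_{d,N\to\infty}\frac1d\left\|\frac{\partial^2\ell_{\mathrm{CE}}(V)}{\partial v_i\partial v_j^\top}\right\|_{\mathrm F}^2=g_{ij}(\gamma,C)\quad\text{for all } i,j\in[C],\ i\neq j,$$ where, with $\mathbf z_C=(Z_1,\dots,Z_C)\sim\mathcal N_C(0,I_C)$, $$g_{ii}(\gamma,C)=\gamma\,\mathbf E[h_1(\mathbf z_C)^2]+(\mathbf E[h_1(\mathbf z_C)])^2,\qquad g_{ij}(\gamma,C)=\gamma\,\mathbf E[h_2(\mathbf z_C)^2]+(\mathbf E[h_2(\mathbf z_C)])^2,$$ $$h_1(\mathbf z_C)=\frac{e^{Z_1}}{\sum_{l=1}^Ce^{Z_l}}\left(1-\frac{e^{Z_1}}{\sum_{l=1}^Ce^{Z_l}}\right),\qquad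 h_2(\mathbf z_C)=\frac{e^{Z_1+Z_2}}{\left(\sum_{l=1}^Ce^{Z_l}\right)^2}.$$ Furthermore, $$\lim_{C\to\infty}C^2g_{ii}(\gamma,C)=\gamma e+1,\qquad \lim_{C\to\infty}C^4g_{ij}(\gamma,C)=\gamma e^2+1.$$
   Context: $\|\cdot\|_{\mathrm F}$ is the Frobenius norm and $[C]=\{1,\dots,C\}$. For data $x_n\in\mathbb{R}^d$ with labels $y_n\in[C]$, the cross-entropy loss of the linear model $x\mapsto Vx$ is $\ell_{\mathrm{CE}}(V)=-\frac1N\sum_{n=1}^N\log\left(\frac{\exp(v_{y_n}^\top x_n)}{\sum_{c=1}^C\exp(v_c^\top x_n)}\right)$. With $p_{n,i}=\exp(v_i^\top x_n)/\sum_{c=1}^C\exp(v_c^\top x_n)$, its Hessian blocks (which do not depend on the labels) are the $d\times d$ matrices $$\frac{\partial^2\ell_{\mathrm{CE}}(V)}{\partial v_i\partial v_i^\top}=\frac1N\sum_{n=1}^Np_{n,i}(1-p_{n,i})x_nx_n^\top,\qquad \frac{\partial^2\ell_{\mathrm{CE}}(V)}{\partial v_i\partial v_j^\top}=-\frac1N\sum_{n=1}^Np_{n,i}p_{n,j}x_nx_n^\top\quad(i\ne j).$$ All random matrices, for all $d,N$, are defined on a common probability space. *)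

theory Defs
  imports "HOL-Probability.Probability"
begin

text \<open>
  Since the dimensions \<open>d\<close> and \<open>N\<close> tend to infinity, vectors and matrices are functions on \<open>nat\<close>
  of which only the entries with indices in \<open>{1..d}\<close>, \<open>{1..N}\<close>, \<open>{1..C}\<close> are ever used.
  A data set is a function \<open>x\<close> with \<open>x n k\<close> the \<open>k\<close>-th coordinate of \<open>x\<^sub>n\<close>; that is, the data
  matrix is stored by columns. A parameter matrix \<open>V\<close> is stored by rows, \<open>V c\<close> being \<open>v\<^sub>c\<close>.
\<close>

definition frobenius_norm :: "nat \<Rightarrow> nat \<Rightarrow> (nat \<Rightarrow> nat \<Rightarrow> real) \<Rightarrow> real" where
  "frobenius_norm m n A = sqrt (\<Sum>a\<in>{1..m}. \<Sum>b\<in>{1..n}. (A a b)\<^sup>2)"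

definition dot :: "nat \<Rightarrow> (nat \<Rightarrow> real) \<Rightarrow> (nat \<Rightarrow> real) \<Rightarrow> real" where
  "dot d v x = (\<Sum>k\<in>{1..d}. v k * x k)"

definition softmax_prob ::
  "nat \<Rightarrow> nat \<Rightarrow> (nat \<Rightarrow> nat \<Rightarrow> real) \<Rightarrow> (nat \<Rightarrow> real) \<Rightarrow> nat \<Rightarrow> real" where
  "softmax_prob C d V x i = exp (dot d (V i) x) / (\<Sum>c\<in>{1..C}. exp (dot d (V c) x))"

definition ce_loss ::
  "nat \<Rightarrow> nat \<Rightarrow> nat \<Rightarrow> (nat \<Rightarrow> nat \<Rightarrow> real) \<Rightarrow> (nat \<Rightarrow> nat) \<Rightarrow> (nat \<Rightarrow> nat \<Rightarrow> real) \<Rightarrow> real" where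
  "ce_loss C d N x y V =
     - (1 / real N) * (\<Sum>n\<in>{1..N}. ln (exp (dot d (V (y n)) (x n)) /
                                        (\<Sum>c\<in>{1..C}. exp (dot d (V c) (x n)))))"

text \<open>The partial derivative of \<open>f\<close> with respect to the entry \<open>(i, a)\<close> of its matrix argument.\<close>

definition entry_deriv ::
  "nat \<Rightarrow> nat \<Rightarrow> ((nat \<Rightarrow> nat \<Rightarrow> real) \<Rightarrow> real) \<Rightarrow> (nat \<Rightarrow> nat \<Rightarrow> real) \<Rightarrow> real" where
  "entry_deriv i a f V = deriv (\<lambda>t. f (V(i := (V i)(a := t)))) (V i a)"

text \<open>The Hessian block with respect to the rows \<open>v\<^sub>i\<close> and \<open>v\<^sub>j\<close>.\<close>

definition hessian_block ::
  "((nat \<Rightarrow> nat \<Rightarrow> real) \<Rightarrow> real) \<Rightarrow> (nat \<Rightarrow> nat \<Rightarrow> real) \<Rightarrow> nat \<Rightarrow> nat \<Rightarrow> nat \<Rightarrow> nat \<Rightarrow> real" where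
  "hessian_block f V i j = (\<lambda>a b. entry_deriv i a (entry_deriv j b f) V)"

text \<open>
  \<open>deriv\<close> is total, so the following facts confirm that for the cross-entropy loss the iterated
  partial derivatives exist and give the usual closed form.
\<close>

lemma dot_upd:
  assumes "a \<in> {1..d}"
  shows "dot d ((V(i := (V i)(a := t))) c) x =
         dot d (V c) x + (if c = i then (t - V i a) * x a else 0)"
proof (cases "c = i")
  case True
  have "dot d ((V i)(a := t)) x = t * x a + (\<Sum>k\<in>{1..d} - {a}. V i k * x k)"
    unfolding dot_def using assms by (subst sum.remove[of _ a]) auto
  moreover have "dot d (V i) x = V i a * x a + (\<Sum>k\<in>{1..d} - {a}. V i k * x k)"
    unfolding dot_def using assms by (subst sum.remove[of _ a]) auto
  ultimately show ?thesis using True by (simp add: algebra_simps)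
qed simp

lemma has_deriv_dot_upd:
  assumes "a \<in> {1..d}"
  shows "((\<lambda>t. dot d ((V(i := (V i)(a := t))) c) x) has_real_derivative
           (if c = i then x a else 0)) (at t)"
  unfolding dot_upd[OF assms] by (auto intro!: derivative_eq_intros)

lemma has_deriv_sum_exp_upd:
  fixes C :: nat
  assumes a: "a \<in> {1..d}" and i: "i \<in> {1..C}"
  shows "((\<lambda>t. \<Sum>c\<in>{1..C}. exp (dot d ((V(i := (V i)(a := t))) c) x)) has_real_derivative
           exp (dot d (V i) x) * x a) (at (V i a))"
proof -
  have V: "V(i := (V i)(a := V i a)) = V" by simp
  have "((\<lambda>t. \<Sum>c\<in>{1..C}. exp (dot d ((V(i := (V i)(a := t))) c) x)) has_real_derivative
      (\<Sum>c\<in>{1..C}. exp (dot d ((V(i := (V i)(a := V i a))) c) x) * (if c = i then x a else 0)))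
      (at (V i a))"
    by (intro DERIV_sum DERIV_fun_exp has_deriv_dot_upd a)
  also have "(\<Sum>c\<in>{1..C}. exp (dot d ((V(i := (V i)(a := V i a))) c) x) * (if c = i then x a else 0))
      = (\<Sum>c\<in>{1..C}. if c = i then exp (dot d (V i) x) * x a else 0)"
    unfolding V by (intro sum.cong) auto
  also have "\<dots> = exp (dot d (V i) x) * x a"
    using i by simp
  finally show ?thesis .
qed

lemma sum_exp_pos: "i \<in> {1..C} \<Longrightarrow> 0 < (\<Sum>c\<in>{1..C::nat}. exp (f c :: real))"
  by (rule sum_pos) auto

lemma ce_loss_has_deriv:
  assumes a: "a \<in> {1..d}" and i: "i \<in> {1..C}"
  shows "((\<lambda>t. ce_loss C d N x y (V(i := (V i)(a := t)))) has_real_derivative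
           - (1 / real N) * (\<Sum>n\<in>{1..N}. ((if y n = i then 1 else 0) - softmax_prob C d V (x n) i) * x n a))
         (at (V i a))"
proof -
  have V: "V(i := (V i)(a := V i a)) = V" by simp
  note S = sum_exp_pos[OF i]
  have eq: "ln (exp (dot d (W (y n)) (x n)) / (\<Sum>c\<in>{1..C}. exp (dot d (W c) (x n)))) =
      dot d (W (y n)) (x n) - ln (\<Sum>c\<in>{1..C}. exp (dot d (W c) (x n)))" for W n
    using S[of "\<lambda>c. dot d (W c) (x n)"] by (subst ln_div) auto
  have D: "((\<lambda>t. dot d ((V(i := (V i)(a := t))) (y n)) (x n)
            - ln (\<Sum>c\<in>{1..C}. exp (dot d ((V(i := (V i)(a := t))) c) (x n)))) has_real_derivative
          ((if y n = i then 1 else 0) - softmax_prob C d V (x n) i) * x n a) (at (V i a))" for n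
  proof -
    have "((\<lambda>t. ln (\<Sum>c\<in>{1..C}. exp (dot d ((V(i := (V i)(a := t))) c) (x n)))) has_real_derivative
        1 / (\<Sum>c\<in>{1..C}. exp (dot d ((V(i := (V i)(a := V i a))) c) (x n))) *
        (exp (dot d (V i) (x n)) * x n a)) (at (V i a))"
      by (rule DERIV_chain2[OF DERIV_ln_divide has_deriv_sum_exp_upd[OF a i]]) (rule S)
    from DERIV_diff[OF has_deriv_dot_upd[OF a] this]
    show ?thesis
      unfolding V by (rule DERIV_cong) (simp add: softmax_prob_def algebra_simps)
  qed
  show ?thesis
    unfolding ce_loss_def eq by (intro DERIV_cmult DERIV_sum D)
qed

lemma entry_deriv_ce_loss:
  assumes "a \<in> {1..d}" "i \<in> {1..C}"
  shows "entry_deriv i a (ce_loss C d N x y) =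
    (\<lambda>V. - (1 / real N) * (\<Sum>n\<in>{1..N}. ((if y n = i then 1 else 0) - softmax_prob C d V (x n) i) * x n a))"
  unfolding entry_deriv_def using DERIV_imp_deriv[OF ce_loss_has_deriv[OF assms]] by (intro ext)

lemma softmax_prob_has_deriv:
  assumes a: "a \<in> {1..d}" and i: "i \<in> {1..C}"
  shows "((\<lambda>t. softmax_prob C d (V(i := (V i)(a := t))) x j) has_real_derivative
           softmax_prob C d V x j * ((if j = i then 1 else 0) - softmax_prob C d V x i) * x a)
         (at (V i a))"
proof -
  have V: "V(i := (V i)(a := V i a)) = V" by simp
  have S: "(\<Sum>c\<in>{1..C}. exp (dot d (V c) x)) \<noteq> 0"
    using sum_exp_pos[OF i, of "\<lambda>c. dot d (V c) x"] by linarith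
  have E: "((\<lambda>t. exp (dot d ((V(i := (V i)(a := t))) j) x)) has_real_derivative
      exp (dot d ((V(i := (V i)(a := V i a))) j) x) * (if j = i then x a else 0)) (at (V i a))"
    by (intro DERIV_fun_exp has_deriv_dot_upd a)
  show ?thesis
    unfolding softmax_prob_def
    by (rule DERIV_cong[OF DERIV_divide[OF E has_deriv_sum_exp_upd[OF a i, of V x]]], unfold V)
       (use S in \<open>auto simp: field_simps\<close>)
qed

lemma entry_deriv_ce_loss_has_deriv:
  assumes a: "a \<in> {1..d}" and b: "b \<in> {1..d}" and i: "i \<in> {1..C}" and j: "j \<in> {1..C}"
  shows "((\<lambda>t. entry_deriv j b (ce_loss C d N x y) (V(i := (V i)(a := t)))) has_real_derivative
    (1 / real N) * (\<Sum>n\<in>{1..N}. softmax_prob C d V (x n) j *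
        ((if j = i then 1 else 0) - softmax_prob C d V (x n) i) * x n a * x n b)) (at (V i a))"
proof -
  have "((\<lambda>t. - (1 / real N) * (\<Sum>n\<in>{1..N}. ((if y n = j then 1 else 0)
            - softmax_prob C d (V(i := (V i)(a := t))) (x n) j) * x n b)) has_real_derivative
    - (1 / real N) * (\<Sum>n\<in>{1..N}. (0 - softmax_prob C d V (x n) j *
        ((if j = i then 1 else 0) - softmax_prob C d V (x n) i) * x n a) * x n b)) (at (V i a))"
    by (intro DERIV_cmult DERIV_sum DERIV_cmult_right DERIV_diff DERIV_const
          softmax_prob_has_deriv a i)
  then show ?thesis
    unfolding entry_deriv_ce_loss[OF b j]
    by (rule DERIV_cong) (simp add: sum_negf)
qed

lemma hessian_block_ce_loss_diag:
  assumes "a \<in> {1..d}" "b \<in> {1..d}" "i \<in> {1..C}"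
  shows "hessian_block (ce_loss C d N x y) V i i a b =
    (1 / real N) * (\<Sum>n\<in>{1..N}. softmax_prob C d V (x n) i * (1 - softmax_prob C d V (x n) i)
                                  * x n a * x n b)"
  unfolding hessian_block_def entry_deriv_def[of i a]
  using DERIV_imp_deriv[OF entry_deriv_ce_loss_has_deriv[OF assms(1,2,3,3), of N x y V]] by simp

lemma hessian_block_ce_loss_off_diag:
  assumes "a \<in> {1..d}" "b \<in> {1..d}" "i \<in> {1..C}" "j \<in> {1..C}" "i \<noteq> j"
  shows "hessian_block (ce_loss C d N x y) V i j a b =
    - (1 / real N) * (\<Sum>n\<in>{1..N}. softmax_prob C d V (x n) i * softmax_prob C d V (x n) j
                                    * x n a * x n b)"
  unfolding hessian_block_def entry_deriv_def[of i a]
  using DERIV_imp_deriv[OF entry_deriv_ce_loss_has_deriv[OF assms(1-4), of N x y V]] assms(5)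
  by (simp add: sum_negf mult.commute mult.left_commute)

definition (in prob_space) iid_gaussian_matrix ::
  "nat \<Rightarrow> nat \<Rightarrow> real \<Rightarrow> ('a \<Rightarrow> nat \<Rightarrow> nat \<Rightarrow> real) \<Rightarrow> bool" where
  "iid_gaussian_matrix m n \<sigma> W \<longleftrightarrow>
     (\<forall>r\<in>{1..m}. \<forall>s\<in>{1..n}. distributed M lborel (\<lambda>\<omega>. W \<omega> r s) (normal_density 0 \<sigma>)) \<and>
     indep_vars (\<lambda>_. borel) (\<lambda>(r, s) \<omega>. W \<omega> r s) ({1..m} \<times> {1..n})"

text \<open>The relevant entries of a random matrix, as an element of a finite product space.\<close>

definition matrix_entries ::
  "nat \<Rightarrow> nat \<Rightarrow> (nat \<Rightarrow> nat \<Rightarrow> real) \<Rightarrow> (nat \<times> nat \<Rightarrow> real)" where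
  "matrix_entries m n A = restrict (\<lambda>(r, s). A r s) ({1..m} \<times> {1..n})"

definition (in prob_space) indep_matrices ::
  "nat \<Rightarrow> nat \<Rightarrow> ('a \<Rightarrow> nat \<Rightarrow> nat \<Rightarrow> real) \<Rightarrow> nat \<Rightarrow> nat \<Rightarrow> ('a \<Rightarrow> nat \<Rightarrow> nat \<Rightarrow> real) \<Rightarrow> bool" where
  "indep_matrices m n W m' n' W' \<longleftrightarrow>
     indep_var (PiM ({1..m} \<times> {1..n}) (\<lambda>_. borel)) (\<lambda>\<omega>. matrix_entries m n (W \<omega>))
               (PiM ({1..m'} \<times> {1..n'}) (\<lambda>_. borel)) (\<lambda>\<omega>. matrix_entries m' n' (W' \<omega>))"

definition std_gaussian :: "nat \<Rightarrow> (nat \<Rightarrow> real) measure" where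
  "std_gaussian C = PiM {1..C} (\<lambda>_. density lborel std_normal_density)"

definition h1 :: "nat \<Rightarrow> (nat \<Rightarrow> real) \<Rightarrow> real" where
  "h1 C z = exp (z 1) / (\<Sum>l\<in>{1..C}. exp (z l)) * (1 - exp (z 1) / (\<Sum>l\<in>{1..C}. exp (z l)))"

definition h2 :: "nat \<Rightarrow> (nat \<Rightarrow> real) \<Rightarrow> real" where
  "h2 C z = exp (z 1 + z 2) / (\<Sum>l\<in>{1..C}. exp (z l))\<^sup>2"

definition g_diag :: "real \<Rightarrow> nat \<Rightarrow> real" where
  "g_diag \<gamma> C = \<gamma> * (\<integral>z. (h1 C z)\<^sup>2 \<partial>std_gaussian C) + (\<integral>z. h1 C z \<partial>std_gaussian C)\<^sup>2"

definition g_off :: "real \<Rightarrow> nat \<Rightarrow> real" where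
  "g_off \<gamma> C = \<gamma> * (\<integral>z. (h2 C z)\<^sup>2 \<partial>std_gaussian C) + (\<integral>z. h2 C z \<partial>std_gaussian C)\<^sup>2"

end

theory Submission
  imports Defs
begin

text \<open>
  With \<open>a\<^sub>n\<close> the softmax weight of \<open>x\<^sub>n\<close>, the squared Frobenius norm of a block divided by \<open>d\<close> is
  \<open>(d N\<^sup>2)\<^sup>-\<^sup>1 \<Sum>\<^sub>n\<^sub>,\<^sub>m a\<^sub>n a\<^sub>m (x\<^sub>n \<bullet> x\<^sub>m)\<^sup>2\<close>. Given \<open>V\<close>, the columns \<open>x\<^sub>n\<close> are independent and dropping one of them
  changes this by \<open>O(1/N)\<close>, so a martingale argument bounds the sixth central moment by \<open>O(N\<^sup>-\<^sup>3)\<close>. The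
  conditional mean is \<open>(d/N) E[a\<^sup>2 | V] + E[a | V]\<^sup>2\<close> up to \<open>O(1 / sqrt d)\<close>: the correlation of \<open>a\<^sub>n a\<^sub>m\<close> with
  \<open>(x\<^sub>n \<bullet> x\<^sub>m)\<^sup>2\<close> is the squared norm of the second Hermite coefficients of \<open>a\<close>, which Bessel's inequality
  bounds by \<open>2\<close>. The same martingale bound, now over the columns of \<open>V\<close>, shows that \<open>E[a | V]\<close> and
  \<open>E[a\<^sup>2 | V]\<close> concentrate; their means are computed by integrating over \<open>V\<close> first, because for fixed \<open>x\<close>
  the logits are i.i.d. \<open>\<N>(0, |x|\<^sup>2/d)\<close>. For \<open>C \<rightarrow> \<infinity>\<close> one replaces \<open>C\<^sup>-\<^sup>1 \<Sum>\<^sub>l exp Z\<^sub>l\<close> by its mean \<open>exp (1/2)\<close>.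
\<close>

subsection \<open>Sixth moments on product spaces\<close>

text \<open>The two summands of the limit come from the two kinds of index pairs. For n = m the term
  is a_n^2 |x_n|^4, of order d^2, and N of them over d N^2 leave (d/N) E[a^2]. For distinct n and m,
  (x_n . x_m)^2 has mean d, and about N^2 pairs leave E[a]^2. The obstacle is that each weight
  depends on the very column that it multiplies, so the Gram matrix cannot be treated as independent
  of the weights. The mean is therefore handled by a dimension-free Bessel bound, and the
  fluctuations by leave-one-out comparison, which asks only how much a single column matters.
  Nothing relates the matrices for different (d, N), so almost sure convergence must come from
  summable moment bounds. Softmax enters only through bounded first and second differences, with a
  constant independent of C. This class is closed under products and under 1 - f, so diagonal
  blocks, off-diagonal blocks and squares of weights are all treated at once. Large numerical
  constants are merely rounded up.\<close>

definition L6 :: "'a measure \<Rightarrow> ('a \<Rightarrow> real) \<Rightarrow> bool" where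
  "L6 M f \<longleftrightarrow> f \<in> borel_measurable M \<and> integrable M (\<lambda>x. f x ^ 6)"

lemma power6_nonneg [simp]: "0 \<le> (x::real) ^ 6"
  using zero_le_power2[of "x ^ 3"] by simp

text \<open>Convexity of the sixth power: the quotient by \<open>(x - m)\<^sup>2\<close> is x^4 + 2
  x^3 m + 3 x^2 m^2 + 4 x m^3 + 5 m^4, which regroups as a sum of squares. This tangent line is the
  source of all sixth-power Jensen inequalities below, for two numbers, finite sums and
  integrals.\<close>

lemma power6_tangent: "m ^ 6 + 6 * m ^ 5 * (x - m) \<le> (x::real) ^ 6"
proof -
  have "x ^ 6 - m ^ 6 - 6 * m ^ 5 * (x - m) =
      (x - m)\<^sup>2 * ((x\<^sup>2 + x * m)\<^sup>2 + 2 * (x * m + m\<^sup>2)\<^sup>2 + 3 * (m\<^sup>2)\<^sup>2)"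
    by algebra
  also have "\<dots> \<ge> 0" by simp
  finally show ?thesis by simp
qed

lemma power6_add_le: "(a + b :: real) ^ 6 \<le> 32 * (a ^ 6 + b ^ 6)"
proof -
  \<comment> \<open>At the midpoint the two linear terms cancel; the constant is 2^6 / 2.\<close>
  define m where "m = (a + b) / 2"
  have ab: "a + b = 2 * m" by (simp add: m_def)
  have "6 * m ^ 5 * (a - m) + 6 * m ^ 5 * (b - m) = 6 * m ^ 5 * ((a + b) - 2 * m)"
    by (simp only: right_diff_distrib distrib_left)
  then have "6 * m ^ 5 * (a - m) + 6 * m ^ 5 * (b - m) = 0"
    by (simp add: ab)
  then have "2 * m ^ 6 \<le> a ^ 6 + b ^ 6"
    using power6_tangent[of m a] power6_tangent[of m b] by linarith
  then show ?thesis unfolding ab by (simp add: power_mult_distrib)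
qed

lemma power6_diff_le: "(a - b :: real) ^ 6 \<le> 32 * (a ^ 6 + b ^ 6)"
  using power6_add_le[of a "- b"] by simp

lemma abs_le_power6: "\<bar>x::real\<bar> \<le> 1 + x ^ 6"
proof (cases "\<bar>x\<bar> \<le> 1")
  case False
  then have "\<bar>x\<bar> ^ 1 \<le> \<bar>x\<bar> ^ 6" by (intro power_increasing) auto
  then show ?thesis by (simp add: power_even_abs)
next
  case True
  then show ?thesis using power6_nonneg[of x] by linarith
qed

lemma L6_bound:
  assumes "L6 M g" "f \<in> borel_measurable M" "\<And>x. x \<in> space M \<Longrightarrow> \<bar>f x\<bar> \<le> \<bar>g x\<bar>"
  shows "L6 M f"
proof -
  have "f x ^ 6 \<le> g x ^ 6" if "x \<in> space M" for x
    using power_mono[OF assms(3)[OF that], of 6] by (simp add: power_even_abs)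
  then show ?thesis
    using assms(1,2) unfolding L6_def
    by (auto intro!: Bochner_Integration.integrable_bound[of M "\<lambda>x. g x ^ 6"])
qed

lemma L6_add:
  assumes "L6 M f" "L6 M g" shows "L6 M (\<lambda>x. f x + g x)"
proof -
  have [measurable]: "f \<in> borel_measurable M" "g \<in> borel_measurable M"
    using assms by (auto simp: L6_def)
  have "integrable M (\<lambda>x. 32 * (f x ^ 6 + g x ^ 6))"
    using assms by (auto simp: L6_def)
  then have "integrable M (\<lambda>x. (f x + g x) ^ 6)"
    by (rule Bochner_Integration.integrable_bound)
       (use power6_add_le in \<open>auto simp del: distrib_left_numeral intro!: AE_I2\<close>)
  then show ?thesis by (simp add: L6_def)
qed

lemma L6_cmult: "L6 M f \<Longrightarrow> L6 M (\<lambda>x. c * f x)"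
  by (auto simp: L6_def power_mult_distrib)

lemma L6_diff: "L6 M f \<Longrightarrow> L6 M g \<Longrightarrow> L6 M (\<lambda>x. f x - g x)"
  using L6_add[of M f "\<lambda>x. -1 * g x"] L6_cmult[of M g "-1"] by simp

lemma (in prob_space) L6_const: "L6 M (\<lambda>x. c)"
  by (simp add: L6_def)

lemma (in prob_space) L6_integrable: "L6 M f \<Longrightarrow> integrable M f"
  unfolding L6_def
  by (rule Bochner_Integration.integrable_bound[of M "\<lambda>x. 1 + f x ^ 6"])
     (use abs_le_power6 in auto)

lemma (in prob_space) L6_jensen:
  fixes f :: "'a \<Rightarrow> real"
  assumes "integrable M f" "integrable M (\<lambda>x. f x ^ 6)"
  shows "(\<integral>x. f x \<partial>M) ^ 6 \<le> (\<integral>x. f x ^ 6 \<partial>M)"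
proof -
  define m where "m = (\<integral>x. f x \<partial>M)"
  have "(\<integral>x. m ^ 6 + 6 * m ^ 5 * (f x - m) \<partial>M) \<le> (\<integral>x. f x ^ 6 \<partial>M)"
    using assms by (intro integral_mono power6_tangent) auto
  also have "(\<integral>x. m ^ 6 + 6 * m ^ 5 * (f x - m) \<partial>M) = m ^ 6"
    using assms by (simp add: m_def prob_space)
  finally show ?thesis by (simp add: m_def)
qed

text \<open>The linear term \<open>a ^ 5 * b\<close> is kept exact because it will integrate to
  zero; all other mixed terms are pushed onto \<open>p ^ 4 * q\<^sup>2\<close> and
  \<open>q ^ 6\<close>. Facts 2, 3 and 4 give 39 = 15 + 10 + 14 and 18 = 1 + 3 + 14. Fact 5 trades a
  small multiple of the old moment for a large multiple of the increment, at a rate \<open>l\<close>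
  chosen later.\<close>

lemma power6_expand_le:
  fixes a b l :: real
  assumes "l > 0"
  shows "(a + b) ^ 6 \<le> (1 + 39 / l) * a ^ 6 + 6 * (a ^ 5 * b) + (39 * l\<^sup>2 + 18) * b ^ 6"
proof -
  define p q where "p = \<bar>a\<bar>" and "q = \<bar>b\<bar>"
  have pq: "p \<ge> 0" "q \<ge> 0" "a\<^sup>2 = p\<^sup>2" "b\<^sup>2 = q\<^sup>2" by (auto simp: p_def q_def)
  have e: "a ^ 4 = p ^ 4" "b ^ 4 = q ^ 4" "a ^ 6 = p ^ 6" "b ^ 6 = q ^ 6"
    by (auto simp: p_def q_def power_even_abs)
  have 1: "a ^ 3 * b ^ 3 \<le> p ^ 3 * q ^ 3" "a * b ^ 5 \<le> p * q ^ 5"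
    by (simp_all add: p_def q_def flip: abs_mult power_abs)
  have 2: "2 * (p ^ 3 * q ^ 3) \<le> p ^ 4 * q\<^sup>2 + p\<^sup>2 * q ^ 4"
  proof -
    have "p ^ 4 * q\<^sup>2 + p\<^sup>2 * q ^ 4 - 2 * (p ^ 3 * q ^ 3) = (p * q * (p - q))\<^sup>2" by algebra
    then show ?thesis using zero_le_power2[of "p * q * (p - q)"] by linarith
  qed
  have 3: "2 * (p\<^sup>2 * q ^ 4) \<le> p ^ 4 * q\<^sup>2 + q ^ 6"
  proof -
    have "p ^ 4 * q\<^sup>2 + q ^ 6 - 2 * (p\<^sup>2 * q ^ 4) = (q * (p\<^sup>2 - q\<^sup>2))\<^sup>2" by algebra
    then show ?thesis using zero_le_power2[of "q * (p\<^sup>2 - q\<^sup>2)"] by linarith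
  qed
  have 4: "2 * (p * q ^ 5) \<le> p\<^sup>2 * q ^ 4 + q ^ 6"
  proof -
    have "p\<^sup>2 * q ^ 4 + q ^ 6 - 2 * (p * q ^ 5) = (q\<^sup>2 * (p - q))\<^sup>2" by algebra
    then show ?thesis using zero_le_power2[of "q\<^sup>2 * (p - q)"] by linarith
  qed
  have 5: "p ^ 4 * q\<^sup>2 \<le> p ^ 6 / l + l\<^sup>2 * q ^ 6"
  proof (cases "q\<^sup>2 \<le> p\<^sup>2 / l")
    case True
    then have "p ^ 4 * q\<^sup>2 \<le> p ^ 4 * (p\<^sup>2 / l)" using pq by (intro mult_left_mono) auto
    also have "\<dots> = p ^ 6 / l" by (simp flip: power_add)
    also have "\<dots> \<le> p ^ 6 / l + l\<^sup>2 * q ^ 6" by simp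
    finally show ?thesis .
  next
    case False
    then have "p\<^sup>2 \<le> l * q\<^sup>2" using assms by (simp add: field_simps)
    then have "(p\<^sup>2)\<^sup>2 * q\<^sup>2 \<le> (l * q\<^sup>2)\<^sup>2 * q\<^sup>2" by (intro mult_right_mono power_mono) auto
    also have "\<dots> = l\<^sup>2 * q ^ 6" by algebra
    finally have "p ^ 4 * q\<^sup>2 \<le> l\<^sup>2 * q ^ 6" by (simp flip: power_mult)
    then show ?thesis using assms by (intro add_increasing) auto
  qed
  have "(a + b) ^ 6 = a ^ 6 + 6 * (a ^ 5 * b) + 15 * (a ^ 4 * b\<^sup>2) + 20 * (a ^ 3 * b ^ 3)
      + 15 * (a\<^sup>2 * b ^ 4) + 6 * (a * b ^ 5) + b ^ 6" by algebra
  also have "\<dots> \<le> p ^ 6 + 6 * (a ^ 5 * b) + 39 * (p ^ 4 * q\<^sup>2) + 18 * q ^ 6"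
    unfolding e pq(3,4) using 1 2 3 4 by linarith
  also have "\<dots> \<le> p ^ 6 + 6 * (a ^ 5 * b) + 39 * (p ^ 6 / l + l\<^sup>2 * q ^ 6) + 18 * q ^ 6"
    using mult_left_mono[OF 5, of 39] by simp
  finally have *: "(a + b) ^ 6 \<le> p ^ 6 + 6 * (a ^ 5 * b) + 39 * (p ^ 6 / l + l\<^sup>2 * q ^ 6) + 18 * q ^ 6" .
  have "(1 + 39 / l) * p ^ 6 = p ^ 6 + 39 * (p ^ 6 / l)"
    "(39 * l\<^sup>2 + 18) * q ^ 6 = 39 * (l\<^sup>2 * q ^ 6) + 18 * q ^ 6"
    by (simp_all add: distrib_right)
  \<comment> \<open>Monomials are replaced by variables, so that only linear arithmetic is
    left.\<close>
  moreover have "A + 6 * T + B \<ge> S"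
    if "S \<le> P + 6 * T + 39 * (R + U) + 18 * Q" "A = P + 39 * R" "B = 39 * U + 18 * Q"
    for S P T R U Q A B :: real using that by simp
  ultimately show ?thesis unfolding e using * by blast
qed

section \<open>One martingale step on a product of two probability spaces\<close>

context pair_prob_space
begin

text \<open>Jensen on fibres, then Fubini. The fibre inequality holds only almost everywhere,
  because sections of an integrable function are integrable only almost everywhere.\<close>

lemma L6_mean:
  assumes "L6 (M1 \<Otimes>\<^sub>M M2) F"
  shows "L6 M1 (\<lambda>x. \<integral>y. F (x, y) \<partial>M2)"
    and "(\<integral>x. (\<integral>y. F (x, y) \<partial>M2) ^ 6 \<partial>M1) \<le> (\<integral>z. F z ^ 6 \<partial>(M1 \<Otimes>\<^sub>M M2))"
proof -
  have F: "integrable (M1 \<Otimes>\<^sub>M M2) F" "integrable (M1 \<Otimes>\<^sub>M M2) (\<lambda>z. F z ^ 6)"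
    using P.L6_integrable[OF assms] assms by (simp_all add: L6_def)
  have [measurable]: "F \<in> borel_measurable (M1 \<Otimes>\<^sub>M M2)" using assms by (simp add: L6_def)
  have le: "AE x in M1. (\<integral>y. F (x, y) \<partial>M2) ^ 6 \<le> (\<integral>y. F (x, y) ^ 6 \<partial>M2)"
    using AE_integrable_fst'[OF F(1)] AE_integrable_fst'[OF F(2)]
    by eventually_elim (rule M2.L6_jensen)
  have i2: "integrable M1 (\<lambda>x. \<integral>y. F (x, y) ^ 6 \<partial>M2)" by (rule integrable_fst'[OF F(2)])
  have i1: "integrable M1 (\<lambda>x. (\<integral>y. F (x, y) \<partial>M2) ^ 6)"
    by (rule Bochner_Integration.integrable_bound[OF i2]) (use le in auto)
  then show "L6 M1 (\<lambda>x. \<integral>y. F (x, y) \<partial>M2)" by (simp add: L6_def)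
  have "(\<integral>x. (\<integral>y. F (x, y) \<partial>M2) ^ 6 \<partial>M1) \<le> (\<integral>x. (\<integral>y. F (x, y) ^ 6 \<partial>M2) \<partial>M1)"
    by (rule integral_mono_AE[OF i1 i2 le])
  also have "\<dots> = (\<integral>z. F z ^ 6 \<partial>(M1 \<Otimes>\<^sub>M M2))" by (rule integral_fst'[OF F(2)])
  finally show "(\<integral>x. (\<integral>y. F (x, y) \<partial>M2) ^ 6 \<partial>M1) \<le> (\<integral>z. F z ^ 6 \<partial>(M1 \<Otimes>\<^sub>M M2))" .
qed

lemma integrable_comp_fst:
  assumes "integrable M1 f" shows "integrable (M1 \<Otimes>\<^sub>M M2) (\<lambda>z. f (fst z) :: real)"
proof -
  have "integrable (distr (M1 \<Otimes>\<^sub>M M2) M1 fst) f" unfolding M2.distr_pair_fst by (rule assms)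
  then show ?thesis by (rule integrable_distr[rotated]) simp
qed

lemma integral_comp_fst:
  assumes "f \<in> borel_measurable M1" shows "(\<integral>z. f (fst z) \<partial>(M1 \<Otimes>\<^sub>M M2)) = (\<integral>x. f x \<partial>M1 :: real)"
  using integral_distr[of fst "M1 \<Otimes>\<^sub>M M2" M1 f, unfolded M2.distr_pair_fst] assms by simp

lemma L6_comp_fst: "L6 M1 f \<Longrightarrow> L6 (M1 \<Otimes>\<^sub>M M2) (\<lambda>z. f (fst z))"
  using integrable_comp_fst by (auto simp: L6_def)

text \<open>\<open>F - m\<close> splits into \<open>A\<close>, a function of the first coordinate,
  and the martingale difference \<open>D\<close>, whose mean on almost every fibre is zero. Hence
  \<open>A ^ 5 * D\<close> integrates to zero. The comparison function \<open>H\<close> may be any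
  \<open>L6\<close> function of the first coordinate, not just the fibre mean; this makes the
  hypothesis easy to verify.\<close>

lemma L6_step:
  assumes F: "L6 (M1 \<Otimes>\<^sub>M M2) F" and H: "L6 M1 H" and n: "n \<ge> 1"
    and delta: "(\<integral>z. (F z - H (fst z)) ^ 6 \<partial>(M1 \<Otimes>\<^sub>M M2)) \<le> \<delta>"
  shows "(\<integral>z. (F z - m) ^ 6 \<partial>(M1 \<Otimes>\<^sub>M M2))
       \<le> (1 + 1 / n) * (\<integral>x. ((\<integral>y. F (x, y) \<partial>M2) - m) ^ 6 \<partial>M1) + 4000000 * n\<^sup>2 * \<delta>"
proof -
  let ?P = "M1 \<Otimes>\<^sub>M M2"
  define Fb where "Fb = (\<lambda>x. \<integral>y. F (x, y) \<partial>M2)"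
  define A where "A = (\<lambda>z::'a \<times> 'b. Fb (fst z) - m)"
  define D where "D = (\<lambda>z. F z - Fb (fst z))"
  have Fb: "L6 M1 Fb" unfolding Fb_def by (rule L6_mean[OF F])
  have A: "L6 ?P A" unfolding A_def by (intro L6_diff L6_comp_fst Fb P.L6_const)
  have D: "L6 ?P D" unfolding D_def by (intro L6_diff L6_comp_fst Fb F)
  have [measurable]: "F \<in> borel_measurable ?P" "A \<in> borel_measurable ?P" "D \<in> borel_measurable ?P"
     "Fb \<in> borel_measurable M1" "H \<in> borel_measurable M1"
    using F A D Fb H by (auto simp: L6_def)
  have FH: "L6 ?P (\<lambda>z. F z - H (fst z))" by (intro L6_diff L6_comp_fst F H)
  have FbH: "L6 M1 (\<lambda>x. Fb x - H x)" by (intro L6_diff Fb H)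
  \<comment> \<open>\<open>D\<close> is \<open>F - H\<close> minus its own fibre mean. Both parts
    have sixth moment at most \<open>\<delta>\<close>, the second by Jensen, and
    \<open>power6_diff_le\<close> contributes 32, whence 64.\<close>
  have eD: "(\<integral>z. D z ^ 6 \<partial>?P) \<le> 64 * \<delta>"
  proof -
    have "AE x in M1. Fb x - H x = (\<integral>y. F (x, y) - H x \<partial>M2)"
      using AE_integrable_fst'[OF P.L6_integrable[OF F]]
      by eventually_elim (simp add: Fb_def M2.prob_space)
    then have "(\<integral>x. (Fb x - H x) ^ 6 \<partial>M1) = (\<integral>x. (\<integral>y. F (x, y) - H x \<partial>M2) ^ 6 \<partial>M1)"
      by (intro integral_cong_AE) auto
    also have "\<dots> \<le> (\<integral>z. (F z - H (fst z)) ^ 6 \<partial>?P)"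
      using L6_mean(2)[OF FH] by simp
    finally have 1: "(\<integral>x. (Fb x - H x) ^ 6 \<partial>M1) \<le> \<delta>" using delta by simp
    have 2: "(\<integral>z. (Fb (fst z) - H (fst z)) ^ 6 \<partial>?P) = (\<integral>x. (Fb x - H x) ^ 6 \<partial>M1)"
      by (rule integral_comp_fst) measurable
    have i: "integrable ?P (\<lambda>z. (F z - H (fst z)) ^ 6)" "integrable ?P (\<lambda>z. (Fb (fst z) - H (fst z)) ^ 6)"
      using FH L6_comp_fst[OF FbH] by (auto simp: L6_def)
    have "(\<integral>z. D z ^ 6 \<partial>?P) \<le> (\<integral>z. 32 * ((F z - H (fst z)) ^ 6 + (Fb (fst z) - H (fst z)) ^ 6) \<partial>?P)"
    proof (intro integral_mono)
      show "D z ^ 6 \<le> 32 * ((F z - H (fst z)) ^ 6 + (Fb (fst z) - H (fst z)) ^ 6)" for z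
        using power6_diff_le[of "F z - H (fst z)" "Fb (fst z) - H (fst z)"] by (simp add: D_def)
    qed (use D i in \<open>auto simp: L6_def\<close>)
    also have "\<dots> = 32 * ((\<integral>z. (F z - H (fst z)) ^ 6 \<partial>?P) + (\<integral>z. (Fb (fst z) - H (fst z)) ^ 6 \<partial>?P))"
      using i by simp
    also have "\<dots> \<le> 64 * \<delta>" using 1 2 delta by simp
    finally show ?thesis .
  qed
  have iAD: "integrable ?P (\<lambda>z. A z ^ 5 * D z)"
  proof (rule Bochner_Integration.integrable_bound)
    show "integrable ?P (\<lambda>z. A z ^ 6 + D z ^ 6)" using A D by (auto simp: L6_def)
    have "\<bar>a ^ 5 * b\<bar> \<le> a ^ 6 + b ^ 6" for a b :: real
    proof -
      have "max \<bar>a\<bar> \<bar>b\<bar> ^ 5 * max \<bar>a\<bar> \<bar>b\<bar> \<le> \<bar>a\<bar> ^ 6 + \<bar>b\<bar> ^ 6"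
        by (cases "\<bar>a\<bar> \<le> \<bar>b\<bar>") (simp_all add: max_def eval_nat_numeral)
      moreover have "\<bar>a\<bar> ^ 5 * \<bar>b\<bar> \<le> max \<bar>a\<bar> \<bar>b\<bar> ^ 5 * max \<bar>a\<bar> \<bar>b\<bar>"
        by (intro mult_mono power_mono) auto
      ultimately show ?thesis by (simp add: abs_mult power_abs power_even_abs)
    qed
    then show "AE z in ?P. norm (A z ^ 5 * D z) \<le> norm (A z ^ 6 + D z ^ 6)" by auto
  qed measurable
  have AD: "(\<integral>z. A z ^ 5 * D z \<partial>?P) = 0"
  proof -
    have "(\<integral>z. A z ^ 5 * D z \<partial>?P) = (\<integral>x. (\<integral>y. A (x, y) ^ 5 * D (x, y) \<partial>M2) \<partial>M1)"
      using integral_fst'[OF iAD] by simp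
    also have "\<dots> = (\<integral>x. 0 \<partial>M1)"
    proof (rule integral_cong_AE)
      show "AE x in M1. (\<integral>y. A (x, y) ^ 5 * D (x, y) \<partial>M2) = 0"
        using AE_integrable_fst'[OF P.L6_integrable[OF F]]
        by eventually_elim (simp add: A_def D_def Fb_def M2.prob_space)
    qed auto
    finally show ?thesis by simp
  qed
  \<comment> \<open>This choice turns \<open>39 / l\<close> into \<open>1 / n\<close>.\<close>
  define l where "l = 39 * n"
  have l: "l > 0" using n by (simp add: l_def)
  have iA: "integrable ?P (\<lambda>z. A z ^ 6)" and iD: "integrable ?P (\<lambda>z. D z ^ 6)"
    using A D by (auto simp: L6_def)
  have "(\<integral>z. (F z - m) ^ 6 \<partial>?P) \<le>
     (\<integral>z. (1 + 39 / l) * A z ^ 6 + 6 * (A z ^ 5 * D z) + (39 * l\<^sup>2 + 18) * D z ^ 6 \<partial>?P)"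
  proof (rule integral_mono)
    show "integrable ?P (\<lambda>z. (F z - m) ^ 6)"
      using L6_diff[OF F P.L6_const[of m]] by (simp add: L6_def)
    show "(F z - m) ^ 6 \<le> (1 + 39 / l) * A z ^ 6 + 6 * (A z ^ 5 * D z) + (39 * l\<^sup>2 + 18) * D z ^ 6" for z
      using power6_expand_le[OF l, of "A z" "D z"] by (simp add: A_def D_def)
  qed (use iA iD iAD in auto)
  also have "\<dots> = (1 + 1 / n) * (\<integral>z. A z ^ 6 \<partial>?P) + (39 * l\<^sup>2 + 18) * (\<integral>z. D z ^ 6 \<partial>?P)"
    using iA iD iAD AD by (simp add: l_def)
  also have "(\<integral>z. A z ^ 6 \<partial>?P) = (\<integral>x. (Fb x - m) ^ 6 \<partial>M1)"
    unfolding A_def by (rule integral_comp_fst) measurable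
  \<comment> \<open>39 * 39^2 + 18 = 59337, and 59337 * 64 is below 4000000.\<close>
  also have "(39 * l\<^sup>2 + 18) * (\<integral>z. D z ^ 6 \<partial>?P) \<le> (59337 * n\<^sup>2) * (64 * \<delta>)"
  proof (rule mult_mono)
    have "1 \<le> n\<^sup>2" using n by (simp add: one_le_power)
    then show "39 * l\<^sup>2 + 18 \<le> 59337 * n\<^sup>2" by (simp add: l_def power_mult_distrib)
  qed (use eD in auto)
  also have "\<dots> \<le> 4000000 * n\<^sup>2 * \<delta>"
  proof -
    have "0 \<le> \<delta>" using delta by (rule order_trans[rotated]) simp
    then have "0 \<le> n\<^sup>2 * \<delta>" by simp
    then show ?thesis by (simp add: algebra_simps)
  qed
  finally show ?thesis by (simp add: Fb_def)
qed

end

text \<open>Puts the new coordinate last, where \<open>L6_step\<close> expects the variable to be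
  averaged out.\<close>

lemma distr_pair_PiM_insert:
  assumes "prob_space P"
  shows "distr (Pi\<^sub>M I (\<lambda>_. P) \<Otimes>\<^sub>M P) (Pi\<^sub>M (insert i I) (\<lambda>_. P)) (\<lambda>(X, y). X(i := y)) = Pi\<^sub>M (insert i I) (\<lambda>_. P)"
proof -
  interpret P: prob_space P by fact
  interpret Q: prob_space "Pi\<^sub>M I (\<lambda>_. P)" by (intro prob_space_PiM assms)
  interpret pair_sigma_finite "Pi\<^sub>M I (\<lambda>_. P)" P ..
  have "distr (Pi\<^sub>M I (\<lambda>_. P) \<Otimes>\<^sub>M P) (Pi\<^sub>M (insert i I) (\<lambda>_. P)) (\<lambda>(X, y). X(i := y)) =
     distr (distr (P \<Otimes>\<^sub>M Pi\<^sub>M I (\<lambda>_. P)) (Pi\<^sub>M I (\<lambda>_. P) \<Otimes>\<^sub>M P) (\<lambda>(x, y). (y, x)))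
       (Pi\<^sub>M (insert i I) (\<lambda>_. P)) (\<lambda>(X, y). X(i := y))"
    using distr_pair_swap by simp
  also have "\<dots> = distr (P \<Otimes>\<^sub>M Pi\<^sub>M I (\<lambda>_. P)) (Pi\<^sub>M (insert i I) (\<lambda>_. P)) (\<lambda>(y, X). X(i := y))"
    by (subst distr_distr) (auto simp: comp_def split_beta intro!: arg_cong2[where f="distr _"])
  also have "\<dots> = Pi\<^sub>M (insert i I) (\<lambda>_. P)"
    by (rule distr_pair_PiM_eq_PiM) (auto intro: assms)
  finally show ?thesis .
qed

text \<open>A Burkholder-type bound with leave-one-out hypotheses. Integrating out one coordinate at
  a time gives the recursion M(c+1) \<le> (1 + 1/c) M(c) + K c^2 \<delta> with K = 4000000, and K
  c^3 \<delta> solves it since c^3 + 2 c^2 \<le> (c+1)^3. Not depending on coordinate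
  \<open>k\<close> is expressed by updates \<open>x(k := t)\<close> instead of a smaller product
  space, so the hypothesis passes to marginals without reindexing.\<close>

lemma PiM_sixth_moment:
  fixes P :: "'b measure" and F :: "('i \<Rightarrow> 'b) \<Rightarrow> real"
  assumes "finite I" "prob_space P" "L6 (Pi\<^sub>M I (\<lambda>_. P)) F"
    and "\<And>k. k \<in> I \<Longrightarrow> \<exists>G. L6 (Pi\<^sub>M I (\<lambda>_. P)) G \<and>
        (\<forall>x\<in>space (Pi\<^sub>M I (\<lambda>_. P)). \<forall>t\<in>space P. G (x(k := t)) = G x) \<and>
        (\<integral>x. (F x - G x) ^ 6 \<partial>Pi\<^sub>M I (\<lambda>_. P)) \<le> \<delta>"
  shows "(\<integral>x. (F x - (\<integral>x. F x \<partial>Pi\<^sub>M I (\<lambda>_. P))) ^ 6 \<partial>Pi\<^sub>M I (\<lambda>_. P)) \<le> 4000000 * real (card I) ^ 3 * \<delta>"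
  using assms(1,3,4)
proof (induction I arbitrary: F rule: finite_induct)
  case empty
  interpret E: prob_space "Pi\<^sub>M {} (\<lambda>_. P) :: ('i \<Rightarrow> 'b) measure" by (intro prob_space_PiM assms)
  have F0: "F x = F (\<lambda>_. undefined)" if "x \<in> space (Pi\<^sub>M {} (\<lambda>_. P))" for x
    using that by (simp add: space_PiM_empty)
  have "(\<integral>x. F x \<partial>Pi\<^sub>M {} (\<lambda>_. P)) = (\<integral>x. F (\<lambda>_. undefined) \<partial>(Pi\<^sub>M {} (\<lambda>_. P) :: ('i \<Rightarrow> 'b) measure))"
    by (rule Bochner_Integration.integral_cong[OF refl]) (rule F0)
  then have *: "(\<integral>x. F x \<partial>Pi\<^sub>M {} (\<lambda>_. P)) = F (\<lambda>_. undefined)" by (simp add: E.prob_space)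
  have "(\<integral>x. (F x - (\<integral>x. F x \<partial>Pi\<^sub>M {} (\<lambda>_. P))) ^ 6 \<partial>Pi\<^sub>M {} (\<lambda>_. P)) = 0"
    unfolding * by (intro integral_eq_zero_AE AE_I2) (simp add: space_PiM_empty)
  then show ?case by simp
next
  case (insert i I)
  let ?Q = "Pi\<^sub>M I (\<lambda>_. P)" and ?J = "Pi\<^sub>M (insert i I) (\<lambda>_. P)"
  interpret P: prob_space P by fact
  interpret Q: prob_space ?Q by (intro prob_space_PiM assms)
  interpret J: prob_space ?J by (intro prob_space_PiM assms)
  interpret pp: pair_prob_space ?Q P ..
  define u where "u = (\<lambda>z::('i \<Rightarrow> 'b) \<times> 'b. (fst z)(i := snd z))"
  have u_meas [measurable]: "u \<in> measurable (?Q \<Otimes>\<^sub>M P) ?J" unfolding u_def by measurable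
  have du: "distr (?Q \<Otimes>\<^sub>M P) ?J u = ?J"
    using distr_pair_PiM_insert[OF assms(2), of I i] by (simp add: u_def split_beta')
  have L6u: "L6 (?Q \<Otimes>\<^sub>M P) (\<lambda>z. G (u z))" if "L6 ?J G" for G
  proof -
    have "integrable (distr (?Q \<Otimes>\<^sub>M P) ?J u) (\<lambda>x. G x ^ 6)" unfolding du using that by (simp add: L6_def)
    then have "integrable (?Q \<Otimes>\<^sub>M P) (\<lambda>z. G (u z) ^ 6)" by (rule integrable_distr[rotated]) simp
    then show ?thesis using that by (auto simp: L6_def)
  qed
  have Iu: "(\<integral>x. f x \<partial>?J) = (\<integral>z. f (u z) \<partial>(?Q \<Otimes>\<^sub>M P))" if "f \<in> borel_measurable ?J" for f :: "_ \<Rightarrow> real"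
    using integral_distr[OF u_meas that] du by simp
  have FJ: "L6 ?J F" by (rule insert.prems)
  then have [measurable]: "F \<in> borel_measurable ?J" by (simp add: L6_def)
  define m where "m = (\<integral>x. F x \<partial>?J)"
  define Fb where "Fb = (\<lambda>x. \<integral>y. F (u (x, y)) \<partial>P)"
  note Fu = L6u[OF FJ]
  have Fb: "L6 ?Q Fb" unfolding Fb_def by (rule pp.L6_mean(1)[OF Fu])
  have m: "m = (\<integral>x. Fb x \<partial>?Q)"
    unfolding m_def Fb_def by (subst Iu) (auto intro: pp.integral_fst'[OF pp.P.L6_integrable[OF Fu], symmetric])
  have upd: "u (x, y) \<in> space ?J" if "x \<in> space ?Q" "y \<in> space P" for x y
    using measurable_space[OF u_meas, of "(x, y)"] that by (simp add: space_pair_measure)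
  have IH: "(\<integral>x. (Fb x - m) ^ 6 \<partial>?Q) \<le> 4000000 * real (card I) ^ 3 * \<delta>"
    unfolding m
  proof (rule insert.IH[OF Fb])
    fix k assume k: "k \<in> I"
    then have "k \<in> insert i I" by simp
    from insert.prems(2)[OF this] obtain G where G: "L6 ?J G"
        "\<And>x t. x \<in> space ?J \<Longrightarrow> t \<in> space P \<Longrightarrow> G (x(k := t)) = G x"
        "(\<integral>x. (F x - G x) ^ 6 \<partial>?J) \<le> \<delta>" by blast
    have [measurable]: "G \<in> borel_measurable ?J" using G by (simp add: L6_def)
    \<comment> \<open>Averaging \<open>G\<close> in the same way as \<open>F\<close> preserves
      closeness, by Jensen, and also the indifference to coordinate \<open>k\<close>, because
      \<open>k\<close> is not the coordinate being averaged.\<close>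
    define Gb where "Gb = (\<lambda>x. \<integral>y. G (u (x, y)) \<partial>P)"
    note Gu = L6u[OF G(1)]
    have Gb: "L6 ?Q Gb" unfolding Gb_def by (rule pp.L6_mean(1)[OF Gu])
    have [measurable]: "Fb \<in> borel_measurable ?Q" "Gb \<in> borel_measurable ?Q"
      using Fb Gb by (auto simp: L6_def)
    have "AE x in ?Q. (Fb x - Gb x) ^ 6 = (\<integral>y. F (u (x, y)) - G (u (x, y)) \<partial>P) ^ 6"
      using pp.AE_integrable_fst'[OF pp.P.L6_integrable[OF Fu]] pp.AE_integrable_fst'[OF pp.P.L6_integrable[OF Gu]]
      by eventually_elim (simp add: Fb_def Gb_def)
    then have "(\<integral>x. (Fb x - Gb x) ^ 6 \<partial>?Q) = (\<integral>x. (\<integral>y. F (u (x, y)) - G (u (x, y)) \<partial>P) ^ 6 \<partial>?Q)"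
      by (intro integral_cong_AE) auto
    also have "\<dots> \<le> (\<integral>z. (F (u z) - G (u z)) ^ 6 \<partial>(?Q \<Otimes>\<^sub>M P))"
      by (rule pp.L6_mean(2)[OF L6_diff[OF Fu Gu]])
    also have "\<dots> = (\<integral>x. (F x - G x) ^ 6 \<partial>?J)" by (rule Iu[symmetric]) measurable
    finally have "(\<integral>x. (Fb x - Gb x) ^ 6 \<partial>?Q) \<le> \<delta>" using G(3) by simp
    moreover have "Gb (x(k := t)) = Gb x" if "x \<in> space ?Q" "t \<in> space P" for x t
      unfolding Gb_def
    proof (intro Bochner_Integration.integral_cong refl)
      fix y assume "y \<in> space P"
      moreover have "u (x(k := t), y) = (u (x, y))(k := t)"
        using k insert.hyps by (auto simp: u_def)
      ultimately show "G (u (x(k := t), y)) = G (u (x, y))"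
        using G(2)[OF upd[OF that(1)] that(2)] by simp
    qed
    ultimately show "\<exists>G. L6 ?Q G \<and> (\<forall>x\<in>space ?Q. \<forall>t\<in>space P. G (x(k := t)) = G x) \<and>
        (\<integral>x. (Fb x - G x) ^ 6 \<partial>?Q) \<le> \<delta>"
      using Gb by blast
  qed
  from insert.prems(2)[of i] obtain G where G: "L6 ?J G"
      "\<And>x t. x \<in> space ?J \<Longrightarrow> t \<in> space P \<Longrightarrow> G (x(i := t)) = G x"
      "(\<integral>x. (F x - G x) ^ 6 \<partial>?J) \<le> \<delta>" by blast
  \<comment> \<open>\<open>G\<close> ignores coordinate \<open>i\<close>, so freezing it at any
    value exhibits \<open>G\<close> as a function \<open>H\<close> of the remaining
    coordinates.\<close>
  obtain t0 where t0: "t0 \<in> space P" using P.not_empty by blast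
  define H where "H = (\<lambda>x. G (u (x, t0)))"
  have [measurable]: "G \<in> borel_measurable ?J" using G by (simp add: L6_def)
  have [measurable]: "H \<in> borel_measurable ?Q" unfolding H_def using t0 by measurable
  have GH: "G (u z) = H (fst z)" if "z \<in> space (?Q \<Otimes>\<^sub>M P)" for z
  proof -
    obtain x y where z: "z = (x, y)" "x \<in> space ?Q" "y \<in> space P"
      using \<open>z \<in> _\<close> by (cases z) (auto simp: space_pair_measure)
    have "G ((u (x, t0))(i := y)) = G (u (x, t0))" by (rule G(2)[OF upd]) (use z t0 in auto)
    then show ?thesis by (simp add: z H_def u_def)
  qed
  have "L6 (?Q \<Otimes>\<^sub>M P) (\<lambda>z. H (fst z))"
  proof (rule L6_bound[OF L6u[OF G(1)]])
    show "\<bar>H (fst x)\<bar> \<le> \<bar>G (u x)\<bar>" if "x \<in> space (?Q \<Otimes>\<^sub>M P)" for x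
      using GH[OF that] by simp
  qed measurable
  from pp.L6_mean(1)[OF this] have H: "L6 ?Q H" by (simp add: P.prob_space L6_def)
  have dl: "(\<integral>z. (F (u z) - H (fst z)) ^ 6 \<partial>(?Q \<Otimes>\<^sub>M P)) \<le> \<delta>"
  proof -
    have "(\<integral>z. (F (u z) - H (fst z)) ^ 6 \<partial>(?Q \<Otimes>\<^sub>M P)) = (\<integral>z. (F (u z) - G (u z)) ^ 6 \<partial>(?Q \<Otimes>\<^sub>M P))"
      using GH by (intro Bochner_Integration.integral_cong refl) simp
    also have "\<dots> = (\<integral>x. (F x - G x) ^ 6 \<partial>?J)" by (rule Iu[symmetric]) measurable
    finally show ?thesis using G(3) by simp
  qed
  have \<delta>: "0 \<le> \<delta>" using dl by (rule order_trans[rotated]) simp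
  define c where "c = real (card I)"
  \<comment> \<open>The maximum covers the first induction step, where \<open>I\<close> is empty and
    \<open>c\<close> is 0.\<close>
  define n where "n = max 1 c"
  have n: "n \<ge> 1" by (simp add: n_def)
  have "(\<integral>x. (F x - m) ^ 6 \<partial>?J) = (\<integral>z. (F (u z) - m) ^ 6 \<partial>(?Q \<Otimes>\<^sub>M P))"
    by (rule Iu) measurable
  also have "\<dots> \<le> (1 + 1 / n) * (\<integral>x. (Fb x - m) ^ 6 \<partial>?Q) + 4000000 * n\<^sup>2 * \<delta>"
    using pp.L6_step[OF Fu H n dl, of m] by (simp add: Fb_def)
  also have "\<dots> \<le> (1 + 1 / n) * (4000000 * c ^ 3 * \<delta>) + 4000000 * n\<^sup>2 * \<delta>"
    using IH n by (intro add_right_mono mult_left_mono) (auto simp: c_def)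
  also have "\<dots> = 4000000 * \<delta> * ((1 + 1 / n) * c ^ 3 + n\<^sup>2)" by (simp add: algebra_simps)
  also have "\<dots> \<le> 4000000 * \<delta> * (c + 1) ^ 3"
  proof (rule mult_left_mono)
    show "(1 + 1 / n) * c ^ 3 + n\<^sup>2 \<le> (c + 1) ^ 3"
    proof (cases "card I = 0")
      case False
      then have c: "c \<ge> 1" by (simp add: c_def)
      then have "n = c" by (simp add: n_def)
      then have "(1 + 1 / n) * c ^ 3 + n\<^sup>2 = c ^ 3 + 2 * c\<^sup>2"
        using c by (simp add: field_simps eval_nat_numeral)
      also have "\<dots> \<le> (c + 1) ^ 3" using c by (simp add: power3_eq_cube power2_eq_square algebra_simps)
      finally show ?thesis .
    qed (simp add: c_def n_def)
  qed (use \<delta> in auto)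
  finally show ?case using insert.hyps by (simp add: m_def c_def algebra_simps)
qed

subsection \<open>Standard Gaussian vectors\<close>

text \<open>Finiteness of all moments is stable under products, unlike that of a fixed order.
  Integrability of the polynomial expressions below thus follows from closure rules alone.\<close>

definition all_moments :: "'a measure \<Rightarrow> ('a \<Rightarrow> real) \<Rightarrow> bool" where
  "all_moments M f \<longleftrightarrow> f \<in> borel_measurable M \<and> (\<forall>n::nat. integrable M (\<lambda>x. \<bar>f x\<bar> ^ n))"

lemma all_moments_measurable: "all_moments M f \<Longrightarrow> f \<in> borel_measurable M"
  by (simp add: all_moments_def)

lemma all_moments_bound:
  assumes "all_moments M g" "f \<in> borel_measurable M" "\<And>x. x \<in> space M \<Longrightarrow> \<bar>f x\<bar> \<le> \<bar>g x\<bar>"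
  shows "all_moments M f"
  unfolding all_moments_def
proof (intro conjI allI)
  fix n
  show "integrable M (\<lambda>x. \<bar>f x\<bar> ^ n)"
    by (rule Bochner_Integration.integrable_bound[of M "\<lambda>x. \<bar>g x\<bar> ^ n"])
       (use assms in \<open>auto simp: all_moments_def intro!: power_mono AE_I2 simp del: power_abs\<close>)
qed fact

text \<open>AM-GM bounds the n-th moment of the product by moments of order 2 n of the
  factors.\<close>

lemma all_moments_mult:
  assumes "all_moments M f" "all_moments M g" shows "all_moments M (\<lambda>x. f x * g x)"
  unfolding all_moments_def
proof (intro conjI allI)
  have [measurable]: "f \<in> borel_measurable M" "g \<in> borel_measurable M"
    using assms by (auto simp: all_moments_def)
  show "(\<lambda>x. f x * g x) \<in> borel_measurable M" by measurable
  fix n :: nat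
  have "integrable M (\<lambda>x. \<bar>f x\<bar> ^ (2 * n) + \<bar>g x\<bar> ^ (2 * n))"
    using assms unfolding all_moments_def by (intro Bochner_Integration.integrable_add) blast+
  then show "integrable M (\<lambda>x. \<bar>f x * g x\<bar> ^ n)"
  proof (rule Bochner_Integration.integrable_bound)
    have "\<bar>a * b\<bar> ^ n \<le> \<bar>a\<bar> ^ (2 * n) + \<bar>b\<bar> ^ (2 * n)" for a b :: real
    proof -
      have "0 \<le> (\<bar>a\<bar> ^ n - \<bar>b\<bar> ^ n)\<^sup>2" by simp
      then have "2 * (\<bar>a\<bar> ^ n * \<bar>b\<bar> ^ n) \<le> (\<bar>a\<bar> ^ n)\<^sup>2 + (\<bar>b\<bar> ^ n)\<^sup>2"
        by (simp add: power2_diff algebra_simps)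
      moreover have "0 \<le> \<bar>a\<bar> ^ n * \<bar>b\<bar> ^ n" by simp
      ultimately have "\<bar>a\<bar> ^ n * \<bar>b\<bar> ^ n \<le> (\<bar>a\<bar> ^ n)\<^sup>2 + (\<bar>b\<bar> ^ n)\<^sup>2" by linarith
      then show ?thesis
        by (simp add: abs_mult power_mult_distrib mult.commute[of 2 n] power_mult)
    qed
    then show "AE x in M. norm (\<bar>f x * g x\<bar> ^ n) \<le> norm (\<bar>f x\<bar> ^ (2 * n) + \<bar>g x\<bar> ^ (2 * n))"
      by (intro AE_I2) (simp add: order_trans[OF _ abs_ge_self])
  qed measurable
qed

lemma all_moments_add:
  assumes "all_moments M f" "all_moments M g" shows "all_moments M (\<lambda>x. f x + g x)"
  unfolding all_moments_def
proof (intro conjI allI)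
  have [measurable]: "f \<in> borel_measurable M" "g \<in> borel_measurable M"
    using assms by (auto simp: all_moments_def)
  show "(\<lambda>x. f x + g x) \<in> borel_measurable M" by measurable
  fix n :: nat
  have "integrable M (\<lambda>x. 2 ^ n * (\<bar>f x\<bar> ^ n + \<bar>g x\<bar> ^ n))"
    using assms unfolding all_moments_def
    by (intro integrable_mult_right Bochner_Integration.integrable_add) blast+
  then show "integrable M (\<lambda>x. \<bar>f x + g x\<bar> ^ n)"
  proof (rule Bochner_Integration.integrable_bound)
    have "\<bar>a + b\<bar> ^ n \<le> 2 ^ n * (\<bar>a\<bar> ^ n + \<bar>b\<bar> ^ n)" for a b :: real
    proof -
      have "\<bar>a + b\<bar> ^ n \<le> (2 * max \<bar>a\<bar> \<bar>b\<bar>) ^ n" by (intro power_mono) auto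
      also have "\<dots> = 2 ^ n * max \<bar>a\<bar> \<bar>b\<bar> ^ n" by (simp add: power_mult_distrib)
      also have "max \<bar>a\<bar> \<bar>b\<bar> ^ n \<le> \<bar>a\<bar> ^ n + \<bar>b\<bar> ^ n"
        by (cases "\<bar>a\<bar> \<le> \<bar>b\<bar>") (auto simp: max_def)
      finally show ?thesis by simp
    qed
    then show "AE x in M. norm (\<bar>f x + g x\<bar> ^ n) \<le> norm (2 ^ n * (\<bar>f x\<bar> ^ n + \<bar>g x\<bar> ^ n))"
      by (intro AE_I2) (simp add: order_trans[OF _ abs_ge_self] abs_mult)
  qed measurable
qed

lemma (in finite_measure) all_moments_const: "all_moments M (\<lambda>x. c)"
  by (simp add: all_moments_def)

lemma (in finite_measure) all_moments_bounded:
  assumes "f \<in> borel_measurable M" "\<And>x. x \<in> space M \<Longrightarrow> \<bar>f x\<bar> \<le> B"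
  shows "all_moments M f"
  by (rule all_moments_bound[OF all_moments_const[of B]]) (use assms in force)+

lemma (in finite_measure) all_moments_sum:
  "(\<And>i. i \<in> I \<Longrightarrow> all_moments M (f i)) \<Longrightarrow> all_moments M (\<lambda>x. \<Sum>i\<in>I. f i x)"
  by (induction I rule: infinite_finite_induct) (auto intro: all_moments_const all_moments_add)

lemma (in finite_measure) all_moments_power: "all_moments M f \<Longrightarrow> all_moments M (\<lambda>x. f x ^ n)"
  by (induction n) (auto intro: all_moments_const all_moments_mult)

lemma (in finite_measure) all_moments_cmult: "all_moments M f \<Longrightarrow> all_moments M (\<lambda>x. c * f x)"
  by (intro all_moments_mult all_moments_const)

lemma (in finite_measure) all_moments_diff:
  "all_moments M f \<Longrightarrow> all_moments M g \<Longrightarrow> all_moments M (\<lambda>x. f x - g x)"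
  using all_moments_add[of M f "\<lambda>x. -1 * g x"] all_moments_cmult[of g "-1"] by simp

lemma all_moments_abs: "all_moments M f \<Longrightarrow> all_moments M (\<lambda>x. \<bar>f x\<bar>)"
  by (auto simp: all_moments_def)

lemma all_moments_integrable: "all_moments M f \<Longrightarrow> integrable M f"
  unfolding all_moments_def using integrable_abs_cancel[of M f] by (auto dest: spec[of _ 1])

lemma (in finite_measure) integral_double_sum:
  assumes "\<And>i j. i \<in> I \<Longrightarrow> j \<in> J \<Longrightarrow> all_moments M (f i j)"
  shows "(\<integral>x. (\<Sum>i\<in>I. \<Sum>j\<in>J. f i j x) \<partial>M) = (\<Sum>i\<in>I. \<Sum>j\<in>J. \<integral>x. f i j x \<partial>M)"
proof -
  have "(\<integral>x. (\<Sum>i\<in>I. \<Sum>j\<in>J. f i j x) \<partial>M) = (\<Sum>i\<in>I. \<integral>x. (\<Sum>j\<in>J. f i j x) \<partial>M)"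
    by (intro Bochner_Integration.integral_sum all_moments_integrable all_moments_sum assms)
  also have "\<dots> = (\<Sum>i\<in>I. \<Sum>j\<in>J. \<integral>x. f i j x \<partial>M)"
    by (intro sum.cong refl Bochner_Integration.integral_sum all_moments_integrable assms)
  finally show ?thesis .
qed

lemma all_moments_L6: "all_moments M f \<Longrightarrow> L6 M f"
  unfolding all_moments_def L6_def by (auto dest: spec[of _ 6] simp: power_even_abs)

lemma all_moments_comp:
  assumes "g \<in> measurable M N" "all_moments (distr M N g) f" shows "all_moments M (\<lambda>x. f (g x))"
proof -
  have [measurable]: "f \<in> borel_measurable N" using assms by (simp add: all_moments_def)
  have "integrable (distr M N g) (\<lambda>x. \<bar>f x\<bar> ^ n)" for n using assms by (simp add: all_moments_def)
  then show ?thesis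
    unfolding all_moments_def using integrable_distr[OF assms(1)] assms(1) by auto
qed

lemma all_moments_PiM_component:
  assumes "\<And>i. i \<in> I \<Longrightarrow> prob_space (P i)" "i \<in> I" "all_moments (P i) f"
  shows "all_moments (Pi\<^sub>M I P) (\<lambda>x. f (x i))"
proof (rule all_moments_comp[where g = "\<lambda>x. x i" and N = "P i"])
  show "all_moments (distr (Pi\<^sub>M I P) (P i) (\<lambda>x. x i)) f"
    using assms distr_PiM_component[of I P i] by simp
qed (use assms in measurable)

lemma integral_PiM_component:
  fixes f :: "_ \<Rightarrow> real"
  assumes "\<And>i. i \<in> I \<Longrightarrow> prob_space (P i)" "i \<in> I" "f \<in> borel_measurable (P i)"
  shows "(\<integral>x. f (x i) \<partial>Pi\<^sub>M I P) = (\<integral>y. f y \<partial>P i)"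
  using integral_distr[of "\<lambda>x. x i" "Pi\<^sub>M I P" "P i" f] assms distr_PiM_component[of I P i] by simp

section \<open>The normal law on the line and its finite powers\<close>

abbreviation gauss :: "real measure" where
  "gauss \<equiv> density lborel std_normal_density"

lemma prob_space_gauss: "prob_space gauss"
  by (rule prob_space_normal_density) simp

interpretation gauss: prob_space gauss by (rule prob_space_gauss)

lemma sets_std_gaussian [measurable_cong]: "sets (std_gaussian d) = sets (Pi\<^sub>M {1..d} (\<lambda>_. borel))"
  unfolding std_gaussian_def by (intro sets_PiM_cong refl) simp

lemma space_std_gaussian: "space (std_gaussian d) = {1..d} \<rightarrow>\<^sub>E UNIV"
  by (simp add: std_gaussian_def space_PiM)

lemma prob_space_std_gaussian: "prob_space (std_gaussian d)"
  unfolding std_gaussian_def by (intro prob_space_PiM prob_space_gauss)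

interpretation std_gaussian: prob_space "std_gaussian d" for d by (rule prob_space_std_gaussian)

interpretation gauss_product: product_sigma_finite "\<lambda>_::nat. gauss"
  by unfold_locales

lemma measurable_std_gaussian_component [measurable]:
  "k \<in> {1..d} \<Longrightarrow> (\<lambda>x. x k) \<in> borel_measurable (std_gaussian d)"
  by (subst measurable_cong_sets[OF sets_std_gaussian refl]) (rule measurable_component_singleton)

lemma integral_gauss: "f \<in> borel_measurable borel \<Longrightarrow> (\<integral>x. f x \<partial>gauss) = (\<integral>x. std_normal_density x * f x \<partial>lborel)"
  by (subst integral_density) (auto simp: normal_density_nonneg)

lemma integrable_gauss:
  fixes f :: "real \<Rightarrow> real"
  shows "f \<in> borel_measurable borel \<Longrightarrow> integrable gauss f \<longleftrightarrow> integrable lborel (\<lambda>x. std_normal_density x * f x)"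
  by (subst integrable_density) (auto simp: normal_density_nonneg)

lemma all_moments_gauss_id: "all_moments gauss (\<lambda>x. x)"
  unfolding all_moments_def by (auto simp: integrable_gauss integrable_std_normal_moment_abs)

lemma gauss_mean [simp]: "(\<integral>x. x \<partial>gauss) = 0"
  using has_bochner_integral_integral_eq[OF std_normal_moment_odd[of 0]] by (simp add: integral_gauss)

lemma gauss_second_moment [simp]: "(\<integral>x. x\<^sup>2 \<partial>gauss) = 1"
  using has_bochner_integral_integral_eq[OF std_normal_moment_even[of 1]] by (simp add: integral_gauss)

lemma gauss_fourth_moment [simp]: "(\<integral>x. x ^ 4 \<partial>gauss) = 3"
  using has_bochner_integral_integral_eq[OF std_normal_moment_even[of 2]]
  by (simp add: integral_gauss fact_numeral)

lemma gauss_exp: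
  shows integrable_gauss_exp: "integrable gauss (\<lambda>x. exp (a * x))"
    and integral_gauss_exp: "(\<integral>x. exp (a * x) \<partial>gauss) = exp (a\<^sup>2 / 2)"
proof -
  \<comment> \<open>Completing the square: exponential tilting shifts the normal density by
    \<open>a\<close>.\<close>
  have eq: "std_normal_density x * exp (a * x) = exp (a\<^sup>2 / 2) * normal_density a 1 x" for x
  proof -
    have "exp (- x\<^sup>2 / 2) * exp (a * x) = exp (a\<^sup>2 / 2) * exp (- (x - a)\<^sup>2 / 2)"
      by (simp add: power2_eq_square field_simps flip: exp_add)
    then show ?thesis by (simp add: normal_density_def)
  qed
  show "integrable gauss (\<lambda>x. exp (a * x))"
    by (simp add: integrable_gauss eq)
  show "(\<integral>x. exp (a * x) \<partial>gauss) = exp (a\<^sup>2 / 2)"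
    by (simp add: integral_gauss eq)
qed

lemma all_moments_gauss_exp: "all_moments gauss (\<lambda>x. exp (a * x))"
  unfolding all_moments_def
  using integrable_gauss_exp[of "_ * a"] by (auto simp: power_abs[symmetric] exp_of_nat_mult[symmetric] mult.assoc)

text \<open>The symmetry that removes first-order terms when one column of the parameters is
  dropped.\<close>

lemma distr_gauss_uminus: "distr gauss gauss uminus = gauss"
proof (rule measure_eqI)
  fix A assume "A \<in> sets (distr gauss gauss uminus)"
  then have A [measurable]: "A \<in> sets borel" by simp
  have A' [measurable]: "uminus -` A \<in> sets borel"
    using measurable_sets[of uminus borel borel A] by simp
  have "emeasure (distr gauss gauss uminus) A = emeasure gauss (uminus -` A)"
    by (subst emeasure_distr) auto
  also have "\<dots> = (\<integral>\<^sup>+x. ennreal (std_normal_density x) * indicator (uminus -` A) x \<partial>lborel)"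
    by (subst emeasure_density) auto
  also have "\<dots> = (\<integral>\<^sup>+x. ennreal (std_normal_density x) * indicator A x \<partial>lborel)"
    by (subst nn_integral_real_affine[of _ "-1" 0])
       (auto intro!: nn_integral_cong simp: indicator_def normal_density_def)
  also have "\<dots> = emeasure gauss A" by (subst emeasure_density) auto
  finally show "emeasure (distr gauss gauss uminus) A = emeasure gauss A" .
qed simp

lemma integral_gauss_uminus:
  fixes f :: "real \<Rightarrow> real"
  assumes [measurable]: "f \<in> borel_measurable borel"
  shows "(\<integral>x. f (- x) \<partial>gauss) = (\<integral>x. f x \<partial>gauss)"
  using integral_distr[of uminus gauss gauss f] distr_gauss_uminus by simp

lemma all_moments_component:
  "k \<in> {1..d} \<Longrightarrow> all_moments gauss f \<Longrightarrow> all_moments (std_gaussian d) (\<lambda>x. f (x k))"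
  unfolding std_gaussian_def by (intro all_moments_PiM_component prob_space_gauss)

lemma all_moments_coord: "k \<in> {1..d} \<Longrightarrow> all_moments (std_gaussian d) (\<lambda>x. x k)"
  by (rule all_moments_component[OF _ all_moments_gauss_id])

lemma integral_component:
  fixes f :: "real \<Rightarrow> real"
  assumes "k \<in> {1..d}" "f \<in> borel_measurable borel"
  shows "(\<integral>x. f (x k) \<partial>std_gaussian d) = (\<integral>y. f y \<partial>gauss)"
  unfolding std_gaussian_def using assms by (intro integral_PiM_component prob_space_gauss) auto

lemma integral_two_components:
  fixes f g :: "real \<Rightarrow> real"
  assumes "k \<in> {1..d}" "l \<in> {1..d}" "k \<noteq> l" "integrable gauss f" "integrable gauss g"
  shows "(\<integral>x. f (x k) * g (x l) \<partial>std_gaussian d) = (\<integral>y. f y \<partial>gauss) * (\<integral>y. g y \<partial>gauss)"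
proof -
  \<comment> \<open>Padding with constant factors 1 turns the integrand into a product over all
    coordinates.\<close>
  define h where "h = (\<lambda>i::nat. if i = k then f else if i = l then g else (\<lambda>_. 1))"
  have "f (x k) * g (x l) = (\<Prod>i\<in>{1..d}. h i (x i))" for x
  proof -
    have "(\<Prod>i\<in>{1..d}. h i (x i)) = (\<Prod>i\<in>{k, l}. h i (x i))"
      by (rule prod.mono_neutral_right) (use assms in \<open>auto simp: h_def\<close>)
    then show ?thesis using assms by (simp add: h_def)
  qed
  then have "(\<integral>x. f (x k) * g (x l) \<partial>std_gaussian d) = (\<Prod>i\<in>{1..d}. \<integral>y. h i y \<partial>gauss)"
    unfolding std_gaussian_def using assms
    by (subst gauss_product.product_integral_prod[symmetric]) (auto simp: h_def)
  also have "\<dots> = (\<Prod>i\<in>{k, l}. \<integral>y. h i y \<partial>gauss)"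
    by (rule prod.mono_neutral_right) (use assms gauss.prob_space in \<open>auto simp: h_def\<close>)
  finally show ?thesis using assms by (simp add: h_def)
qed

lemma std_gaussian_insert: "k \<in> {1..d} \<Longrightarrow> std_gaussian d = Pi\<^sub>M (insert k ({1..d} - {k})) (\<lambda>_. gauss)"
  by (simp add: std_gaussian_def insert_absorb)

lemma integral_std_gaussian_insert:
  fixes f :: "_ \<Rightarrow> real"
  assumes "k \<in> {1..d}" "integrable (std_gaussian d) f"
  shows "(\<integral>x. f x \<partial>std_gaussian d) = (\<integral>x. (\<integral>y. f (x(k := y)) \<partial>gauss) \<partial>Pi\<^sub>M ({1..d} - {k}) (\<lambda>_. gauss))"
  using assms(2) unfolding std_gaussian_insert[OF assms(1)]
  by (intro gauss_product.product_integral_insert) auto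

text \<open>Fubini with the innermost integral over coordinate \<open>k\<close>, on which
  \<open>G\<close> is constant. All vanishing products of Hermite polynomials below are of this
  form.\<close>

lemma integral_coord_zero:
  assumes "k \<in> {1..d}" "integrable (std_gaussian d) (\<lambda>x. u (x k) * G x)"
    and "\<And>x y. G (x(k := y)) = G x" and "(\<integral>y. u y \<partial>gauss) = (0::real)"
  shows "(\<integral>x. u (x k) * G x \<partial>std_gaussian d) = 0"
  using assms by (subst integral_std_gaussian_insert) auto

lemma (in prob_space) distr_lin_comb_std_normal:
  assumes "finite I" "indep_vars (\<lambda>_. borel) X I"
    and X: "\<And>i. i \<in> I \<Longrightarrow> distributed M lborel (X i) std_normal_density"
  shows "distr M borel (\<lambda>\<omega>. \<Sum>i\<in>I. u i * X i \<omega>) = distr gauss borel (\<lambda>z. sqrt (\<Sum>i\<in>I. (u i)\<^sup>2) * z)"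
proof -
  \<comment> \<open>Zero coefficients are dropped because the rule for sums of independent normals
    asks for positive standard deviations. If none remains, both laws are the point mass at
    0.\<close>
  define J where "J = {i \<in> I. u i \<noteq> 0}"
  have J: "finite J" "J \<subseteq> I" using assms by (auto simp: J_def)
  define s where "s = sqrt (\<Sum>i\<in>I. (u i)\<^sup>2)"
  have sJ: "s = sqrt (\<Sum>i\<in>J. (u i)\<^sup>2)"
    unfolding s_def J_def using assms by (intro arg_cong[where f=sqrt] sum.mono_neutral_right) auto
  have "(\<Sum>i\<in>I. u i * X i \<omega>) = (\<Sum>i\<in>J. u i * X i \<omega>)" for \<omega>
    unfolding J_def using assms by (intro sum.mono_neutral_right) auto
  then have eq: "(\<lambda>\<omega>. \<Sum>i\<in>I. u i * X i \<omega>) = (\<lambda>\<omega>. \<Sum>i\<in>J. u i * X i \<omega>)" by simp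
  show ?thesis
  proof (cases "J = {}")
    case True
    have "distr M borel (\<lambda>\<omega>. 0::real) = return borel 0" "distr gauss borel (\<lambda>\<omega>. 0::real) = return borel 0"
      by (auto intro!: measure_eqI simp: emeasure_distr emeasure_space_1 gauss.emeasure_space_1 indicator_def
           split: if_splits)
    then show ?thesis unfolding eq s_def[symmetric] sJ using True by simp
  next
    case False
    have s: "s > 0" unfolding sJ using False J by (auto simp: J_def intro!: sum_pos)
    have "indep_vars (\<lambda>_. borel) (\<lambda>i \<omega>. u i * X i \<omega>) J"
      by (rule indep_vars_compose2[where Y = "\<lambda>i x. u i * x", OF indep_vars_subset[OF assms(2) J(2)]]) auto
    moreover have "distributed M lborel (\<lambda>\<omega>. u i * X i \<omega>) (normal_density 0 \<bar>u i\<bar>)" if "i \<in> J" for i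
      using normal_density_affine[of "X i" 0 1 "u i" 0] X[of i] that by (simp add: J_def)
    ultimately have "distributed M lborel (\<lambda>\<omega>. \<Sum>i\<in>J. u i * X i \<omega>)
        (normal_density (\<Sum>i\<in>J. 0) (sqrt (\<Sum>i\<in>J. \<bar>u i\<bar>\<^sup>2)))"
      using J False by (intro sum_indep_normal) (auto simp: J_def)
    then have "distr M lborel (\<lambda>\<omega>. \<Sum>i\<in>J. u i * X i \<omega>) = density lborel (normal_density 0 s)"
      by (simp add: sJ distributed_distr_eq_density)
    moreover have "distributed gauss lborel (\<lambda>x. x) std_normal_density"
      by (auto simp: distributed_def distr_id2 cong: distr_cong)
    then have "distributed gauss lborel (\<lambda>x. 0 + s * x) (normal_density (0 + s * 0) (\<bar>s\<bar> * 1))"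
      by (rule gauss.normal_density_affine) (use s in auto)
    then have "distr gauss lborel (\<lambda>x. s * x) = density lborel (normal_density 0 s)"
      using s by (simp add: distributed_distr_eq_density)
    moreover have "distr M' lborel h = distr M' borel h" for M' :: "'z measure" and h :: "'z \<Rightarrow> real"
      by (rule distr_cong) auto
    ultimately show ?thesis unfolding eq s_def[symmetric] by metis
  qed
qed

lemma indep_vars_std_gaussian: "std_gaussian.indep_vars d (\<lambda>_. borel) (\<lambda>k x. x k) {1..d}"
proof (cases "d = 0")
  case False
  have c: "distr (std_gaussian d) borel (\<lambda>x. x k) = gauss" if "k \<in> {1..d}" for k
    using distr_PiM_component[of "{1..d}" "\<lambda>_. gauss" k] prob_space_gauss that
    by (simp add: std_gaussian_def cong: distr_cong)
  have "distr (std_gaussian d) (Pi\<^sub>M {1..d} (\<lambda>_. borel)) (\<lambda>x. \<lambda>k\<in>{1..d}. x k)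
      = distr (std_gaussian d) (std_gaussian d) (\<lambda>x. x)"
    by (rule distr_cong) (auto simp: sets_std_gaussian space_std_gaussian restrict_PiE_iff extensional_restrict PiE_def)
  also have "\<dots> = std_gaussian d" by simp
  also have "\<dots> = Pi\<^sub>M {1..d} (\<lambda>k. distr (std_gaussian d) borel (\<lambda>x. x k))"
    unfolding std_gaussian_def[of d, symmetric] by (subst std_gaussian_def, rule PiM_cong) (auto simp: c)
  finally show ?thesis
    using False by (subst std_gaussian.indep_vars_iff_distr_eq_PiM') auto
qed (auto simp: std_gaussian.indep_vars_def std_gaussian.indep_sets_def)

lemma distributed_std_gaussian_component:
  "k \<in> {1..d} \<Longrightarrow> distributed (std_gaussian d) lborel (\<lambda>x. x k) std_normal_density"
  using distr_PiM_component[of "{1..d}" "\<lambda>_. gauss" k] prob_space_gauss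
  by (auto simp: distributed_def std_gaussian_def cong: distr_cong simp del: One_nat_def)

lemma distr_std_gaussian_dot:
  "distr (std_gaussian d) borel (\<lambda>x. \<Sum>k\<in>{1..d}. u k * x k) = distr gauss borel (\<lambda>z. sqrt (\<Sum>k\<in>{1..d}. (u k)\<^sup>2) * z)"
  by (rule std_gaussian.distr_lin_comb_std_normal)
     (auto intro: indep_vars_std_gaussian distributed_std_gaussian_component simp del: One_nat_def)

lemma integral_std_gaussian_dot_power:
  "(\<integral>x. (\<Sum>k\<in>{1..d}. u k * x k) ^ (2 * n) \<partial>std_gaussian d) = (\<Sum>k\<in>{1..d}. (u k)\<^sup>2) ^ n * (\<integral>z. z ^ (2 * n) \<partial>gauss)"
proof -
  have "(\<integral>x. (\<Sum>k\<in>{1..d}. u k * x k) ^ (2 * n) \<partial>std_gaussian d)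
      = (\<integral>y. y ^ (2 * n) \<partial>distr (std_gaussian d) borel (\<lambda>x. \<Sum>k\<in>{1..d}. u k * x k))"
    by (subst integral_distr) auto
  also have "\<dots> = (\<integral>z. (sqrt (\<Sum>k\<in>{1..d}. (u k)\<^sup>2) * z) ^ (2 * n) \<partial>gauss)"
    unfolding distr_std_gaussian_dot by (subst integral_distr) auto
  also have "\<dots> = (\<Sum>k\<in>{1..d}. (u k)\<^sup>2) ^ n * (\<integral>z. z ^ (2 * n) \<partial>gauss)"
    by (simp add: power_mult_distrib power_mult sum_nonneg)
  finally show ?thesis .
qed

subsection \<open>Many classes\<close>

lemma all_moments_exp_lin_comb: "all_moments (std_gaussian d) (\<lambda>x. exp (\<Sum>k\<in>{1..d}. u k * x k))"
proof (rule all_moments_comp[where N = borel and f = exp])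
  let ?s = "sqrt (\<Sum>k\<in>{1..d}. (u k)\<^sup>2)"
  have "all_moments gauss (\<lambda>z. exp (?s * z))" by (rule all_moments_gauss_exp)
  then show "all_moments (distr (std_gaussian d) borel (\<lambda>x. \<Sum>k\<in>{1..d}. u k * x k)) exp"
    unfolding distr_std_gaussian_dot all_moments_def by (auto simp: integrable_distr_eq)
qed measurable

lemma integral_exp_lin_comb:
  "(\<integral>x. exp (\<Sum>k\<in>{1..d}. u k * x k) \<partial>std_gaussian d) = exp ((\<Sum>k\<in>{1..d}. (u k)\<^sup>2) / 2)"
proof -
  have "(\<integral>x. exp (\<Sum>k\<in>{1..d}. u k * x k) \<partial>std_gaussian d)
      = (\<integral>y. exp y \<partial>distr (std_gaussian d) borel (\<lambda>x. \<Sum>k\<in>{1..d}. u k * x k))"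
    by (subst integral_distr) auto
  also have "\<dots> = (\<integral>z. exp (sqrt (\<Sum>k\<in>{1..d}. (u k)\<^sup>2) * z) \<partial>gauss)"
    unfolding distr_std_gaussian_dot by (subst integral_distr) auto
  also have "\<dots> = exp ((\<Sum>k\<in>{1..d}. (u k)\<^sup>2) / 2)"
    by (subst integral_gauss_exp) (simp add: sum_nonneg)
  finally show ?thesis .
qed

definition mean_exp :: "nat \<Rightarrow> (nat \<Rightarrow> real) \<Rightarrow> real" where
  "mean_exp C z = (\<Sum>l\<in>{1..C}. exp (z l)) / real C"

lemma measurable_mean_exp [measurable]: "mean_exp C \<in> borel_measurable (std_gaussian C)"
  unfolding mean_exp_def by measurable

lemma mean_exp_pos: "C \<ge> 1 \<Longrightarrow> mean_exp C z > 0"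
  unfolding mean_exp_def by (intro divide_pos_pos sum_pos) auto

text \<open>AM-GM, from the tangent line of exp at the average \<open>b\<close>. It dominates
  negative powers of \<open>mean_exp\<close> by the exponential of a linear form, whose Gaussian
  integral is explicit.\<close>

lemma exp_mean_le_mean_exp:
  assumes "C \<ge> 1" shows "exp (\<Sum>l\<in>{1..C}. 1 / real C * z l) \<le> mean_exp C z"
proof -
  define b where "b = (\<Sum>l\<in>{1..C}. 1 / real C * z l)"
  have b: "(\<Sum>l\<in>{1..C}. z l) = real C * b"
    using assms by (simp add: b_def flip: sum_divide_distrib)
  have "real C * exp b = (\<Sum>l\<in>{1..C}. exp b * (1 + (z l - b)))"
    by (simp add: sum_distrib_left[symmetric] sum.distrib sum_subtractf b del: One_nat_def)
  also have "\<dots> \<le> (\<Sum>l\<in>{1..C}. exp (z l))"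
  proof (rule sum_mono)
    fix l
    have "exp b * (1 + (z l - b)) \<le> exp b * exp (z l - b)" by (intro mult_left_mono) auto
    also have "\<dots> = exp (z l)" by (simp flip: exp_add)
    finally show "exp b * (1 + (z l - b)) \<le> exp (z l)" .
  qed
  finally show ?thesis using assms by (simp add: mean_exp_def b_def field_simps)
qed

text \<open>The coefficients \<open>- n / C\<close> have square sum n^2 / C, at most n^2. The
  resulting moment bound is uniform in \<open>C\<close>, which the limit needs.\<close>

lemma inverse_mean_exp_power:
  assumes "C \<ge> 1"
  shows all_moments_inverse_mean_exp: "all_moments (std_gaussian C) (\<lambda>z. inverse (mean_exp C z) ^ n)"
    and integral_inverse_mean_exp: "(\<integral>z. inverse (mean_exp C z) ^ n \<partial>std_gaussian C) \<le> exp ((real n)\<^sup>2 / 2)"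
proof -
  let ?u = "\<lambda>_::nat. - real n / real C"
  have le: "inverse (mean_exp C z) ^ n \<le> exp (\<Sum>l\<in>{1..C}. ?u l * z l)" for z
  proof -
    have "inverse (mean_exp C z) ^ n \<le> inverse (exp (\<Sum>l\<in>{1..C}. 1 / real C * z l)) ^ n"
      by (intro power_mono le_imp_inverse_le exp_mean_le_mean_exp assms)
         (use mean_exp_pos[OF assms, of z] in auto)
    also have "\<dots> = exp (\<Sum>l\<in>{1..C}. ?u l * z l)"
      by (simp add: exp_minus[symmetric] exp_of_nat_mult[symmetric] sum_distrib_left
                    sum_negf[symmetric] del: One_nat_def)
    finally show ?thesis .
  qed
  have nn: "0 \<le> inverse (mean_exp C z) ^ n" for z
    using mean_exp_pos[OF assms, of z] by simp
  note am = all_moments_exp_lin_comb[of C ?u]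
  show 1: "all_moments (std_gaussian C) (\<lambda>z. inverse (mean_exp C z) ^ n)"
    by (rule all_moments_bound[OF am]) (use le nn in auto)
  have "(\<integral>z. inverse (mean_exp C z) ^ n \<partial>std_gaussian C) \<le> (\<integral>z. exp (\<Sum>l\<in>{1..C}. ?u l * z l) \<partial>std_gaussian C)"
    by (intro integral_mono all_moments_integrable 1 am le)
  also have "\<dots> = exp ((real n)\<^sup>2 / real C / 2)"
    using assms by (subst integral_exp_lin_comb) (simp add: power2_eq_square)
  also have "\<dots> \<le> exp ((real n)\<^sup>2 / 2)"
    using assms by (simp add: divide_le_eq mult_le_cancel_left1)
  finally show "(\<integral>z. inverse (mean_exp C z) ^ n \<partial>std_gaussian C) \<le> exp ((real n)\<^sup>2 / 2)" .
qed

text \<open>The value \<open>exp (1 / 2)\<close> is the mean of exp of a standard normal, so the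
  summands are centred and independent, and only the diagonal of the double sum survives.\<close>

lemma mean_exp_variance:
  assumes "C \<ge> 1"
  shows "all_moments (std_gaussian C) (\<lambda>z. mean_exp C z - exp (1 / 2))"
    and "(\<integral>z. (mean_exp C z - exp (1 / 2))\<^sup>2 \<partial>std_gaussian C) = (\<integral>y. (exp y - exp (1 / 2))\<^sup>2 \<partial>gauss) / real C"
proof -
  define u where "u = (\<lambda>y::real. exp y - exp (1 / 2))"
  have u: "all_moments gauss u"
    unfolding u_def using all_moments_gauss_exp[of 1] by (intro gauss.all_moments_diff gauss.all_moments_const) simp
  have u0: "(\<integral>y. u y \<partial>gauss) = 0"
    unfolding u_def using integrable_gauss_exp[of 1] integral_gauss_exp[of 1] gauss.prob_space by simp
  have [measurable]: "u \<in> borel_measurable borel" unfolding u_def by measurable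
  have eq: "mean_exp C z - exp (1 / 2) = (\<Sum>l\<in>{1..C}. u (z l)) / real C" for z
    using assms by (simp add: mean_exp_def u_def sum_subtractf field_simps)
  have am: "all_moments (std_gaussian C) (\<lambda>z. u (z l))" if "l \<in> {1..C}" for l
    by (rule all_moments_component[OF that u])
  show "all_moments (std_gaussian C) (\<lambda>z. mean_exp C z - exp (1 / 2))"
    unfolding eq divide_inverse[of _ "real C"]
    by (intro all_moments_mult std_gaussian.all_moments_sum std_gaussian.all_moments_const am)
  have "(mean_exp C z - exp (1 / 2))\<^sup>2 = (\<Sum>l\<in>{1..C}. \<Sum>l'\<in>{1..C}. u (z l) * u (z l')) / (real C)\<^sup>2" for z
    unfolding eq by (simp add: power_divide power2_eq_square sum_product del: One_nat_def)
  then have "(\<integral>z. (mean_exp C z - exp (1 / 2))\<^sup>2 \<partial>std_gaussian C)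
     = (\<Sum>l\<in>{1..C}. \<Sum>l'\<in>{1..C}. (\<integral>z. u (z l) * u (z l') \<partial>std_gaussian C)) / (real C)\<^sup>2"
    using std_gaussian.integral_double_sum[OF all_moments_mult[OF am am], of "{1..C}" "{1..C}"]
    by (simp del: One_nat_def)
  also have "(\<Sum>l\<in>{1..C}. \<Sum>l'\<in>{1..C}. (\<integral>z. u (z l) * u (z l') \<partial>std_gaussian C))
    = (\<Sum>l\<in>{1..C}. \<Sum>l'\<in>{1..C}. if l' = l then (\<integral>y. (u y)\<^sup>2 \<partial>gauss) else 0)"
  proof (intro sum.cong refl)
    fix l l' assume l: "l \<in> {1..C}" "l' \<in> {1..C}"
    show "(\<integral>z. u (z l) * u (z l') \<partial>std_gaussian C) = (if l' = l then (\<integral>y. (u y)\<^sup>2 \<partial>gauss) else 0)"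
    proof (cases "l' = l")
      case True
      then show ?thesis using integral_component[OF l(1), of "\<lambda>y. (u y)\<^sup>2"] by (simp add: power2_eq_square)
    next
      case False
      then show ?thesis
        using integral_two_components[OF l, of u u] all_moments_integrable[OF u] u0 by simp
    qed
  qed
  also have "\<dots> = real C * (\<integral>y. (u y)\<^sup>2 \<partial>gauss)" by simp
  finally show "(\<integral>z. (mean_exp C z - exp (1 / 2))\<^sup>2 \<partial>std_gaussian C) = (\<integral>y. (exp y - exp (1 / 2))\<^sup>2 \<partial>gauss) / real C"
    using assms by (simp add: u_def power2_eq_square)
qed

text \<open>With r = 1/R and q = 1/m one has r - q = (m - R) r q. In the factorization of r^j - q^j
  the extra factor r q makes every term at most r^(i+1), because q \<le> 1, and r^(i+1) \<le> 1 +
  r^j for i < j.\<close>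

lemma inverse_power_diff_le:
  fixes R m :: real
  assumes "R > 0" "m \<ge> 1"
  shows "\<bar>inverse R ^ j - inverse m ^ j\<bar> \<le> \<bar>R - m\<bar> * (real j * (1 + inverse R ^ j))"
proof -
  define r q where "r = inverse R" and "q = inverse m"
  have r: "r > 0" and q: "0 < q" "q \<le> 1" using assms by (auto simp: r_def q_def inverse_le_1_iff)
  have "r - q = (m - R) * (r * q)" using assms by (simp add: r_def q_def field_simps)
  then have a: "\<bar>r - q\<bar> = \<bar>R - m\<bar> * (r * q)" using r q by (simp add: abs_mult)
  have "\<bar>r ^ j - q ^ j\<bar> = \<bar>r - q\<bar> * (\<Sum>i<j. q ^ (j - Suc i) * r ^ i)"
    using r q by (simp add: power_diff_sumr2 abs_mult sum_nonneg)
  also have "\<dots> = \<bar>R - m\<bar> * (\<Sum>i<j. r * q * (q ^ (j - Suc i) * r ^ i))"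
    by (simp add: a sum_distrib_left mult.assoc)
  also have "\<dots> \<le> \<bar>R - m\<bar> * (\<Sum>i<j. 1 + r ^ j)"
  proof (intro mult_left_mono sum_mono)
    fix i assume i: "i \<in> {..<j}"
    have "r * q * (q ^ (j - Suc i) * r ^ i) = (q * q ^ (j - Suc i)) * r ^ Suc i" by simp
    also have "\<dots> \<le> 1 * r ^ Suc i"
      using q r by (intro mult_right_mono mult_le_one power_le_one) auto
    also have "r ^ Suc i \<le> 1 + r ^ j"
    proof (cases "r \<le> 1")
      case True
      then have "r ^ Suc i \<le> 1" using r by (intro power_le_one) auto
      then show ?thesis using r by (simp add: add_increasing2)
    next
      case False
      then have "r ^ Suc i \<le> r ^ j" using i by (intro power_increasing) auto
      then show ?thesis by simp
    qed
    finally show "r * q * (q ^ (j - Suc i) * r ^ i) \<le> 1 + r ^ j" by simp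
  qed auto
  finally show ?thesis by (simp add: r_def q_def)
qed

lemma tendsto_integral_exp_inverse_mean_exp:
  fixes a b j :: nat
  shows "(\<lambda>C. \<integral>z. exp (real a * z 1 + real b * z 2) * inverse (mean_exp C z) ^ j \<partial>std_gaussian C)
      \<longlonglongrightarrow> exp ((real a)\<^sup>2 / 2 + (real b)\<^sup>2 / 2 - real j / 2)"
proof -
  define m :: real where "m = exp (1 / 2)"
  have m: "m \<ge> 1" by (simp add: m_def)
  define w where "w = (\<integral>y. (exp y - exp (1 / 2))\<^sup>2 \<partial>gauss)"
  define E where "E = (\<lambda>s::real. exp ((s * real a)\<^sup>2 / 2 + (s * real b)\<^sup>2 / 2))"
  \<comment> \<open>A bound for the second moment of \<open>Y\<close> below, uniform in
    \<open>C\<close>; \<open>E s\<close> is the \<open>s\<close>-th moment of the numerator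
    \<open>u\<close>.\<close>
  define K where "K = (real j)\<^sup>2 * (E 4 + 8 * (1 + exp ((real (4 * j))\<^sup>2 / 2)))"
  define I where "I = (\<lambda>C. \<integral>z. exp (real a * z 1 + real b * z 2) * inverse (mean_exp C z) ^ j \<partial>std_gaussian C)"
  have main: "\<bar>I C - E 1 * inverse m ^ j\<bar> \<le> (w + K) / sqrt (real C)" if C: "C \<ge> 2" for C
  proof -
    let ?S = "std_gaussian C"
    have C1: "C \<ge> 1" and k12: "1 \<in> {1..C}" "2 \<in> {1..C}" using C by auto
    define u where "u = (\<lambda>z. exp (real a * z 1 + real b * z (2::nat)))"
    define r where "r = (\<lambda>z. inverse (mean_exp C z))"
    have rpos: "r z > 0" for z using mean_exp_pos[OF C1, of z] by (simp add: r_def)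
    have u_pow: "u z ^ s = exp (real (s * a) * z 1) * exp (real (s * b) * z 2)" for z s
      by (simp add: u_def exp_add power_mult_distrib exp_of_nat_mult[symmetric] mult.assoc)
    have uam: "all_moments ?S u"
      unfolding u_def exp_add
      by (intro all_moments_mult all_moments_component[OF k12(1), of "\<lambda>y. exp (_ * y)"]
                all_moments_component[OF k12(2), of "\<lambda>y. exp (_ * y)"] all_moments_gauss_exp)
    have Eu: "(\<integral>z. u z ^ s \<partial>?S) = E (real s)" for s
      unfolding u_pow
      by (subst integral_two_components[OF k12, of "\<lambda>y. exp (_ * y)" "\<lambda>y. exp (_ * y)"])
         (simp_all only: integrable_gauss_exp integral_gauss_exp, simp_all add: E_def exp_add)
    have ram: "all_moments ?S (\<lambda>z. r z ^ n)" for n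
      unfolding r_def by (rule all_moments_inverse_mean_exp[OF C1])
    have Er: "(\<integral>z. r z ^ n \<partial>?S) \<le> exp ((real n)\<^sup>2 / 2)" for n
      unfolding r_def by (rule integral_inverse_mean_exp[OF C1])
    define D where "D = (\<lambda>z. mean_exp C z - m)"
    have Dam: "all_moments ?S D" and ED: "(\<integral>z. (D z)\<^sup>2 \<partial>?S) = w / real C"
      using mean_exp_variance[OF C1] by (simp_all add: D_def m_def w_def)
    define Y where "Y = (\<lambda>z. u z * (real j * (1 + r z ^ j)))"
    have Yam: "all_moments ?S Y" unfolding Y_def
      by (intro all_moments_mult all_moments_add uam ram std_gaussian.all_moments_const)
    have EY: "(\<integral>z. (Y z)\<^sup>2 \<partial>?S) \<le> K"
    proof -
      have "(Y z)\<^sup>2 \<le> (real j)\<^sup>2 * (u z ^ 4 + 8 * (1 + r z ^ (4 * j)))" for z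
      proof -
        have *: "(x * (1 + y))\<^sup>2 \<le> x ^ 4 + 8 * (1 + y ^ 4)" for x y :: real
        proof -
          have 1: "2 * (x\<^sup>2 * (1 + y)\<^sup>2) \<le> x ^ 4 + (1 + y) ^ 4"
          proof -
            have "0 \<le> (x\<^sup>2 - (1 + y)\<^sup>2)\<^sup>2" by simp
            also have "\<dots> = x ^ 4 + (1 + y) ^ 4 - 2 * (x\<^sup>2 * (1 + y)\<^sup>2)" by algebra
            finally show ?thesis by simp
          qed
          have 2: "(1 + y) ^ 4 \<le> 8 * (1 + y ^ 4)"
          proof -
            have "0 \<le> (1 - y\<^sup>2)\<^sup>2" "0 \<le> (y - 1)\<^sup>2" "0 \<le> (y * (y - 1))\<^sup>2" by auto
            then have "0 \<le> 5 * (1 - y\<^sup>2)\<^sup>2 + 2 * ((y - 1)\<^sup>2 + (y * (y - 1))\<^sup>2)" by simp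
            also have "\<dots> = 8 * (1 + y ^ 4) - (1 + y) ^ 4" by algebra
            finally show ?thesis by simp
          qed
          have "(x * (1 + y))\<^sup>2 = x\<^sup>2 * (1 + y)\<^sup>2" by (simp add: power_mult_distrib)
          moreover have "0 \<le> x ^ 4 + (1 + y) ^ 4" by simp
          moreover have "0 \<le> x\<^sup>2 * (1 + y)\<^sup>2" by simp
          ultimately show ?thesis using 1 2 by linarith
        qed
        have "(Y z)\<^sup>2 = (real j)\<^sup>2 * (u z * (1 + r z ^ j))\<^sup>2"
          by (simp add: Y_def power_mult_distrib mult_ac)
        also have "\<dots> \<le> (real j)\<^sup>2 * (u z ^ 4 + 8 * (1 + (r z ^ j) ^ 4))"
          by (intro mult_left_mono *) simp
        finally show ?thesis by (simp flip: power_mult add: mult.commute)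
      qed
      then have "(\<integral>z. (Y z)\<^sup>2 \<partial>?S) \<le> (\<integral>z. (real j)\<^sup>2 * (u z ^ 4 + 8 * (1 + r z ^ (4 * j))) \<partial>?S)"
        by (intro integral_mono all_moments_integrable std_gaussian.all_moments_power all_moments_mult all_moments_add
             std_gaussian.all_moments_const Yam uam ram)
      also have "\<dots> = (real j)\<^sup>2 * (E 4 + 8 * (1 + (\<integral>z. r z ^ (4 * j) \<partial>?S)))"
        using Eu[of 4] all_moments_integrable[OF ram] all_moments_integrable[OF std_gaussian.all_moments_power[OF uam]]
        by (simp add: std_gaussian.prob_space)
      also have "\<dots> \<le> K" unfolding K_def
        by (intro mult_left_mono add_left_mono Er) auto
      finally show ?thesis .
    qed
    have "\<bar>I C - E 1 * inverse m ^ j\<bar> = \<bar>\<integral>z. u z * r z ^ j - u z * inverse m ^ j \<partial>?S\<bar>"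
      using Eu[of 1] all_moments_integrable[OF uam] all_moments_integrable[OF all_moments_mult[OF uam ram]]
      by (simp add: I_def u_def r_def)
    also have "\<dots> \<le> (\<integral>z. \<bar>u z * r z ^ j - u z * inverse m ^ j\<bar> \<partial>?S)"
      by (rule integral_abs_bound)
    also have "\<dots> \<le> (\<integral>z. (sqrt (real C) * (D z)\<^sup>2 + (Y z)\<^sup>2 / sqrt (real C)) \<partial>?S)"
    proof (rule integral_mono)
      fix z
      have "\<bar>u z * r z ^ j - u z * inverse m ^ j\<bar> = u z * \<bar>r z ^ j - inverse m ^ j\<bar>"
        by (simp add: u_def abs_mult flip: right_diff_distrib)
      also have "\<dots> \<le> u z * (\<bar>D z\<bar> * (real j * (1 + r z ^ j)))"
        unfolding r_def D_def using m mean_exp_pos[OF C1, of z]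
        by (intro mult_left_mono inverse_power_diff_le) (auto simp: u_def)
      also have "\<dots> = \<bar>D z\<bar> * Y z" by (simp add: Y_def)
      also have "\<dots> \<le> sqrt (real C) * (D z)\<^sup>2 + (Y z)\<^sup>2 / sqrt (real C)"
      proof -
        \<comment> \<open>AM-GM with weight t = C^(1/4): the second moment of \<open>D\<close> is w
          / C and that of \<open>Y\<close> is at most \<open>K\<close>, so both terms become O(1 /
          sqrt C).\<close>
        define t where "t = sqrt (sqrt (real C))"
        have t: "t > 0" "t\<^sup>2 = sqrt (real C)" using C by (auto simp: t_def)
        have "0 \<le> (t * \<bar>D z\<bar> - Y z / t)\<^sup>2" by simp
        also have "\<dots> = t\<^sup>2 * (D z)\<^sup>2 + (Y z)\<^sup>2 / t\<^sup>2 - 2 * (\<bar>D z\<bar> * Y z)"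
          using t(1) by (simp add: power2_diff power_mult_distrib power_divide)
        finally have "2 * (\<bar>D z\<bar> * Y z) \<le> t\<^sup>2 * (D z)\<^sup>2 + (Y z)\<^sup>2 / t\<^sup>2" by simp
        moreover have "0 \<le> \<bar>D z\<bar> * Y z" using rpos[of z] by (simp add: Y_def u_def)
        ultimately show ?thesis unfolding t by linarith
      qed
      finally show "\<bar>u z * r z ^ j - u z * inverse m ^ j\<bar> \<le> sqrt (real C) * (D z)\<^sup>2 + (Y z)\<^sup>2 / sqrt (real C)" .
    next
      show "integrable ?S (\<lambda>z. \<bar>u z * r z ^ j - u z * inverse m ^ j\<bar>)"
        by (intro all_moments_integrable all_moments_abs std_gaussian.all_moments_diff all_moments_mult uam ram std_gaussian.all_moments_const)
      show "integrable ?S (\<lambda>z. sqrt (real C) * (D z)\<^sup>2 + (Y z)\<^sup>2 / sqrt (real C))"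
        unfolding divide_inverse
        by (intro all_moments_integrable all_moments_add all_moments_mult std_gaussian.all_moments_power Dam Yam std_gaussian.all_moments_const)
    qed
    also have "\<dots> = sqrt (real C) * (w / real C) + (\<integral>z. (Y z)\<^sup>2 \<partial>?S) / sqrt (real C)"
      using ED all_moments_integrable[OF std_gaussian.all_moments_power[OF Dam]]
        all_moments_integrable[OF std_gaussian.all_moments_power[OF Yam]] by simp
    also have "\<dots> \<le> sqrt (real C) * (w / real C) + K / sqrt (real C)"
      using EY by (intro add_left_mono divide_right_mono) auto
    also have "sqrt (real C) * (w / real C) = w / sqrt (real C)"
      using C by (simp add: field_simps flip: real_sqrt_mult)
    finally show ?thesis by (simp add: add_divide_distrib)
  qed
  have E: "E 1 * inverse m ^ j = exp ((real a)\<^sup>2 / 2 + (real b)\<^sup>2 / 2 - real j / 2)"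
  proof -
    have "inverse m ^ j = exp (- real j / 2)"
      by (simp add: m_def exp_minus[symmetric] exp_of_nat_mult[symmetric])
    then show ?thesis by (simp add: E_def flip: exp_add)
  qed
  have "(\<lambda>C. (w + K) / sqrt (real C)) \<longlonglongrightarrow> 0"
    by (intro tendsto_divide_0[OF tendsto_const] filterlim_at_top_imp_at_infinity
          filterlim_compose[OF sqrt_at_top filterlim_real_sequentially])
  then have "(\<lambda>C. I C - E 1 * inverse m ^ j) \<longlonglongrightarrow> 0"
    by (rule Lim_null_comparison[rotated]) (use main in \<open>auto intro: eventually_sequentiallyI[of 2]\<close>)
  then show ?thesis unfolding E[symmetric] I_def by (rule LIM_zero_cancel)
qed

section \<open>The functions g in terms of exponential moments\<close>

definition exp_moment :: "nat \<Rightarrow> nat \<Rightarrow> nat \<Rightarrow> nat \<Rightarrow> real" where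
  "exp_moment a b j C = (\<integral>z. exp (real a * z 1 + real b * z 2) * inverse (mean_exp C z) ^ j \<partial>std_gaussian C)"

lemma integrable_exp_moment:
  assumes "C \<ge> 2"
  shows "integrable (std_gaussian C) (\<lambda>z. exp (real a * z 1 + real b * z 2) * inverse (mean_exp C z) ^ j)"
  unfolding exp_add using assms
  by (intro all_moments_integrable all_moments_mult all_moments_component[of 1 C "\<lambda>y. exp (_ * y)"]
     all_moments_component[of 2 C "\<lambda>y. exp (_ * y)"] all_moments_gauss_exp all_moments_inverse_mean_exp) auto

lemma exp_moment_tendsto: "exp_moment a b j \<longlonglongrightarrow> exp ((real a)\<^sup>2 / 2 + (real b)\<^sup>2 / 2 - real j / 2)"
  using tendsto_integral_exp_inverse_mean_exp[of a b j] by (simp add: exp_moment_def[abs_def])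

lemma exp_sum_eq_mean_exp: "C \<ge> 1 \<Longrightarrow> (\<Sum>l\<in>{1..C}. exp (z l)) = real C * mean_exp C z"
  by (simp add: mean_exp_def)

lemma exp_mult_power: "(exp x * r) ^ n = exp (real n * x) * (r::real) ^ n"
  by (simp add: power_mult_distrib exp_of_nat_mult)

text \<open>A softmax probability is exp (z 1) / (C * mean_exp), so C * h1 is a polynomial in
  \<open>f 1\<close> with coefficients in powers of 1 / C; each factor C of the normalization
  cancels one denominator.\<close>

lemma g_diag_eq_exp_moment:
  assumes C: "C \<ge> 2"
  shows "(real C)\<^sup>2 * g_diag \<gamma> C =
    \<gamma> * (exp_moment 2 0 2 C - 2 * exp_moment 3 0 3 C / real C + exp_moment 4 0 4 C / (real C)\<^sup>2)
    + (exp_moment 1 0 1 C - exp_moment 2 0 2 C / real C)\<^sup>2"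
proof -
  let ?S = "std_gaussian C"
  define f where "f = (\<lambda>n z. exp (real n * z (1::nat)) * inverse (mean_exp C z) ^ n)"
  have fi: "integrable ?S (f n)" and fe: "(\<integral>z. f n z \<partial>?S) = exp_moment n 0 n C" for n
    using integrable_exp_moment[OF C, of n 0 n] by (simp_all add: f_def exp_moment_def)
  have C0: "real C \<noteq> 0" using C by simp
  have h: "h1 C z = (f 1 z - f 2 z / real C) / real C" for z
  proof -
    have R: "mean_exp C z \<noteq> 0" using mean_exp_pos[of C z] C by simp
    have f2: "f 2 z = (f 1 z)\<^sup>2" using exp_mult_power[of "z 1" "inverse (mean_exp C z)" 2] by (simp add: f_def)
    have p: "exp (z 1) / (\<Sum>l\<in>{1..C}. exp (z l)) = f 1 z / real C"
      using C R by (subst exp_sum_eq_mean_exp) (simp_all add: f_def field_simps)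
    show ?thesis unfolding h1_def p f2 using C0 by (simp add: field_simps power2_eq_square)
  qed
  have h2: "(h1 C z)\<^sup>2 = (f 2 z - 2 * f 3 z / real C + f 4 z / (real C)\<^sup>2) / (real C)\<^sup>2" for z
  proof -
    have "f n z = (f 1 z) ^ n" for n
      using exp_mult_power[of "z 1" "inverse (mean_exp C z)" n] by (simp add: f_def)
    then have "f 2 z = f 1 z ^ 2" "f 3 z = f 1 z ^ 3" "f 4 z = f 1 z ^ 4" by blast+
    then show ?thesis unfolding h using C0
      by (simp add: field_simps eval_nat_numeral)
  qed
  have 1: "real C * (\<integral>z. h1 C z \<partial>?S) = exp_moment 1 0 1 C - exp_moment 2 0 2 C / real C"
    unfolding h using C0 fi[of 1] fi[of 2] fe[of 1] fe[of 2] by simp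
  have 2: "(real C)\<^sup>2 * (\<integral>z. (h1 C z)\<^sup>2 \<partial>?S) =
      exp_moment 2 0 2 C - 2 * exp_moment 3 0 3 C / real C + exp_moment 4 0 4 C / (real C)\<^sup>2"
    unfolding h2 using C0 fi[of 2] fi[of 3] fi[of 4] fe[of 2] fe[of 3] fe[of 4] by simp
  show ?thesis unfolding 1[symmetric] 2[symmetric] g_diag_def by (simp add: algebra_simps)
qed

lemma g_off_eq_exp_moment:
  assumes C: "C \<ge> 2"
  shows "(real C) ^ 4 * g_off \<gamma> C = \<gamma> * exp_moment 2 2 4 C + (exp_moment 1 1 2 C)\<^sup>2"
proof -
  let ?S = "std_gaussian C"
  have C0: "real C \<noteq> 0" using C by simp
  have h: "h2 C z = exp (real 1 * z 1 + real 1 * z 2) * inverse (mean_exp C z) ^ 2 / (real C)\<^sup>2" for z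
    using C mean_exp_pos[of C z] unfolding h2_def
    by (subst exp_sum_eq_mean_exp) (simp_all add: field_simps)
  have hs: "(h2 C z)\<^sup>2 = exp (real 2 * z 1 + real 2 * z 2) * inverse (mean_exp C z) ^ 4 / (real C) ^ 4" for z
    unfolding h by (simp add: power_divide power_mult_distrib exp_double[symmetric] distrib_left flip: power_mult)
  have 1: "(real C)\<^sup>2 * (\<integral>z. h2 C z \<partial>?S) = exp_moment 1 1 2 C"
    unfolding h exp_moment_def using C0 by simp
  have 2: "(real C) ^ 4 * (\<integral>z. (h2 C z)\<^sup>2 \<partial>?S) = exp_moment 2 2 4 C"
    unfolding hs exp_moment_def using C0 by simp
  show ?thesis unfolding 1[symmetric] 2[symmetric] g_off_def
    by (simp add: distrib_left power_mult_distrib flip: power_mult)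
qed

lemma g_diag_asymptotics: "(\<lambda>C. (real C)\<^sup>2 * g_diag \<gamma> C) \<longlonglongrightarrow> \<gamma> * exp 1 + 1"
proof -
  \<comment> \<open>The limiting exponents are 2 - 1 and 1/2 - 1/2. All other moments carry a factor
    1 / C and disappear.\<close>
  have e: "exp_moment 2 0 2 \<longlonglongrightarrow> exp 1" "exp_moment 1 0 1 \<longlonglongrightarrow> 1"
    using exp_moment_tendsto[of 2 0 2] exp_moment_tendsto[of 1 0 1] by simp_all
  have z: "(\<lambda>C. exp_moment a b j C / real C) \<longlonglongrightarrow> 0" for a b j
    by (rule tendsto_divide_0[OF exp_moment_tendsto])
       (rule filterlim_at_top_imp_at_infinity[OF filterlim_real_sequentially])
  have z2: "(\<lambda>C. exp_moment a b j C / (real C)\<^sup>2) \<longlonglongrightarrow> 0" for a b j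
    using tendsto_mult[OF z[of a b j] lim_1_over_n] by (simp add: power2_eq_square)
  have "(\<lambda>C. \<gamma> * (exp_moment 2 0 2 C - 2 * (exp_moment 3 0 3 C / real C) + exp_moment 4 0 4 C / (real C)\<^sup>2)
    + (exp_moment 1 0 1 C - exp_moment 2 0 2 C / real C)\<^sup>2)
      \<longlonglongrightarrow> \<gamma> * (exp 1 - 2 * 0 + 0) + (1 - 0)\<^sup>2"
    by (intro tendsto_intros e z z2)
  then have "(\<lambda>C. \<gamma> * (exp_moment 2 0 2 C - 2 * exp_moment 3 0 3 C / real C + exp_moment 4 0 4 C / (real C)\<^sup>2)
    + (exp_moment 1 0 1 C - exp_moment 2 0 2 C / real C)\<^sup>2) \<longlonglongrightarrow> \<gamma> * exp 1 + 1" by simp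
  then show ?thesis
    by (rule Lim_transform_eventually)
       (auto intro!: eventually_sequentiallyI[of 2] simp: g_diag_eq_exp_moment)
qed

lemma g_off_asymptotics: "(\<lambda>C. (real C) ^ 4 * g_off \<gamma> C) \<longlonglongrightarrow> \<gamma> * (exp 1)\<^sup>2 + 1"
proof -
  \<comment> \<open>Here the exponents are 2 + 2 - 2 and 1/2 + 1/2 - 1.\<close>
  have e: "exp_moment 2 2 4 \<longlonglongrightarrow> (exp 1)\<^sup>2" "exp_moment 1 1 2 \<longlonglongrightarrow> 1"
    using exp_moment_tendsto[of 2 2 4] exp_moment_tendsto[of 1 1 2] by (simp_all flip: exp_double)
  have "(\<lambda>C. \<gamma> * exp_moment 2 2 4 C + (exp_moment 1 1 2 C)\<^sup>2) \<longlonglongrightarrow> \<gamma> * (exp 1)\<^sup>2 + 1\<^sup>2"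
    by (intro tendsto_intros e)
  then have "(\<lambda>C. \<gamma> * exp_moment 2 2 4 C + (exp_moment 1 1 2 C)\<^sup>2) \<longlonglongrightarrow> \<gamma> * (exp 1)\<^sup>2 + 1" by simp
  then show ?thesis
    by (rule Lim_transform_eventually)
       (auto intro!: eventually_sequentiallyI[of 2] simp: g_off_eq_exp_moment)
qed

subsection \<open>Smooth weights and softmax\<close>

definition l1 :: "nat \<Rightarrow> (nat \<Rightarrow> real) \<Rightarrow> real" where
  "l1 C w = (\<Sum>c\<in>{1..C}. \<bar>w c\<bar>)"

lemma l1_nonneg: "0 \<le> l1 C w"
  by (simp add: l1_def sum_nonneg)

lemma l1_cmult: "l1 C (\<lambda>c. t * w c) = \<bar>t\<bar> * l1 C w"
  by (simp add: l1_def abs_mult sum_distrib_left)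

text \<open>Difference bounds replace derivatives: the symmetric second difference is exactly what
  reflection of a Gaussian coordinate produces, and both bounds are stable under products.
  Quantifying over all functions z and w while \<open>l1\<close> sees only the entries 1 to C also
  forces f to depend on these entries alone.\<close>

definition smooth_weight :: "nat \<Rightarrow> real \<Rightarrow> ((nat \<Rightarrow> real) \<Rightarrow> real) \<Rightarrow> bool" where
  "smooth_weight C K f \<longleftrightarrow>
     f \<in> borel_measurable (Pi\<^sub>M {1..C} (\<lambda>_. borel)) \<and> (\<forall>z. 0 \<le> f z \<and> f z \<le> 1) \<and>
     (\<forall>z w. \<bar>f (\<lambda>c. z c + w c) - f z\<bar> \<le> K * l1 C w) \<and>
     (\<forall>z w. \<bar>f (\<lambda>c. z c + w c) + f (\<lambda>c. z c - w c) - 2 * f z\<bar> \<le> K * (l1 C w)\<^sup>2)"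

lemma smooth_weightD:
  assumes "smooth_weight C K f"
  shows "f \<in> borel_measurable (Pi\<^sub>M {1..C} (\<lambda>_. borel))" "0 \<le> f z" "f z \<le> 1" "\<bar>f z\<bar> \<le> 1"
    "\<bar>f (\<lambda>c. z c + w c) - f z\<bar> \<le> K * l1 C w"
    "\<bar>f (\<lambda>c. z c + w c) + f (\<lambda>c. z c - w c) - 2 * f z\<bar> \<le> K * (l1 C w)\<^sup>2"
  using assms by (auto simp: smooth_weight_def)

lemma smooth_weight_cong:
  assumes "smooth_weight C K f" "\<And>c. c \<in> {1..C} \<Longrightarrow> z c = z' c"
  shows "f z = f z'"
proof -
  have "l1 C (\<lambda>c. z' c - z c) = 0" using assms(2) by (simp add: l1_def)
  then show ?thesis using smooth_weightD(5)[OF assms(1), of z "\<lambda>c. z' c - z c"] by simp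
qed

lemma smooth_weight_one_minus:
  assumes f: "smooth_weight C K f"
  shows "smooth_weight C K (\<lambda>z. 1 - f z)"
  unfolding smooth_weight_def
proof (intro conjI allI)
  show "(\<lambda>z. 1 - f z) \<in> borel_measurable (Pi\<^sub>M {1..C} (\<lambda>_. borel))"
    using smooth_weightD(1)[OF f] by measurable
  fix z w
  show "0 \<le> 1 - f z" "1 - f z \<le> 1" using smooth_weightD(2,3)[OF f, of z] by auto
  show "\<bar>1 - f (\<lambda>c. z c + w c) - (1 - f z)\<bar> \<le> K * l1 C w"
    using smooth_weightD(5)[OF f, of z w] by linarith
  show "\<bar>1 - f (\<lambda>c. z c + w c) + (1 - f (\<lambda>c. z c - w c)) - 2 * (1 - f z)\<bar> \<le> K * (l1 C w)\<^sup>2"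
  proof -
    have "1 - a + (1 - b) - 2 * (1 - c) = - (a + b - 2 * c)" for a b c :: real by simp
    then show ?thesis using smooth_weightD(6)[OF f, of z w] by (simp only: abs_minus_cancel)
  qed
qed

text \<open>The product rule for differences. Cross terms \<open>a * c\<close> and
  \<open>b * e\<close> are products of two first differences, hence the summand quadratic in
  \<open>K\<close>.\<close>

lemma smooth_weight_mult:
  assumes f: "smooth_weight C K f" and g: "smooth_weight C K g" and K: "K \<ge> 0"
  shows "smooth_weight C (2 * K + 2 * K\<^sup>2) (\<lambda>z. f z * g z)"
  unfolding smooth_weight_def
proof (intro conjI allI)
  show "(\<lambda>z. f z * g z) \<in> borel_measurable (Pi\<^sub>M {1..C} (\<lambda>_. borel))"
    using smooth_weightD(1)[OF f] smooth_weightD(1)[OF g] by measurable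
  fix z w
  show "0 \<le> f z * g z" "f z * g z \<le> 1"
    using smooth_weightD(2,3)[OF f, of z] smooth_weightD(2,3)[OF g, of z] by (auto intro: mult_le_one)
  define W where "W = l1 C w"
  have W: "W \<ge> 0" by (simp add: W_def l1_nonneg)
  define a b where "a = f (\<lambda>c. z c + w c) - f z" and "b = f (\<lambda>c. z c - w c) - f z"
  define c e where "c = g (\<lambda>c. z c + w c) - g z" and "e = g (\<lambda>c. z c - w c) - g z"
  have neg: "l1 C (\<lambda>c. - w c) = W" by (simp add: W_def l1_def)
  have d: "\<bar>a\<bar> \<le> K * W" "\<bar>b\<bar> \<le> K * W" "\<bar>c\<bar> \<le> K * W" "\<bar>e\<bar> \<le> K * W"
    using smooth_weightD(5)[OF f, of z w] smooth_weightD(5)[OF f, of z "\<lambda>c. - w c"]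
      smooth_weightD(5)[OF g, of z w] smooth_weightD(5)[OF g, of z "\<lambda>c. - w c"]
    by (simp_all add: a_def b_def c_def e_def neg W_def[symmetric])
  have s: "\<bar>a + b\<bar> \<le> K * W\<^sup>2" "\<bar>c + e\<bar> \<le> K * W\<^sup>2"
    using smooth_weightD(6)[OF f, of z w] smooth_weightD(6)[OF g, of z w]
    by (simp_all add: a_def b_def c_def e_def W_def algebra_simps)
  have le1: "\<bar>x * y\<bar> \<le> B" if "\<bar>x\<bar> \<le> 1" "\<bar>y\<bar> \<le> B" for x y B :: real
    using mult_mono[OF that] that by (simp add: abs_mult)
  have le2: "\<bar>x * y\<bar> \<le> K\<^sup>2 * W\<^sup>2" if "\<bar>x\<bar> \<le> K * W" "\<bar>y\<bar> \<le> K * W" for x y :: real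
    using mult_mono[OF that] K W by (simp add: abs_mult power2_eq_square mult_ac)
  have "f (\<lambda>c. z c + w c) * g (\<lambda>c. z c + w c) - f z * g z = g (\<lambda>c. z c + w c) * a + f z * c"
    by (simp add: a_def c_def algebra_simps)
  moreover have "\<bar>g (\<lambda>c. z c + w c) * a\<bar> \<le> K * W" "\<bar>f z * c\<bar> \<le> K * W"
    by (intro le1 d smooth_weightD(4)[OF f] smooth_weightD(4)[OF g])+
  moreover have "2 * (K * W) \<le> (2 * K + 2 * K\<^sup>2) * W"
    using K W by (simp add: distrib_right)
  ultimately show "\<bar>f (\<lambda>c. z c + w c) * g (\<lambda>c. z c + w c) - f z * g z\<bar> \<le> (2 * K + 2 * K\<^sup>2) * l1 C w"
    unfolding W_def[symmetric] by linarith
  have "f (\<lambda>c. z c + w c) * g (\<lambda>c. z c + w c) + f (\<lambda>c. z c - w c) * g (\<lambda>c. z c - w c) - 2 * (f z * g z)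
     = f z * (c + e) + g z * (a + b) + a * c + b * e"
    by (simp add: a_def b_def c_def e_def algebra_simps)
  moreover have "\<bar>f z * (c + e)\<bar> \<le> K * W\<^sup>2" "\<bar>g z * (a + b)\<bar> \<le> K * W\<^sup>2"
    by (intro le1 s smooth_weightD(4)[OF f] smooth_weightD(4)[OF g])+
  moreover have "\<bar>a * c\<bar> \<le> K\<^sup>2 * W\<^sup>2" "\<bar>b * e\<bar> \<le> K\<^sup>2 * W\<^sup>2"
    by (intro le2 d)+
  moreover have "(2 * K + 2 * K\<^sup>2) * W\<^sup>2 = 2 * (K * W\<^sup>2) + 2 * (K\<^sup>2 * W\<^sup>2)"
    by (simp add: algebra_simps)
  ultimately show "\<bar>f (\<lambda>c. z c + w c) * g (\<lambda>c. z c + w c) + f (\<lambda>c. z c - w c) * g (\<lambda>c. z c - w c) - 2 * (f z * g z)\<bar>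
      \<le> (2 * K + 2 * K\<^sup>2) * (l1 C w)\<^sup>2"
    unfolding W_def[symmetric] by linarith
qed

definition softmax :: "nat \<Rightarrow> (nat \<Rightarrow> real) \<Rightarrow> nat \<Rightarrow> real" where
  "softmax C z i = exp (z i) / (\<Sum>c\<in>{1..C}. exp (z c))"

lemma softmax_prob_eq: "softmax_prob C d V x i = softmax C (\<lambda>c. dot d (V c) x) i"
  by (simp add: softmax_prob_def softmax_def)

lemma softmax_bounds:
  assumes "i \<in> {1..C}"
  shows "0 \<le> softmax C z i" "softmax C z i \<le> 1"
proof -
  have p: "0 < (\<Sum>c\<in>{1..C}. exp (z c))" by (rule sum_exp_pos[OF assms])
  have "exp (z i) \<le> (\<Sum>c\<in>{1..C}. exp (z c))"
    using assms by (intro member_le_sum) auto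
  then show "softmax C z i \<le> 1" "0 \<le> softmax C z i" using p by (simp_all add: softmax_def)
qed

text \<open>Along a line, with W the l1 norm of the direction, |q'| \<le> 2 W and |q''| \<le> 6 W^2,
  so the first difference is at most 2 W and the second at most 2 * 6 W^2. The number of classes
  enters only through W.\<close>

lemma smooth_weight_softmax:
  assumes i: "i \<in> {1..C}"
  shows "smooth_weight C 12 (\<lambda>z. softmax C z i)"
proof -
  have "(\<lambda>z. softmax C z i) \<in> borel_measurable (Pi\<^sub>M {1..C} (\<lambda>_. borel))"
    unfolding softmax_def using i by measurable
  moreover have "\<bar>softmax C (\<lambda>c. z c + w c) i - softmax C z i\<bar> \<le> 12 * l1 C w \<and>
     \<bar>softmax C (\<lambda>c. z c + w c) i + softmax C (\<lambda>c. z c - w c) i - 2 * softmax C z i\<bar> \<le> 12 * (l1 C w)\<^sup>2" for z w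
  proof -
    define W where "W = l1 C w"
    have W: "W \<ge> 0" by (simp add: W_def l1_nonneg)
    \<comment> \<open>Probabilities along the line z + t w. Below, \<open>m\<close> is the mean of
      \<open>w\<close> under them; the derivative of q_c is q_c (w_c - m).\<close>
    define q where "q = (\<lambda>c t. softmax C (\<lambda>c. z c + t * w c) c)"
    define m where "m = (\<lambda>t. \<Sum>c\<in>{1..C}. w c * q c t)"
    define q1 where "q1 = (\<lambda>c t. q c t * (w c - m t))"
    define m1 where "m1 = (\<lambda>t. \<Sum>c\<in>{1..C}. w c * q1 c t)"
    have qb: "0 \<le> q c t" "q c t \<le> 1" if "c \<in> {1..C}" for c t
      using softmax_bounds[OF that] by (auto simp: q_def)
    have dq: "(q c has_real_derivative q1 c t) (at t)" if c: "c \<in> {1..C}" for c t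
    proof -
      define S where "S = (\<lambda>t. \<Sum>c\<in>{1..C}. exp (z c + t * w c))"
      have S: "S t > 0" for t unfolding S_def by (rule sum_exp_pos[OF i])
      have dS: "(S has_real_derivative (\<Sum>c\<in>{1..C}. exp (z c + t * w c) * w c)) (at t)"
        unfolding S_def by (auto intro!: derivative_eq_intros sum.cong)
      have qS: "q c = (\<lambda>t. exp (z c + t * w c) / S t)" for c by (simp add: q_def softmax_def S_def)
      have m': "(\<Sum>c\<in>{1..C}. exp (z c + t * w c) * w c) = m t * S t"
        unfolding m_def qS sum_distrib_right using S[of t] by (intro sum.cong) auto
      have "((\<lambda>t. exp (z c + t * w c) / S t) has_real_derivative
         (exp (z c + t * w c) * w c * S t - exp (z c + t * w c) * (m t * S t)) / (S t * S t)) (at t)"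
        using S[of t] by (auto intro!: derivative_eq_intros dS simp: m' simp del: One_nat_def)
      then show ?thesis unfolding qS
        by (rule DERIV_cong) (use S[of t] in \<open>simp add: q1_def qS field_simps\<close>)
    qed
    have dm: "(m has_real_derivative m1 t) (at t)" for t
      unfolding m_def m1_def by (intro DERIV_sum DERIV_cmult dq)
    have dq1: "(q1 i has_real_derivative q1 i t * (w i - m t) - q i t * m1 t) (at t)" for t
      unfolding q1_def by (rule DERIV_cong[OF DERIV_mult[OF dq[OF i] DERIV_diff[OF DERIV_const dm]]])
         (simp add: q1_def)
    have mb: "\<bar>m t\<bar> \<le> W" for t
    proof -
      have "\<bar>m t\<bar> \<le> (\<Sum>c\<in>{1..C}. \<bar>w c * q c t\<bar>)" unfolding m_def by (rule sum_abs)
      also have "\<dots> \<le> W" unfolding W_def l1_def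
        using qb by (intro sum_mono) (auto simp: abs_mult intro!: mult_left_le)
      finally show ?thesis .
    qed
    have wb: "\<bar>w c\<bar> \<le> W" if "c \<in> {1..C}" for c
      unfolding W_def l1_def using that by (intro member_le_sum[of c _ "\<lambda>c. \<bar>w c\<bar>"]) auto
    have q1b: "\<bar>q1 c t\<bar> \<le> 2 * W" if c: "c \<in> {1..C}" for c t
    proof -
      have "\<bar>q1 c t\<bar> \<le> 1 * \<bar>w c - m t\<bar>"
        unfolding q1_def abs_mult using qb[OF c] by (intro mult_right_mono) auto
      also have "\<dots> \<le> 2 * W" using abs_triangle_ineq4[of "w c" "m t"] mb[of t] wb[OF c] by simp
      finally show ?thesis .
    qed
    have m1b: "\<bar>m1 t\<bar> \<le> 2 * W\<^sup>2" for t
    proof -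
      have "\<bar>m1 t\<bar> \<le> (\<Sum>c\<in>{1..C}. \<bar>w c * q1 c t\<bar>)" unfolding m1_def by (rule sum_abs)
      also have "\<dots> \<le> (\<Sum>c\<in>{1..C}. \<bar>w c\<bar> * (2 * W))"
        using q1b by (intro sum_mono) (auto simp: abs_mult intro!: mult_left_mono)
      also have "\<dots> = 2 * W\<^sup>2"
        by (simp add: W_def l1_def power2_eq_square mult_ac flip: sum_distrib_right)
      finally show ?thesis .
    qed
    have q2b: "\<bar>q1 i t * (w i - m t) - q i t * m1 t\<bar> \<le> 6 * W\<^sup>2" for t
    proof -
      have "\<bar>q1 i t * (w i - m t)\<bar> \<le> (2 * W) * (2 * W)"
        unfolding abs_mult using q1b[OF i, of t] abs_triangle_ineq4[of "w i" "m t"] mb[of t] wb[OF i] W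
        by (intro mult_mono) auto
      moreover have "\<bar>q i t * m1 t\<bar> \<le> 1 * (2 * W\<^sup>2)"
        unfolding abs_mult using qb[OF i, of t] m1b[of t] by (intro mult_mono) auto
      ultimately show ?thesis by (simp add: power2_eq_square)
    qed
    have q01: "q i 1 = softmax C (\<lambda>c. z c + w c) i" "q i (-1) = softmax C (\<lambda>c. z c - w c) i" "q i 0 = softmax C z i"
      by (simp_all add: q_def)
    have 1: "\<bar>q i 1 - q i 0\<bar> \<le> 2 * W"
    proof -
      obtain t where "q i 1 - q i 0 = (1 - 0) * q1 i t"
        using MVT2[of 0 1 "q i" "q1 i"] dq[OF i] by auto
      then show ?thesis using q1b[OF i, of t] by simp
    qed
    have 2: "\<bar>q i 1 + q i (-1) - 2 * q i 0\<bar> \<le> 12 * W\<^sup>2"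
    proof -
      \<comment> \<open>Mean value theorem twice: for q(t) + q(-t) on [0, 1], then for q' on
        [-t, t], an interval of length at most 2.\<close>
      have d: "((\<lambda>t. q i t + q i (- t)) has_real_derivative q1 i t - q1 i (- t)) (at t)" for t
        by (rule DERIV_cong[OF DERIV_add[OF dq[OF i] DERIV_chain2[OF dq[OF i] DERIV_minus[OF DERIV_ident]]]]) simp
      obtain t where t: "0 < t" "t < 1" "(q i 1 + q i (- 1)) - (q i 0 + q i (- 0)) = (1 - 0) * (q1 i t - q1 i (- t))"
        using MVT2[of 0 1 "\<lambda>t. q i t + q i (- t)" "\<lambda>t. q1 i t - q1 i (- t)"] d by auto
      obtain s where s: "q1 i t - q1 i (- t) = (t - (- t)) * (q1 i s * (w i - m s) - q i s * m1 s)"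
        using MVT2[of "- t" t "q1 i" "\<lambda>s. q1 i s * (w i - m s) - q i s * m1 s"] dq1 t by auto
      have "\<bar>q1 i t - q1 i (- t)\<bar> \<le> 2 * (6 * W\<^sup>2)"
        unfolding s abs_mult using t q2b[of s] by (intro mult_mono) auto
      then show ?thesis using t(3) by simp
    qed
    show ?thesis using 1 2 W unfolding q01 W_def by (auto intro: order_trans)
  qed
  ultimately show ?thesis
    unfolding smooth_weight_def using softmax_bounds[OF i] by blast
qed

subsection \<open>Quadratic forms of a Gaussian vector\<close>

text \<open>The degree-two Hermite polynomials. Over ordered index pairs, an off-diagonal polynomial
  of norm 1 occurs twice while a diagonal one has squared norm 2, so symmetric coefficients see a
  uniform factor 2.\<close>

definition quad :: "nat \<Rightarrow> nat \<Rightarrow> (nat \<Rightarrow> real) \<Rightarrow> real" where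
  "quad k l x = x k * x l - (if k = l then 1 else 0)"

lemma quad_commute: "quad k l = quad l k"
  by (auto simp: quad_def fun_eq_iff)

lemma quad_upd: "i \<noteq> k \<Longrightarrow> i \<noteq> l \<Longrightarrow> quad k l (x(i := y)) = quad k l x"
  by (simp add: quad_def)

lemma all_moments_quad: "k \<in> {1..d} \<Longrightarrow> l \<in> {1..d} \<Longrightarrow> all_moments (std_gaussian d) (quad k l)"
  unfolding quad_def[abs_def]
  by (intro std_gaussian.all_moments_diff all_moments_mult all_moments_coord std_gaussian.all_moments_const)

text \<open>Wick's formula with its two pairings. Either the index pairs agree up to order, or some
  index is absent from the other factor and its coordinate contributes a centred polynomial, which
  integrates to zero.\<close>

lemma integral_quad_quad:
  assumes k: "k \<in> {1..d}" and l: "l \<in> {1..d}" and m: "m \<in> {1..d}" and n: "n \<in> {1..d}"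
  shows "(\<integral>x. quad k l x * quad m n x \<partial>std_gaussian d)
    = (if k = m \<and> l = n then 1 else 0) + (if k = n \<and> l = m then 1 else 0)"
proof -
  let ?S = "std_gaussian d"
  have zero: "(\<integral>x. quad k l x * quad m n x \<partial>?S) = 0"
    if "k \<in> {1..d}" "l \<in> {1..d}" "m \<in> {1..d}" "n \<in> {1..d}" "k \<noteq> m" "k \<noteq> n" for k l m n
  proof (cases "k = l")
    case True
    have i: "integrable gauss (\<lambda>y. y\<^sup>2)"
      by (rule all_moments_integrable[OF gauss.all_moments_power[OF all_moments_gauss_id]])
    have "(\<integral>x. ((x k)\<^sup>2 - 1) * quad m n x \<partial>?S) = 0"
    proof (rule integral_coord_zero[where u = "\<lambda>y. y\<^sup>2 - 1"])
      show "integrable ?S (\<lambda>x. ((x k)\<^sup>2 - 1) * quad m n x)"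
        using that by (intro all_moments_integrable all_moments_mult all_moments_quad
           std_gaussian.all_moments_diff std_gaussian.all_moments_const std_gaussian.all_moments_power all_moments_coord)
      show "(\<integral>y. y\<^sup>2 - 1 \<partial>gauss) = 0" using i gauss.prob_space by simp
    qed (use that in \<open>auto simp: quad_upd\<close>)
    then show ?thesis using True by (simp add: quad_def power2_eq_square)
  next
    case False
    have "(\<integral>x. x k * (x l * quad m n x) \<partial>?S) = 0"
    proof (rule integral_coord_zero[where u = "\<lambda>y. y"])
      show "integrable ?S (\<lambda>x. x k * (x l * quad m n x))"
        using that by (intro all_moments_integrable all_moments_mult all_moments_quad all_moments_coord)
    qed (use that False in \<open>auto simp: quad_upd\<close>)
    then show ?thesis using False by (simp add: quad_def[of k l] mult.assoc)
  qed
  consider "k = m \<and> l = n \<or> k = n \<and> l = m" | "k \<noteq> m \<and> k \<noteq> n" | "l \<noteq> m \<and> l \<noteq> n" | "m \<noteq> k \<and> m \<noteq> l" | "n \<noteq> k \<and> n \<noteq> l"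
    by blast
  then show ?thesis
  proof cases
    case 1
    then have q: "quad m n = quad k l" using quad_commute[of k l] by auto
    show ?thesis
    proof (cases "k = l")
      case True
      have "(\<integral>x. quad k l x * quad m n x \<partial>?S) = (\<integral>x. (\<lambda>y. y ^ 4 - 2 * y\<^sup>2 + 1) (x k) \<partial>?S)"
        using True q by (intro Bochner_Integration.integral_cong) (auto simp: quad_def algebra_simps eval_nat_numeral)
      also have "\<dots> = (\<integral>y. y ^ 4 - 2 * y\<^sup>2 + 1 \<partial>gauss)"
        by (rule integral_component[OF k]) measurable
      also have "\<dots> = 2"
        using all_moments_integrable[OF gauss.all_moments_power[OF all_moments_gauss_id]] gauss.prob_space
        by simp
      finally show ?thesis using 1 True by auto
    next
      case False
      have "(\<integral>x. quad k l x * quad m n x \<partial>?S) = (\<integral>x. (x k)\<^sup>2 * (x l)\<^sup>2 \<partial>?S)"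
        using False q by (intro Bochner_Integration.integral_cong) (auto simp: quad_def power2_eq_square)
      also have "\<dots> = 1"
        using integral_two_components[OF k l False, of "\<lambda>y. y\<^sup>2" "\<lambda>y. y\<^sup>2"]
          all_moments_integrable[OF gauss.all_moments_power[OF all_moments_gauss_id]] by simp
      finally show ?thesis using 1 False by auto
    qed
  next
    case 2 then show ?thesis using zero[OF k l m n] by auto
  next
    case 3 then show ?thesis using zero[OF l k m n] unfolding quad_commute[of l k] by auto
  next
    case 4 then show ?thesis using zero[OF m n k l] by (auto simp: mult.commute)
  next
    case 5 then show ?thesis using zero[OF n m k l] unfolding quad_commute[of n m] by (auto simp: mult.commute)
  qed
qed

definition quad_form :: "nat \<Rightarrow> (nat \<Rightarrow> nat \<Rightarrow> real) \<Rightarrow> (nat \<Rightarrow> real) \<Rightarrow> real" where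
  "quad_form d b x = (\<Sum>k\<in>{1..d}. \<Sum>l\<in>{1..d}. b k l * quad k l x)"

lemma all_moments_quad_form: "all_moments (std_gaussian d) (quad_form d b)"
  unfolding quad_form_def[abs_def]
  by (intro std_gaussian.all_moments_sum std_gaussian.all_moments_cmult all_moments_quad)

lemma integral_mult_quad_form:
  assumes f: "all_moments (std_gaussian d) f"
  shows "(\<integral>x. f x * quad_form d b x \<partial>std_gaussian d)
    = (\<Sum>k\<in>{1..d}. \<Sum>l\<in>{1..d}. b k l * (\<integral>x. f x * quad k l x \<partial>std_gaussian d))"
proof -
  have "(\<integral>x. f x * quad_form d b x \<partial>std_gaussian d)
    = (\<integral>x. (\<Sum>k\<in>{1..d}. \<Sum>l\<in>{1..d}. b k l * (f x * quad k l x)) \<partial>std_gaussian d)"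
    by (simp add: quad_form_def sum_distrib_left mult_ac)
  also have "\<dots> = (\<Sum>k\<in>{1..d}. \<Sum>l\<in>{1..d}. \<integral>x. b k l * (f x * quad k l x) \<partial>std_gaussian d)"
    by (intro std_gaussian.integral_double_sum std_gaussian.all_moments_cmult all_moments_mult f all_moments_quad)
  finally show ?thesis by simp
qed

lemma integral_quad_form_square:
  assumes sym: "\<And>k l. b k l = b l k"
  shows "(\<integral>x. (quad_form d b x)\<^sup>2 \<partial>std_gaussian d) = 2 * (\<Sum>k\<in>{1..d}. \<Sum>l\<in>{1..d}. (b k l)\<^sup>2)"
proof -
  have 1: "(\<integral>x. quad_form d b x * quad k l x \<partial>std_gaussian d) = 2 * b k l" if k: "k \<in> {1..d}" and l: "l \<in> {1..d}" for k l
  proof -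
    have "(\<integral>x. quad_form d b x * quad k l x \<partial>std_gaussian d) =
      (\<Sum>m\<in>{1..d}. \<Sum>n\<in>{1..d}. b m n * (\<integral>x. quad k l x * quad m n x \<partial>std_gaussian d))"
      using integral_mult_quad_form[OF all_moments_quad[OF k l]] by (simp add: mult.commute)
    also have "\<dots> = (\<Sum>m\<in>{1..d}. \<Sum>n\<in>{1..d}. (if m = k then (if n = l then b m n else 0) else 0)
        + (if m = l then (if n = k then b m n else 0) else 0))"
      by (intro sum.cong refl, subst integral_quad_quad) (use k l in auto)
    also have "\<dots> = (\<Sum>m\<in>{1..d}. (if m = k then b m l else 0) + (if m = l then b m k else 0))"
    proof (intro sum.cong refl)
      fix m
      show "(\<Sum>n\<in>{1..d}. (if m = k then (if n = l then b m n else 0) else 0)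
        + (if m = l then (if n = k then b m n else 0) else 0)) = (if m = k then b m l else 0) + (if m = l then b m k else 0)"
        using k l by (cases "m = k"; cases "m = l") (auto simp: sum.distrib simp del: mult_2 simp flip: sum_distrib_left)
    qed
    also have "\<dots> = 2 * b k l" using k l sym[of l k] by (simp add: sum.distrib)
    finally show ?thesis .
  qed
  have "(\<integral>x. (quad_form d b x)\<^sup>2 \<partial>std_gaussian d) = (\<integral>x. quad_form d b x * quad_form d b x \<partial>std_gaussian d)"
    by (simp add: power2_eq_square)
  also have "\<dots> = (\<Sum>k\<in>{1..d}. \<Sum>l\<in>{1..d}. b k l * (2 * b k l))"
    unfolding integral_mult_quad_form[OF all_moments_quad_form] by (intro sum.cong refl, subst 1) auto
  finally show ?thesis by (simp add: sum_distrib_left power2_eq_square mult_ac)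
qed

text \<open>Let Q be the quadratic form with the coefficients \<open>b\<close> of \<open>a\<close>,
  and S their square sum. Then E[a Q] = S and E[Q^2] = 2 S, so Q / 2 is the projection of
  \<open>a\<close>, and 0 \<le> E[(a - Q/2)^2] = E[a^2] - S/2. The bound does not grow with the
  dimension.\<close>

lemma bessel_quad:
  assumes a: "a \<in> borel_measurable (std_gaussian d)" and a01: "\<And>x. 0 \<le> a x" "\<And>x. a x \<le> 1"
  shows "(\<Sum>k\<in>{1..d}. \<Sum>l\<in>{1..d}. (\<integral>x. a x * quad k l x \<partial>std_gaussian d)\<^sup>2) \<le> 2"
proof -
  let ?S = "std_gaussian d"
  define b where "b = (\<lambda>k l. \<integral>x. a x * quad k l x \<partial>?S)"
  define S where "S = (\<Sum>k\<in>{1..d}. \<Sum>l\<in>{1..d}. (b k l)\<^sup>2)"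
  have sym: "b k l = b l k" for k l unfolding b_def by (subst quad_commute) (rule refl)
  have am: "all_moments ?S a"
    using a01 by (intro std_gaussian.all_moments_bounded[OF a, of 1]) auto
  note q = all_moments_quad_form[of d b]
  have i: "integrable ?S (\<lambda>x. (a x)\<^sup>2)" "integrable ?S (\<lambda>x. a x * quad_form d b x)" "integrable ?S (\<lambda>x. (quad_form d b x)\<^sup>2)"
    by (intro all_moments_integrable std_gaussian.all_moments_power all_moments_mult am q)+
  have aq: "(\<integral>x. a x * quad_form d b x \<partial>?S) = S"
    unfolding integral_mult_quad_form[OF am] by (simp add: S_def b_def power2_eq_square)
  have "0 \<le> (\<integral>x. (a x - quad_form d b x / 2)\<^sup>2 \<partial>?S)" by simp
  also have "\<dots> = (\<integral>x. (a x)\<^sup>2 - a x * quad_form d b x + (quad_form d b x)\<^sup>2 / 4 \<partial>?S)"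
    by (intro Bochner_Integration.integral_cong refl) (simp add: power2_eq_square algebra_simps)
  also have "\<dots> = (\<integral>x. (a x)\<^sup>2 \<partial>?S) - S + 2 * S / 4"
    using i aq integral_quad_form_square[OF sym, of d] S_def[symmetric] by simp
  also have "(\<integral>x. (a x)\<^sup>2 \<partial>?S) \<le> (\<integral>x. 1 \<partial>?S)"
    using a01 by (intro integral_mono i) (auto simp: abs_square_le_1)
  finally show ?thesis by (simp add: S_def b_def std_gaussian.prob_space)
qed

section \<open>The squared norm, and the diagonal and off-diagonal expectations\<close>

definition sqnorm :: "nat \<Rightarrow> (nat \<Rightarrow> real) \<Rightarrow> real" where
  "sqnorm d x = (\<Sum>k\<in>{1..d}. (x k)\<^sup>2)"

lemma sqnorm_nonneg: "0 \<le> sqnorm d x"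
  by (simp add: sqnorm_def sum_nonneg)

lemma all_moments_sqnorm: "all_moments (std_gaussian d) (sqnorm d)"
  unfolding sqnorm_def[abs_def]
  by (intro std_gaussian.all_moments_sum std_gaussian.all_moments_power all_moments_coord)

lemma all_moments_sqnorm_dev: "all_moments (std_gaussian d) (\<lambda>x. sqnorm d x / real d - 1)"
  unfolding divide_inverse
  by (intro std_gaussian.all_moments_diff all_moments_mult all_moments_sqnorm std_gaussian.all_moments_const)

text \<open>The normalized deviation is the quadratic form of the identity matrix divided by d,
  whose entries have square sum 1 / d.\<close>

lemma sqnorm_variance:
  assumes "d \<ge> 1"
  shows "(\<integral>x. (sqnorm d x / real d - 1)\<^sup>2 \<partial>std_gaussian d) = 2 / real d"
proof -
  define b where "b = (\<lambda>k l::nat. if k = l then 1 / real d else 0)"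
  have "quad_form d b x = sqnorm d x / real d - 1" for x
  proof -
    have "quad_form d b x = (\<Sum>k\<in>{1..d}. ((x k)\<^sup>2 - 1) / real d)"
      unfolding quad_form_def b_def by (intro sum.cong refl) (simp add: quad_def power2_eq_square if_distrib[where f = "\<lambda>t. t * _"] cong: if_cong)
    also have "\<dots> = (sqnorm d x - real d) / real d"
      by (simp add: sqnorm_def sum_subtractf flip: sum_divide_distrib)
    finally show ?thesis using assms by (simp add: diff_divide_distrib)
  qed
  then have "(\<integral>x. (sqnorm d x / real d - 1)\<^sup>2 \<partial>std_gaussian d) = (\<integral>x. (quad_form d b x)\<^sup>2 \<partial>std_gaussian d)" by simp
  also have "\<dots> = 2 * (\<Sum>k\<in>{1..d}. \<Sum>l\<in>{1..d}. (b k l)\<^sup>2)"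
    by (rule integral_quad_form_square) (simp add: b_def)
  also have "(\<Sum>k\<in>{1..d}. \<Sum>l\<in>{1..d}. (b k l)\<^sup>2) = (\<Sum>k\<in>{1..d}. 1 / (real d)\<^sup>2)"
    by (intro sum.cong refl) (simp add: b_def power_divide if_distrib[where f = "\<lambda>t. t\<^sup>2"] cong: if_cong)
  finally show ?thesis using assms by (simp add: power2_eq_square)
qed

text \<open>AM-GM with weight sqrt d in place of Cauchy-Schwarz; the outcome 3 / (2 sqrt d) is
  rounded up.\<close>

lemma sqnorm_mean_dev:
  assumes "d \<ge> 1"
  shows "(\<integral>x. \<bar>sqnorm d x / real d - 1\<bar> \<partial>std_gaussian d) \<le> 2 / sqrt (real d)"
proof -
  let ?S = "std_gaussian d"
  define t where "t = (\<lambda>x. sqnorm d x / real d - 1)"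
  have tm: "all_moments ?S t" unfolding t_def by (rule all_moments_sqnorm_dev)
  define s where "s = sqrt (real d)"
  have s: "s > 0" "s * s = real d" using assms by (auto simp: s_def)
  have i: "integrable ?S (\<lambda>x. \<bar>t x\<bar>)" "integrable ?S (\<lambda>x. (t x)\<^sup>2)"
    by (intro all_moments_integrable all_moments_abs std_gaussian.all_moments_power tm)+
  have "(\<integral>x. \<bar>t x\<bar> \<partial>?S) \<le> (\<integral>x. (1 / s + s * (t x)\<^sup>2) / 2 \<partial>?S)"
  proof (intro integral_mono)
    fix x
    have "0 \<le> (1 - s * \<bar>t x\<bar>)\<^sup>2" by simp
    also have "\<dots> = 1 + s\<^sup>2 * (t x)\<^sup>2 - 2 * s * \<bar>t x\<bar>" by (simp add: power2_diff power_mult_distrib)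
    finally have "s * (2 * \<bar>t x\<bar>) \<le> s * (1 / s + s * (t x)\<^sup>2)" using s(1) by (simp add: power2_eq_square distrib_left mult_ac)
    then show "\<bar>t x\<bar> \<le> (1 / s + s * (t x)\<^sup>2) / 2" using s by simp
  qed (use i in auto)
  also have "\<dots> = (1 / s + s * (2 / real d)) / 2"
    using i sqnorm_variance[OF assms] by (simp add: t_def std_gaussian.prob_space)
  also have "\<dots> \<le> 2 / s" using s(1) unfolding s(2)[symmetric] by (simp add: field_simps)
  finally show ?thesis by (simp add: t_def s_def)
qed

lemma inverse_le_inverse_sqrt: "d \<ge> 1 \<Longrightarrow> 2 / real d \<le> 2 / sqrt (real d)"
  by (intro divide_left_mono) (auto intro: real_le_lsqrt simp: power2_eq_square)

lemma diag_expectation: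
  assumes d: "d \<ge> 1" and a: "a \<in> borel_measurable (std_gaussian d)" and a01: "\<And>x. 0 \<le> a x" "\<And>x. a x \<le> 1"
  shows "\<bar>(\<integral>x. (a x)\<^sup>2 * (sqnorm d x / real d)\<^sup>2 \<partial>std_gaussian d) - (\<integral>x. (a x)\<^sup>2 \<partial>std_gaussian d)\<bar> \<le> 6 / sqrt (real d)"
proof -
  let ?S = "std_gaussian d"
  define t where "t = (\<lambda>x. sqnorm d x / real d - 1)"
  have tm: "all_moments ?S t" unfolding t_def by (rule all_moments_sqnorm_dev)
  have am: "all_moments ?S a"
    using a01 by (intro std_gaussian.all_moments_bounded[OF a, of 1]) auto
  have m: "all_moments ?S (\<lambda>x. (a x)\<^sup>2 * (t x + 1)\<^sup>2)" "all_moments ?S (\<lambda>x. (a x)\<^sup>2)"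
     "all_moments ?S (\<lambda>x. (t x)\<^sup>2)" "all_moments ?S (\<lambda>x. \<bar>t x\<bar>)"
    by (intro all_moments_mult std_gaussian.all_moments_power am tm all_moments_add std_gaussian.all_moments_const all_moments_abs)+
  have "\<bar>(\<integral>x. (a x)\<^sup>2 * (t x + 1)\<^sup>2 \<partial>?S) - (\<integral>x. (a x)\<^sup>2 \<partial>?S)\<bar> = \<bar>\<integral>x. (a x)\<^sup>2 * (t x + 1)\<^sup>2 - (a x)\<^sup>2 \<partial>?S\<bar>"
    using m by (simp add: all_moments_integrable)
  also have "\<dots> \<le> (\<integral>x. \<bar>(a x)\<^sup>2 * (t x + 1)\<^sup>2 - (a x)\<^sup>2\<bar> \<partial>?S)" by (rule integral_abs_bound)
  also have "\<dots> \<le> (\<integral>x. (t x)\<^sup>2 + 2 * \<bar>t x\<bar> \<partial>?S)"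
  proof (intro integral_mono)
    fix x
    have "\<bar>(a x)\<^sup>2 * (t x + 1)\<^sup>2 - (a x)\<^sup>2\<bar> = (a x)\<^sup>2 * \<bar>(t x)\<^sup>2 + 2 * t x\<bar>"
    proof -
      have "(a x)\<^sup>2 * (t x + 1)\<^sup>2 - (a x)\<^sup>2 = (a x)\<^sup>2 * ((t x)\<^sup>2 + 2 * t x)"
        by (simp add: power2_eq_square algebra_simps)
      then show ?thesis by (simp add: abs_mult)
    qed
    also have "\<dots> \<le> 1 * \<bar>(t x)\<^sup>2 + 2 * t x\<bar>"
      using a01 by (intro mult_right_mono) (auto simp: abs_square_le_1)
    also have "\<dots> \<le> (t x)\<^sup>2 + 2 * \<bar>t x\<bar>" using abs_triangle_ineq[of "(t x)\<^sup>2" "2 * t x"] by (simp add: abs_mult)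
    finally show "\<bar>(a x)\<^sup>2 * (t x + 1)\<^sup>2 - (a x)\<^sup>2\<bar> \<le> (t x)\<^sup>2 + 2 * \<bar>t x\<bar>" .
  qed (intro all_moments_integrable all_moments_abs all_moments_add std_gaussian.all_moments_cmult
         std_gaussian.all_moments_diff m)+
  also have "\<dots> = 2 / real d + 2 * (\<integral>x. \<bar>t x\<bar> \<partial>?S)"
    using m sqnorm_variance[OF d] by (simp add: all_moments_integrable t_def)
  also have "\<dots> \<le> 2 / sqrt (real d) + 2 * (2 / sqrt (real d))"
    unfolding t_def by (intro add_mono mult_left_mono sqnorm_mean_dev d inverse_le_inverse_sqrt) auto
  finally show ?thesis by (simp add: t_def)
qed

text \<open>Expanding (x . y)^2 and using independence turns the double integral into the sum of
  \<open>(c k l)\<^sup>2\<close>, where c is b plus L on the diagonal. Three terms result: the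
  square sum of b, at most 2 by \<open>bessel_quad\<close>; the trace term 2 L d E[a t], of order
  sqrt d; and d L^2, which alone survives division by d. Bounding each b by a constant would give
  only order d^2 for the first term.\<close>

lemma pair_expectation:
  assumes d: "d \<ge> 1" and a: "a \<in> borel_measurable (std_gaussian d)" and a01: "\<And>x. 0 \<le> a x" "\<And>x. a x \<le> 1"
  shows "\<bar>(\<integral>x. (\<integral>y. a x * a y * (dot d x y)\<^sup>2 \<partial>std_gaussian d) \<partial>std_gaussian d) / real d
     - (\<integral>x. a x \<partial>std_gaussian d)\<^sup>2\<bar> \<le> 6 / sqrt (real d)"
proof -
  let ?S = "std_gaussian d"
  have am: "all_moments ?S a"
    using a01 by (intro std_gaussian.all_moments_bounded[OF a, of 1]) auto
  define L where "L = (\<integral>x. a x \<partial>?S)"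
  have L: "0 \<le> L" "L \<le> 1"
    unfolding L_def using a01 std_gaussian.prob_space[of d] integral_mono[OF all_moments_integrable[OF am], of "\<lambda>_. 1"]
    by (auto intro: Bochner_Integration.integral_nonneg)
  define c where "c = (\<lambda>k l. \<integral>x. a x * (x k * x l) \<partial>?S)"
  define b where "b = (\<lambda>k l. \<integral>x. a x * quad k l x \<partial>?S)"
  have mc: "all_moments ?S (\<lambda>x. a x * (x k * x l))" if "k \<in> {1..d}" "l \<in> {1..d}" for k l
    using that by (intro all_moments_mult am all_moments_coord)
  have sq: "(dot d x y)\<^sup>2 = (\<Sum>k\<in>{1..d}. \<Sum>l\<in>{1..d}. (x k * x l) * (y k * y l))" for x y
    by (simp add: dot_def power2_eq_square sum_product mult_ac)
  have "(\<integral>y. a x * a y * (dot d x y)\<^sup>2 \<partial>?S) = (\<Sum>k\<in>{1..d}. \<Sum>l\<in>{1..d}. c k l * (a x * (x k * x l)))" for x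
  proof -
    have "(\<integral>y. a x * a y * (dot d x y)\<^sup>2 \<partial>?S)
       = (\<integral>y. (\<Sum>k\<in>{1..d}. \<Sum>l\<in>{1..d}. (a x * (x k * x l)) * (a y * (y k * y l))) \<partial>?S)"
      by (simp add: sq sum_distrib_left mult_ac)
    also have "\<dots> = (\<Sum>k\<in>{1..d}. \<Sum>l\<in>{1..d}. \<integral>y. (a x * (x k * x l)) * (a y * (y k * y l)) \<partial>?S)"
      by (intro std_gaussian.integral_double_sum std_gaussian.all_moments_cmult mc)
    finally show ?thesis by (simp add: c_def mult.commute)
  qed
  then have "(\<integral>x. (\<integral>y. a x * a y * (dot d x y)\<^sup>2 \<partial>?S) \<partial>?S)
     = (\<integral>x. (\<Sum>k\<in>{1..d}. \<Sum>l\<in>{1..d}. c k l * (a x * (x k * x l))) \<partial>?S)" by simp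
  also have "\<dots> = (\<Sum>k\<in>{1..d}. \<Sum>l\<in>{1..d}. \<integral>x. c k l * (a x * (x k * x l)) \<partial>?S)"
    by (intro std_gaussian.integral_double_sum std_gaussian.all_moments_cmult mc)
  also have "\<dots> = (\<Sum>k\<in>{1..d}. \<Sum>l\<in>{1..d}. (c k l)\<^sup>2)"
    by (simp add: c_def power2_eq_square)
  also have "\<dots> = (\<Sum>k\<in>{1..d}. \<Sum>l\<in>{1..d}. (b k l)\<^sup>2 + (if l = k then 2 * L * b k k + L\<^sup>2 else 0))"
  proof (intro sum.cong refl)
    fix k l assume kl: "k \<in> {1..d}" "l \<in> {1..d}"
    have "b k l = (\<integral>x. a x * (x k * x l) - (if k = l then a x else 0) \<partial>?S)"
      unfolding b_def by (intro Bochner_Integration.integral_cong refl) (simp add: quad_def right_diff_distrib)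
    then have "c k l = b k l + (if k = l then L else 0)"
      using all_moments_integrable[OF mc[OF kl]] all_moments_integrable[OF am]
      by (cases "k = l") (simp_all add: c_def L_def)
    then show "(c k l)\<^sup>2 = (b k l)\<^sup>2 + (if l = k then 2 * L * b k k + L\<^sup>2 else 0)"
      by (auto simp: power2_sum)
  qed
  also have "\<dots> = (\<Sum>k\<in>{1..d}. \<Sum>l\<in>{1..d}. (b k l)\<^sup>2) + 2 * L * (\<Sum>k\<in>{1..d}. b k k) + real d * L\<^sup>2"
    by (simp add: sum.distrib sum_distrib_left)
  finally have main: "(\<integral>x. (\<integral>y. a x * a y * (dot d x y)\<^sup>2 \<partial>?S) \<partial>?S) =
      (\<Sum>k\<in>{1..d}. \<Sum>l\<in>{1..d}. (b k l)\<^sup>2) + 2 * L * (\<Sum>k\<in>{1..d}. b k k) + real d * L\<^sup>2" .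
  define t where "t = (\<lambda>x. sqnorm d x / real d - 1)"
  have tm: "all_moments ?S t" unfolding t_def by (rule all_moments_sqnorm_dev)
  have "(\<Sum>k\<in>{1..d}. b k k) = (\<integral>x. (\<Sum>k\<in>{1..d}. a x * quad k k x) \<partial>?S)"
    unfolding b_def by (rule Bochner_Integration.integral_sum[symmetric]) (intro all_moments_integrable all_moments_mult am all_moments_quad)
  also have "\<dots> = (\<integral>x. real d * (a x * t x) \<partial>?S)"
  proof (intro Bochner_Integration.integral_cong refl)
    fix x
    have "(\<Sum>k\<in>{1..d}. quad k k x) = real d * t x"
      using d by (simp add: quad_def t_def sqnorm_def sum_subtractf power2_eq_square right_diff_distrib)
    then show "(\<Sum>k\<in>{1..d}. a x * quad k k x) = real d * (a x * t x)" by (simp flip: sum_distrib_left)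
  qed
  finally have tr: "(\<Sum>k\<in>{1..d}. b k k) = real d * (\<integral>x. a x * t x \<partial>?S)" by simp
  have "\<bar>\<integral>x. a x * t x \<partial>?S\<bar> \<le> (\<integral>x. \<bar>a x * t x\<bar> \<partial>?S)" by (rule integral_abs_bound)
  also have "\<dots> \<le> (\<integral>x. \<bar>t x\<bar> \<partial>?S)"
    using a01 by (intro integral_mono all_moments_integrable all_moments_abs all_moments_mult am tm)
      (auto simp: abs_mult intro: mult_left_le_one_le)
  also have "\<dots> \<le> 2 / sqrt (real d)" unfolding t_def by (rule sqnorm_mean_dev[OF d])
  finally have at: "\<bar>\<integral>x. a x * t x \<partial>?S\<bar> \<le> 2 / sqrt (real d)" .
  define B where "B = (\<Sum>k\<in>{1..d}. \<Sum>l\<in>{1..d}. (b k l)\<^sup>2)"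
  have B: "0 \<le> B" "B \<le> 2" unfolding B_def b_def using bessel_quad[OF a a01] by (simp_all add: sum_nonneg)
  have "(\<integral>x. (\<integral>y. a x * a y * (dot d x y)\<^sup>2 \<partial>?S) \<partial>?S) / real d - L\<^sup>2 = B / real d + 2 * L * (\<integral>x. a x * t x \<partial>?S)"
    unfolding main tr B_def[symmetric] using d by (simp add: field_simps)
  also have "\<bar>\<dots>\<bar> \<le> B / real d + 2 * \<bar>L * (\<integral>x. a x * t x \<partial>?S)\<bar>"
    using B(1) by (intro order_trans[OF abs_triangle_ineq]) (simp add: abs_mult)
  also have "\<dots> \<le> 2 / sqrt (real d) + 2 * (1 * (2 / sqrt (real d)))"
  proof (intro add_mono mult_left_mono)
    show "B / real d \<le> 2 / sqrt (real d)"
      using B divide_right_mono[OF B(2), of "real d"] inverse_le_inverse_sqrt[OF d] by simp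
    show "\<bar>L * (\<integral>x. a x * t x \<partial>?S)\<bar> \<le> 1 * (2 / sqrt (real d))"
      unfolding abs_mult using L at by (intro mult_mono) auto
  qed auto
  finally show ?thesis by (simp add: L_def)
qed

subsection \<open>Concentration over the data\<close>

lemma sum_power6_le:
  fixes t :: "'i \<Rightarrow> real"
  assumes "finite I"
  shows "(\<Sum>i\<in>I. t i) ^ 6 \<le> real (card I) ^ 5 * (\<Sum>i\<in>I. t i ^ 6)"
proof (cases "I = {}")
  case False
  define c where "c = real (card I)"
  have c: "c > 0" using assms False by (simp add: c_def card_gt_0_iff)
  define m where "m = (\<Sum>i\<in>I. t i) / c"
  have s: "(\<Sum>i\<in>I. t i) = c * m" using c by (simp add: m_def)
  have "(\<Sum>i\<in>I. m ^ 6 + 6 * m ^ 5 * (t i - m)) \<le> (\<Sum>i\<in>I. t i ^ 6)"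
    by (intro sum_mono power6_tangent)
  also have "(\<Sum>i\<in>I. m ^ 6 + 6 * m ^ 5 * (t i - m)) = c * m ^ 6"
    by (simp add: sum.distrib sum_distrib_left[symmetric] sum_subtractf s c_def[symmetric])
  finally have "c ^ 5 * (c * m ^ 6) \<le> c ^ 5 * (\<Sum>i\<in>I. t i ^ 6)"
    using c by (intro mult_left_mono) auto
  moreover have "c ^ 5 * (c * m ^ 6) = (c * m) ^ 6" using power_add[of c 5 1] by (simp add: power_mult_distrib)
  ultimately show ?thesis by (simp add: s c_def)
qed simp

abbreviation gauss_moment :: "nat \<Rightarrow> real" where
  "gauss_moment n \<equiv> \<integral>z. z ^ n \<partial>gauss"

lemma gauss_moment_even_nonneg: "even n \<Longrightarrow> 0 \<le> gauss_moment n"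
  by (intro Bochner_Integration.integral_nonneg) (simp add: zero_le_even_power)

text \<open>Convexity over the d coordinates. The twelfth power is reached by squaring the pointwise
  bound for the sixth and applying Cauchy-Schwarz.\<close>

lemma integral_sqnorm_power:
  shows "(\<integral>x. sqnorm d x ^ 6 \<partial>std_gaussian d) \<le> real d ^ 6 * gauss_moment 12"
    and "(\<integral>x. sqnorm d x ^ 12 \<partial>std_gaussian d) \<le> real d ^ 12 * gauss_moment 24"
proof -
  have i: "integrable (std_gaussian d) (\<lambda>x. x k ^ n)" if "k \<in> {1..d}" for k n
    by (intro all_moments_integrable std_gaussian.all_moments_power all_moments_coord that)
  have si: "integrable (std_gaussian d) (\<lambda>x. sqnorm d x ^ n)" for n
    by (intro all_moments_integrable std_gaussian.all_moments_power all_moments_sqnorm)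
  have e: "(\<integral>x. (\<Sum>k\<in>{1..d}. x k ^ n) \<partial>std_gaussian d) = real d * gauss_moment n" for n
  proof -
    have "(\<integral>x. (\<Sum>k\<in>{1..d}. x k ^ n) \<partial>std_gaussian d) = (\<Sum>k\<in>{1..d}. \<integral>x. x k ^ n \<partial>std_gaussian d)"
      by (intro Bochner_Integration.integral_sum i)
    also have "\<dots> = (\<Sum>k\<in>{1..d}. gauss_moment n)"
      by (intro sum.cong refl integral_component[where f = "\<lambda>y. y ^ n"]) auto
    finally show ?thesis by simp
  qed
  have le: "sqnorm d x ^ 6 \<le> real d ^ 5 * (\<Sum>k\<in>{1..d}. x k ^ 12)" for x
    using sum_power6_le[of "{1..d}" "\<lambda>k. (x k)\<^sup>2"] by (simp add: sqnorm_def flip: power_mult)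
  have "(\<integral>x. sqnorm d x ^ 6 \<partial>std_gaussian d) \<le> (\<integral>x. real d ^ 5 * (\<Sum>k\<in>{1..d}. x k ^ 12) \<partial>std_gaussian d)"
    by (intro integral_mono si le integrable_mult_right Bochner_Integration.integrable_sum i)
  also have "\<dots> = real d ^ 5 * (real d * gauss_moment 12)" by (simp only: integral_mult_right_zero e)
  finally show "(\<integral>x. sqnorm d x ^ 6 \<partial>std_gaussian d) \<le> real d ^ 6 * gauss_moment 12"
    using power_add[of "real d" 5 1] by (simp add: mult_ac)
  have le2: "sqnorm d x ^ 12 \<le> real d ^ 11 * (\<Sum>k\<in>{1..d}. x k ^ 24)" for x
  proof -
    have "sqnorm d x ^ 12 = (sqnorm d x ^ 6)\<^sup>2" by simp
    also have "\<dots> \<le> (real d ^ 5 * (\<Sum>k\<in>{1..d}. x k ^ 12))\<^sup>2"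
      using le[of x] sqnorm_nonneg[of d x] by (intro power_mono) auto
    also have "\<dots> = real d ^ 10 * (\<Sum>k\<in>{1..d}. x k ^ 12)\<^sup>2" by (simp add: power_mult_distrib)
    also have "\<dots> \<le> real d ^ 10 * ((\<Sum>k\<in>{1..d}. (x k ^ 12)\<^sup>2) * real (card {1..d}))"
      by (intro mult_left_mono sum_squared_le_sum_of_squares) auto
    finally show ?thesis using power_add[of "real d" 10 1] by (simp add: mult_ac del: One_nat_def)
  qed
  have "(\<integral>x. sqnorm d x ^ 12 \<partial>std_gaussian d) \<le> (\<integral>x. real d ^ 11 * (\<Sum>k\<in>{1..d}. x k ^ 24) \<partial>std_gaussian d)"
    by (intro integral_mono si le2 integrable_mult_right Bochner_Integration.integrable_sum i)
  also have "\<dots> = real d ^ 11 * (real d * gauss_moment 24)" by (simp only: integral_mult_right_zero e)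
  finally show "(\<integral>x. sqnorm d x ^ 12 \<partial>std_gaussian d) \<le> real d ^ 12 * gauss_moment 24"
    using power_add[of "real d" 11 1] by (simp add: mult_ac)
qed

lemma integral_PiM_two_components:
  fixes g :: "'b \<Rightarrow> 'b \<Rightarrow> real" and P :: "'b measure"
  assumes P: "prob_space P" and I: "finite I" "n \<in> I" "m \<in> I" "n \<noteq> m"
    and g: "case_prod g \<in> borel_measurable (P \<Otimes>\<^sub>M P)"
    and i: "integrable (Pi\<^sub>M I (\<lambda>_. P)) (\<lambda>x. g (x n) (x m))"
  shows "(\<integral>x. g (x n) (x m) \<partial>Pi\<^sub>M I (\<lambda>_. P)) = (\<integral>v. (\<integral>u. g u v \<partial>P) \<partial>P)"
proof -
  interpret P: prob_space P by fact
  interpret product_sigma_finite "\<lambda>_. P" by unfold_locales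
  have I': "insert n (I - {n}) = I" using I by auto
  have "(\<integral>x. g (x n) (x m) \<partial>Pi\<^sub>M I (\<lambda>_. P)) = (\<integral>x. (\<integral>u. g u (x m) \<partial>P) \<partial>Pi\<^sub>M (I - {n}) (\<lambda>_. P))"
    using product_integral_insert[of "I - {n}" n "\<lambda>x. g (x n) (x m)"] I i unfolding I' by simp
  also have "\<dots> = (\<integral>v. (\<integral>u. g u v \<partial>P) \<partial>P)"
    using I by (intro integral_PiM_component[where f = "\<lambda>v. \<integral>u. g u v \<partial>P" and P = "\<lambda>_. P"] P)
       (use g in measurable)
  finally show ?thesis .
qed

text \<open>For \<open>a(x\<^sub>n)\<close> equal to \<open>p\<^sub>n\<^sub>,\<^sub>i (1 - p\<^sub>n\<^sub>,\<^sub>i)\<close> or \<open>p\<^sub>n\<^sub>,\<^sub>i p\<^sub>n\<^sub>,\<^sub>j\<close>, this is the squared Frobenius norm of a Hessian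
  block divided by \<open>d\<close>.\<close>

definition block_energy :: "nat \<Rightarrow> nat \<Rightarrow> ((nat \<Rightarrow> real) \<Rightarrow> real) \<Rightarrow> nat set \<Rightarrow> (nat \<Rightarrow> nat \<Rightarrow> real) \<Rightarrow> real" where
  "block_energy d N a I x = (\<Sum>n\<in>I. \<Sum>m\<in>I. a (x n) * a (x m) * (dot d (x n) (x m))\<^sup>2) / (real d * (real N)\<^sup>2)"

lemma dot_self: "dot d x x = sqnorm d x"
  by (simp add: dot_def sqnorm_def power2_eq_square)

lemma dot_commute: "dot d x y = dot d y x"
  by (simp add: dot_def mult.commute)

lemma measurable_dot [measurable (raw)]:
  assumes "\<And>k. k \<in> {1..d} \<Longrightarrow> (\<lambda>z. u z k) \<in> borel_measurable M" "\<And>k. k \<in> {1..d} \<Longrightarrow> (\<lambda>z. v z k) \<in> borel_measurable M"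
  shows "(\<lambda>z. dot d (u z) (v z)) \<in> borel_measurable M"
  unfolding dot_def using assms by measurable

lemma measurable_sqnorm [measurable]: "sqnorm d \<in> borel_measurable (std_gaussian d)"
  by (rule all_moments_measurable[OF all_moments_sqnorm])

text \<open>The parameters are frozen: \<open>a\<close> is the weight at one value of V, of which
  only measurability and the range [0, 1] are assumed. The bounds below are therefore uniform in
  V.\<close>

locale gaussian_data =
  fixes d N :: nat and a :: "(nat \<Rightarrow> real) \<Rightarrow> real"
  assumes d: "d \<ge> 1" and N: "N \<ge> 1"
    and a: "a \<in> borel_measurable (std_gaussian d)" and a01: "\<And>x. 0 \<le> a x" "\<And>x. a x \<le> 1"
begin

abbreviation data :: "(nat \<Rightarrow> nat \<Rightarrow> real) measure" where
  "data \<equiv> Pi\<^sub>M {1..N} (\<lambda>_. std_gaussian d)"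

declare a [measurable]

sublocale data: prob_space data
  by (intro prob_space_PiM prob_space_std_gaussian)

lemma a_all_moments: "all_moments (std_gaussian d) a"
  using a01 by (intro std_gaussian.all_moments_bounded[OF a, of 1]) auto

lemma all_moments_data:
  "n \<in> {1..N} \<Longrightarrow> all_moments (std_gaussian d) f \<Longrightarrow> all_moments data (\<lambda>x. f (x n))"
  by (intro all_moments_PiM_component prob_space_std_gaussian)

lemma all_moments_data_dot:
  assumes "n \<in> {1..N}" "m \<in> {1..N}"
  shows "all_moments data (\<lambda>x. dot d (x n) (x m))"
  unfolding dot_def
  by (intro data.all_moments_sum all_moments_mult all_moments_data[where f = "\<lambda>v. v _"] all_moments_coord assms)

lemma all_moments_summand:
  assumes "n \<in> {1..N}" "m \<in> {1..N}"
  shows "all_moments data (\<lambda>x. a (x n) * a (x m) * (dot d (x n) (x m))\<^sup>2)"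
  by (intro all_moments_mult all_moments_data a_all_moments data.all_moments_power all_moments_data_dot assms)

lemma all_moments_block_energy: "I \<subseteq> {1..N} \<Longrightarrow> all_moments data (block_energy d N a I)"
  unfolding block_energy_def[abs_def] divide_inverse
  by (intro all_moments_mult data.all_moments_sum all_moments_summand data.all_moments_const) auto

lemma block_energy_expectation:
  "(\<integral>x. block_energy d N a {1..N} x \<partial>data) =
     real d / real N * (\<integral>x. (a x)\<^sup>2 * (sqnorm d x / real d)\<^sup>2 \<partial>std_gaussian d)
   + (real N - 1) / real N * ((\<integral>x. (\<integral>y. a x * a y * (dot d x y)\<^sup>2 \<partial>std_gaussian d) \<partial>std_gaussian d) / real d)"
proof -
  let ?S = "std_gaussian d"
  define A where "A = (\<integral>x. (a x)\<^sup>2 * (sqnorm d x / real d)\<^sup>2 \<partial>?S)"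
  define B where "B = (\<integral>x. (\<integral>y. a x * a y * (dot d x y)\<^sup>2 \<partial>?S) \<partial>?S)"
  have e: "(\<integral>x. a (x n) * a (x m) * (dot d (x n) (x m))\<^sup>2 \<partial>data) = (if m = n then (real d)\<^sup>2 * A else B)"
    if nm: "n \<in> {1..N}" "m \<in> {1..N}" for n m
  proof (cases "m = n")
    case True
    have "(\<integral>x. a (x n) * a (x m) * (dot d (x n) (x m))\<^sup>2 \<partial>data) = (\<integral>x. (\<lambda>v. (real d)\<^sup>2 * ((a v)\<^sup>2 * (sqnorm d v / real d)\<^sup>2)) (x n) \<partial>data)"
      using True d by (simp add: dot_self power2_eq_square power_divide)
    also have "\<dots> = (\<integral>v. (real d)\<^sup>2 * ((a v)\<^sup>2 * (sqnorm d v / real d)\<^sup>2) \<partial>?S)"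
      by (intro integral_PiM_component prob_space_std_gaussian nm) measurable
    finally show ?thesis using True by (simp add: A_def)
  next
    case False
    have "(\<integral>x. a (x m) * a (x n) * (dot d (x m) (x n))\<^sup>2 \<partial>data) = (\<integral>v. (\<integral>u. a v * a u * (dot d v u)\<^sup>2 \<partial>?S) \<partial>?S)"
    proof (rule integral_PiM_two_components[where g = "\<lambda>u v. a v * a u * (dot d v u)\<^sup>2"])
      show "case_prod (\<lambda>u v. a v * a u * (dot d v u)\<^sup>2) \<in> borel_measurable (?S \<Otimes>\<^sub>M ?S)"
        by measurable
      show "integrable data (\<lambda>x. a (x m) * a (x n) * (dot d (x m) (x n))\<^sup>2)"
        by (intro all_moments_integrable all_moments_summand nm)
    qed (use nm False prob_space_std_gaussian in auto)
    then show ?thesis using False by (simp add: B_def dot_commute mult_ac)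
  qed
  have "(\<integral>x. block_energy d N a {1..N} x \<partial>data) =
     (\<integral>x. (\<Sum>n\<in>{1..N}. \<Sum>m\<in>{1..N}. a (x n) * a (x m) * (dot d (x n) (x m))\<^sup>2) \<partial>data) / (real d * (real N)\<^sup>2)"
    by (simp add: block_energy_def)
  also have "(\<integral>x. (\<Sum>n\<in>{1..N}. \<Sum>m\<in>{1..N}. a (x n) * a (x m) * (dot d (x n) (x m))\<^sup>2) \<partial>data)
     = (\<Sum>n\<in>{1..N}. \<Sum>m\<in>{1..N}. if m = n then (real d)\<^sup>2 * A else B)"
    by (subst data.integral_double_sum) (auto intro!: all_moments_summand sum.cong simp: e simp del: One_nat_def)
  also have "\<dots> = (\<Sum>n\<in>{1..N}. \<Sum>m\<in>{1..N}. B + (if m = n then (real d)\<^sup>2 * A - B else 0))"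
    by (intro sum.cong refl) auto
  also have "\<dots> = real N * real N * B + real N * ((real d)\<^sup>2 * A - B)"
    by (simp add: sum.distrib distrib_left)
  finally have "(\<integral>x. block_energy d N a {1..N} x \<partial>data)
     = (real N * real N * B + real N * ((real d)\<^sup>2 * A - B)) / (real d * (real N)\<^sup>2)" .
  also have "\<dots> = real d / real N * A + (real N - 1) / real N * (B / real d)"
    using d N by (simp add: field_simps power2_eq_square)
  finally show ?thesis unfolding A_def B_def .
qed

lemma block_energy_expectation_approx:
  "\<bar>(\<integral>x. block_energy d N a {1..N} x \<partial>data) - real d / real N * (\<integral>x. (a x)\<^sup>2 \<partial>std_gaussian d) - (\<integral>x. a x \<partial>std_gaussian d)\<^sup>2\<bar>
    \<le> (6 * (real d / real N) + 6) / sqrt (real d) + 1 / real N"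
proof -
  let ?S = "std_gaussian d"
  define A where "A = (\<integral>x. (a x)\<^sup>2 * (sqnorm d x / real d)\<^sup>2 \<partial>?S)"
  define B where "B = (\<integral>x. (\<integral>y. a x * a y * (dot d x y)\<^sup>2 \<partial>?S) \<partial>?S) / real d"
  define A' where "A' = (\<integral>x. (a x)\<^sup>2 \<partial>?S)"
  define L where "L = (\<integral>x. a x \<partial>?S)"
  have L: "0 \<le> L" "L \<le> 1"
    unfolding L_def using a01 std_gaussian.prob_space[of d] integral_mono[OF all_moments_integrable[OF a_all_moments], of "\<lambda>_. 1"]
    by (auto intro: Bochner_Integration.integral_nonneg)
  have 1: "\<bar>A - A'\<bar> \<le> 6 / sqrt (real d)" unfolding A_def A'_def by (rule diag_expectation[OF d a a01])
  have 2: "\<bar>B - L\<^sup>2\<bar> \<le> 6 / sqrt (real d)" unfolding B_def L_def by (rule pair_expectation[OF d a a01])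
  \<comment> \<open>The last term arises because only N (N - 1) of the N^2 ordered pairs are off the
    diagonal.\<close>
  have "real d / real N * A + (real N - 1) / real N * B - real d / real N * A' - L\<^sup>2
     = real d / real N * (A - A') + (real N - 1) / real N * (B - L\<^sup>2) - L\<^sup>2 / real N"
    using N by (simp add: field_simps)
  also have "\<bar>\<dots>\<bar> \<le> \<bar>real d / real N * (A - A')\<bar> + \<bar>(real N - 1) / real N * (B - L\<^sup>2)\<bar> + \<bar>L\<^sup>2 / real N\<bar>"
  proof -
    have "\<bar>p + q - r\<bar> \<le> \<bar>p\<bar> + \<bar>q\<bar> + \<bar>r\<bar>" for p q r :: real by linarith
    then show ?thesis .
  qed
  also have "\<bar>real d / real N * (A - A')\<bar> \<le> real d / real N * (6 / sqrt (real d))"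
    unfolding abs_mult using 1 by (intro mult_mono) auto
  also have "\<bar>(real N - 1) / real N * (B - L\<^sup>2)\<bar> \<le> 1 * (6 / sqrt (real d))"
    unfolding abs_mult using 2 N by (intro mult_mono) (auto simp: field_simps)
  also have "\<bar>L\<^sup>2 / real N\<bar> \<le> 1 / real N"
    using L N by (auto simp: abs_square_le_1 divide_right_mono)
  finally show ?thesis unfolding block_energy_expectation A_def[symmetric] B_def[symmetric] A'_def[symmetric] L_def[symmetric]
    by (simp add: add_divide_distrib mult.commute)
qed

text \<open>Given v, the product u . v is centred normal with variance |v|^2, so its twelfth moment
  is |v|^12 times a constant, and |v|^12 is the sixth power of \<open>sqnorm\<close>.\<close>

lemma integral_data_dot_power:
  assumes "n \<in> {1..N}" "m \<in> {1..N}" "n \<noteq> m"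
  shows "(\<integral>x. dot d (x n) (x m) ^ 12 \<partial>data) \<le> real d ^ 6 * (gauss_moment 12)\<^sup>2"
proof -
  let ?S = "std_gaussian d"
  have "(\<integral>x. dot d (x n) (x m) ^ 12 \<partial>data) = (\<integral>v. (\<integral>u. dot d u v ^ 12 \<partial>?S) \<partial>?S)"
    by (rule integral_PiM_two_components[where g = "\<lambda>u v. dot d u v ^ 12"])
       (use assms prob_space_std_gaussian in \<open>auto intro!: all_moments_integrable data.all_moments_power all_moments_data_dot simp del: One_nat_def\<close>)
  also have "\<dots> = (\<integral>v. sqnorm d v ^ 6 * gauss_moment 12 \<partial>?S)"
  proof (intro Bochner_Integration.integral_cong refl)
    fix v
    show "(\<integral>u. dot d u v ^ 12 \<partial>?S) = sqnorm d v ^ 6 * gauss_moment 12"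
      using integral_std_gaussian_dot_power[where n = 6 and d = d and u = v]
      by (subst dot_commute) (simp add: dot_def sqnorm_def)
  qed
  also have "\<dots> = (\<integral>v. sqnorm d v ^ 6 \<partial>?S) * gauss_moment 12" by simp
  also have "\<dots> \<le> real d ^ 6 * gauss_moment 12 * gauss_moment 12"
    by (intro mult_right_mono integral_sqnorm_power gauss_moment_even_nonneg) auto
  finally show ?thesis by (simp add: power2_eq_square mult_ac)
qed

text \<open>The lost terms are the diagonal one, |x_k|^4, and each mixed one twice by symmetry;
  weights in [0, 1] can only shrink them.\<close>

lemma block_energy_remove:
  assumes k: "k \<in> {1..N}"
  shows "\<bar>block_energy d N a {1..N} x - block_energy d N a ({1..N} - {k}) x\<bar>
     \<le> 2 / (real d * (real N)\<^sup>2) * ((sqnorm d (x k))\<^sup>2 + (\<Sum>m\<in>{1..N} - {k}. (dot d (x k) (x m))\<^sup>2))"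
proof -
  let ?J = "{1..N} - {k}"
  define s where "s = (\<lambda>n m. a (x n) * a (x m) * (dot d (x n) (x m))\<^sup>2)"
  have s: "0 \<le> s n m" "s n m \<le> (dot d (x n) (x m))\<^sup>2" for n m
    unfolding s_def using a01 by (auto intro!: mult_left_le_one_le mult_le_one)
  have sym: "s n m = s m n" for n m by (simp add: s_def dot_commute mult_ac)
  have fin: "finite {1..N}" by simp
  have "(\<Sum>n\<in>{1..N}. \<Sum>m\<in>{1..N}. s n m) = (\<Sum>m\<in>{1..N}. s k m) + (\<Sum>n\<in>?J. \<Sum>m\<in>{1..N}. s n m)"
    by (rule sum.remove[OF fin k])
  also have "(\<Sum>n\<in>?J. \<Sum>m\<in>{1..N}. s n m) = (\<Sum>n\<in>?J. s n k + (\<Sum>m\<in>?J. s n m))"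
    by (intro sum.cong refl sum.remove[OF fin k])
  also have "(\<Sum>m\<in>{1..N}. s k m) = s k k + (\<Sum>m\<in>?J. s k m)" by (rule sum.remove[OF fin k])
  finally have "(\<Sum>n\<in>{1..N}. \<Sum>m\<in>{1..N}. s n m) - (\<Sum>n\<in>?J. \<Sum>m\<in>?J. s n m) = s k k + 2 * (\<Sum>m\<in>?J. s k m)"
    using sym by (simp add: sum.distrib)
  then have eq: "block_energy d N a {1..N} x - block_energy d N a ?J x = (s k k + 2 * (\<Sum>m\<in>?J. s k m)) / (real d * (real N)\<^sup>2)"
    by (simp add: block_energy_def s_def flip: diff_divide_distrib)
  have "0 \<le> s k k + 2 * (\<Sum>m\<in>?J. s k m)" using s by (simp add: sum_nonneg)
  moreover have "s k k + 2 * (\<Sum>m\<in>?J. s k m) \<le> 2 * ((sqnorm d (x k))\<^sup>2 + (\<Sum>m\<in>?J. (dot d (x k) (x m))\<^sup>2))"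
    using s(2)[of k k] sum_mono[of ?J "s k" "\<lambda>m. (dot d (x k) (x m))\<^sup>2"] s
    by (simp add: dot_self distrib_left) (smt (verit) zero_le_power2)
  ultimately show ?thesis unfolding eq
    by (simp add: divide_right_mono)
qed

text \<open>Removing a column costs about (d^2 + N d) / (d N^2), which is O(1/N) when d \<le> c N.
  Its sixth moment is O(N^-6), and the factor N^3 of \<open>PiM_sixth_moment\<close> leaves N^-3. In
  2048 = 64 * 32, the 64 comes from the factor 2 in \<open>block_energy_remove\<close> and the 32
  from \<open>power6_add_le\<close>.\<close>

lemma block_energy_concentration:
  assumes c: "real d \<le> c * real N"
  shows "(\<integral>x. (block_energy d N a {1..N} x - (\<integral>x. block_energy d N a {1..N} x \<partial>data)) ^ 6 \<partial>data)
    \<le> 4000000 * (2048 * (c ^ 6 * gauss_moment 24 + (gauss_moment 12)\<^sup>2)) / real N ^ 3"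
proof -
  define D where "D = real d"
  define n where "n = real N"
  have Dn: "D > 0" "n > 0" "D \<le> c * n" using d N c by (auto simp: D_def n_def)
  define \<delta> where "\<delta> = 2048 * (c ^ 6 * gauss_moment 24 + (gauss_moment 12)\<^sup>2) / n ^ 6"
  have main: "(\<integral>x. (block_energy d N a {1..N} x - block_energy d N a ({1..N} - {k}) x) ^ 6 \<partial>data) \<le> \<delta>"
    if k: "k \<in> {1..N}" for k
  proof -
    let ?J = "{1..N} - {k}"
    define q where "q = 2 / (D * n\<^sup>2)"
    have q: "q \<ge> 0" using Dn by (simp add: q_def)
    have dm: "all_moments data (\<lambda>x. dot d (x k) (x m))" if "m \<in> ?J" for m
      using that k by (intro all_moments_data_dot) auto
    note sm = all_moments_data[OF k all_moments_sqnorm]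
    have le: "(block_energy d N a {1..N} x - block_energy d N a ?J x) ^ 6
       \<le> q ^ 6 * (32 * (sqnorm d (x k) ^ 12 + n ^ 5 * (\<Sum>m\<in>?J. dot d (x k) (x m) ^ 12)))" for x
    proof -
      define u where "u = (sqnorm d (x k))\<^sup>2"
      define v where "v = (\<Sum>m\<in>?J. (dot d (x k) (x m))\<^sup>2)"
      have "\<bar>block_energy d N a {1..N} x - block_energy d N a ?J x\<bar> ^ 6 \<le> (q * (u + v)) ^ 6"
        using block_energy_remove[OF k, of x]
        by (intro power_mono) (auto simp: q_def D_def n_def u_def v_def)
      also have "\<dots> \<le> q ^ 6 * (32 * (u ^ 6 + v ^ 6))"
        unfolding power_mult_distrib by (intro mult_left_mono power6_add_le) simp
      also have "v ^ 6 \<le> n ^ 5 * (\<Sum>m\<in>?J. dot d (x k) (x m) ^ 12)"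
      proof -
        have "v ^ 6 \<le> real (card ?J) ^ 5 * (\<Sum>m\<in>?J. ((dot d (x k) (x m))\<^sup>2) ^ 6)"
          unfolding v_def by (rule sum_power6_le) simp
        also have "\<dots> \<le> n ^ 5 * (\<Sum>m\<in>?J. ((dot d (x k) (x m))\<^sup>2) ^ 6)"
          using card_mono[of "{1..N}" ?J] by (intro mult_right_mono power_mono sum_nonneg) (auto simp: n_def)
        finally show ?thesis by (simp flip: power_mult)
      qed
      finally show ?thesis using q by (simp add: power_even_abs u_def mult_left_mono flip: power_mult)
    qed
    have "(\<integral>x. (block_energy d N a {1..N} x - block_energy d N a ?J x) ^ 6 \<partial>data)
      \<le> (\<integral>x. q ^ 6 * (32 * (sqnorm d (x k) ^ 12 + n ^ 5 * (\<Sum>m\<in>?J. dot d (x k) (x m) ^ 12))) \<partial>data)"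
      by (intro integral_mono le all_moments_integrable data.all_moments_power data.all_moments_diff
          all_moments_block_energy data.all_moments_cmult all_moments_add data.all_moments_sum sm dm) auto
    also have "\<dots> = q ^ 6 * (32 * ((\<integral>x. sqnorm d (x k) ^ 12 \<partial>data) + n ^ 5 * (\<Sum>m\<in>?J. \<integral>x. dot d (x k) (x m) ^ 12 \<partial>data)))"
    proof -
      have i: "integrable data (\<lambda>x. sqnorm d (x k) ^ 12)" "integrable data (\<lambda>x. \<Sum>m\<in>?J. dot d (x k) (x m) ^ 12)"
        by (intro all_moments_integrable data.all_moments_sum data.all_moments_power sm dm; assumption)+
      have "(\<integral>x. (\<Sum>m\<in>?J. dot d (x k) (x m) ^ 12) \<partial>data) = (\<Sum>m\<in>?J. \<integral>x. dot d (x k) (x m) ^ 12 \<partial>data)"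
        by (intro Bochner_Integration.integral_sum all_moments_integrable data.all_moments_power dm)
      with i show ?thesis by (simp del: One_nat_def)
    qed
    also have "\<dots> \<le> q ^ 6 * (32 * (D ^ 12 * gauss_moment 24 + n ^ 5 * (n * (D ^ 6 * (gauss_moment 12)\<^sup>2))))"
    proof (intro mult_left_mono add_mono)
      have "(\<integral>x. sqnorm d (x k) ^ 12 \<partial>data) = (\<integral>v. sqnorm d v ^ 12 \<partial>std_gaussian d)"
        by (intro integral_PiM_component[where f = "\<lambda>v. sqnorm d v ^ 12"] prob_space_std_gaussian k) measurable
      then show "(\<integral>x. sqnorm d (x k) ^ 12 \<partial>data) \<le> D ^ 12 * gauss_moment 24"
        using integral_sqnorm_power(2)[of d] by (simp add: D_def)
      have "(\<Sum>m\<in>?J. \<integral>x. dot d (x k) (x m) ^ 12 \<partial>data) \<le> (\<Sum>m\<in>?J. D ^ 6 * (gauss_moment 12)\<^sup>2)"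
        unfolding D_def using k by (intro sum_mono integral_data_dot_power) auto
      also have "\<dots> \<le> n * (D ^ 6 * (gauss_moment 12)\<^sup>2)"
        using card_mono[of "{1..N}" ?J] Dn by (simp add: n_def mult_right_mono)
      finally show "(\<Sum>m\<in>?J. \<integral>x. dot d (x k) (x m) ^ 12 \<partial>data) \<le> n * (D ^ 6 * (gauss_moment 12)\<^sup>2)" .
    qed (use q Dn in auto)
    also have "\<dots> = 2048 * (D ^ 6 * gauss_moment 24 / n ^ 6 + (gauss_moment 12)\<^sup>2) / n ^ 6"
    proof -
      have e: "q ^ 6 = 64 / (D ^ 6 * n ^ 12)" by (simp add: q_def power_divide power_mult_distrib)
      have e': "n ^ 12 = n ^ 6 * n ^ 6" "D ^ 12 = D ^ 6 * D ^ 6"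
        using power_add[of n 6 6] power_add[of D 6 6] by simp_all
      have e'': "n ^ 5 * (n * w) = n ^ 6 * w" for w using power_add[of n 5 1] by simp
      have gen: "64 / (p * (r * r)) * (32 * (p * p * u + r * (p * w))) = 2048 * (p * u / r + w) / r"
        if "p > 0" "r > 0" for p r u w :: real using that by (simp add: field_simps)
      show ?thesis unfolding e e' e'' by (rule gen) (use Dn in auto)
    qed
    also have "\<dots> \<le> 2048 * (c ^ 6 * gauss_moment 24 + (gauss_moment 12)\<^sup>2) / n ^ 6"
    proof -
      have "D ^ 6 \<le> (c * n) ^ 6" using Dn by (intro power_mono) auto
      then have "D ^ 6 / n ^ 6 \<le> c ^ 6" using Dn by (simp add: power_mult_distrib divide_le_eq)
      then have "D ^ 6 / n ^ 6 * gauss_moment 24 \<le> c ^ 6 * gauss_moment 24"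
        by (intro mult_right_mono gauss_moment_even_nonneg) auto
      then show ?thesis using Dn by (intro divide_right_mono mult_left_mono add_right_mono) auto
    qed
    finally show ?thesis by (simp add: \<delta>_def)
  qed
  have "(\<integral>x. (block_energy d N a {1..N} x - (\<integral>x. block_energy d N a {1..N} x \<partial>data)) ^ 6 \<partial>data)
      \<le> 4000000 * real (card {1..N}) ^ 3 * \<delta>"
  proof (rule PiM_sixth_moment)
    fix k assume k: "k \<in> {1..N}"
    show "\<exists>G. L6 data G \<and> (\<forall>x\<in>space data. \<forall>t\<in>space (std_gaussian d). G (x(k := t)) = G x) \<and>
       (\<integral>x. (block_energy d N a {1..N} x - G x) ^ 6 \<partial>data) \<le> \<delta>"
    proof (intro exI[of _ "block_energy d N a ({1..N} - {k})"] conjI ballI)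
      show "block_energy d N a ({1..N} - {k}) (x(k := t)) = block_energy d N a ({1..N} - {k}) x" for x t
        unfolding block_energy_def by (intro arg_cong2[where f = divide] sum.cong refl) auto
    qed (rule all_moments_L6[OF all_moments_block_energy] main[OF k], simp?)+
  qed (rule finite_atLeastAtMost prob_space_std_gaussian all_moments_L6[OF all_moments_block_energy[OF subset_refl]])+
  also have "\<dots> = 4000000 * (2048 * (c ^ 6 * gauss_moment 24 + (gauss_moment 12)\<^sup>2)) / n ^ 3"
  proof -
    have "a * n ^ 3 * (x / n ^ 6) = a * x / n ^ 3" for a x
      using Dn power_add[of n 3 3] by (simp add: field_simps)
    moreover have "real (card {1..N}) = n" by (simp add: n_def)
    ultimately show ?thesis by (simp only: \<delta>_def)
  qed
  finally show ?thesis by (simp add: n_def)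
qed

end

subsection \<open>Concentration over the parameters\<close>

text \<open>\<open>f\<close> sees only the entries 1 to C, so its argument may be restricted to
  them, which places it in the product space where \<open>f\<close> is measurable.\<close>

lemma measurable_smooth_weight:
  assumes f: "smooth_weight C K f" and g: "\<And>c. c \<in> {1..C} \<Longrightarrow> (\<lambda>x. g x c) \<in> borel_measurable M"
  shows "(\<lambda>x. f (g x)) \<in> borel_measurable M"
proof -
  have "f (g x) = f (\<lambda>c\<in>{1..C}. g x c)" for x
    by (rule smooth_weight_cong[OF f]) simp
  moreover have "(\<lambda>x. f (\<lambda>c\<in>{1..C}. g x c)) \<in> borel_measurable M"
    by (rule measurable_compose[OF _ smooth_weightD(1)[OF f]]) (intro measurable_restrict g)
  ultimately show ?thesis by simp
qed

lemma integral_std_gaussian_reflect: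
  fixes f :: "(nat \<Rightarrow> real) \<Rightarrow> real"
  assumes k: "k \<in> {1..d}" and i: "integrable (std_gaussian d) f" "integrable (std_gaussian d) (\<lambda>x. f (x(k := - x k)))"
  shows "(\<integral>x. f (x(k := - x k)) \<partial>std_gaussian d) = (\<integral>x. f x \<partial>std_gaussian d)"
proof -
  let ?P = "Pi\<^sub>M ({1..d} - {k}) (\<lambda>_. gauss)"
  have [measurable]: "f \<in> borel_measurable (Pi\<^sub>M (insert k ({1..d} - {k})) (\<lambda>_. gauss))"
    using i(1) std_gaussian_insert[OF k] by auto
  have "(\<integral>x. f (x(k := - x k)) \<partial>std_gaussian d) = (\<integral>x. (\<integral>y. f (x(k := - y)) \<partial>gauss) \<partial>?P)"
    using integral_std_gaussian_insert[OF k i(2)] by simp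
  also have "\<dots> = (\<integral>x. (\<integral>y. f (x(k := y)) \<partial>gauss) \<partial>?P)"
  proof (rule Bochner_Integration.integral_cong[OF refl])
    fix x assume x: "x \<in> space ?P"
    have "(\<lambda>y. x(k := y)) \<in> measurable gauss (Pi\<^sub>M (insert k ({1..d} - {k})) (\<lambda>_. gauss))"
      by (rule measurable_fun_upd[where J = "{1..d} - {k}"]) (use x in auto)
    then have "(\<lambda>y. f (x(k := y))) \<in> borel_measurable gauss"
      by (rule measurable_compose) measurable
    then show "(\<integral>y. f (x(k := - y)) \<partial>gauss) = (\<integral>y. f (x(k := y)) \<partial>gauss)"
      using integral_gauss_uminus[of "\<lambda>y. f (x(k := y))"] by simp
  qed
  also have "\<dots> = (\<integral>x. f x \<partial>std_gaussian d)" by (rule integral_std_gaussian_insert[OF k i(1), symmetric])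
  finally show ?thesis .
qed

text \<open>\<open>G\<close> holds V transposed and rescaled to unit variance, \<open>G k c\<close>
  being sqrt d times \<open>V c k\<close>: the independent coordinates for
  \<open>PiM_sixth_moment\<close> are then the columns of V. The index set \<open>I\<close> is
  variable so that a column can be left out.\<close>

definition logit :: "nat \<Rightarrow> (nat \<Rightarrow> nat \<Rightarrow> real) \<Rightarrow> nat set \<Rightarrow> (nat \<Rightarrow> real) \<Rightarrow> nat \<Rightarrow> real" where
  "logit d G I x c = (\<Sum>k\<in>I. G k c * x k) / sqrt (real d)"

text \<open>For \<open>I = {1..d}\<close> this is the conditional mean of the weight given V, x
  being integrated out.\<close>

definition mean_weight :: "nat \<Rightarrow> ((nat \<Rightarrow> real) \<Rightarrow> real) \<Rightarrow> nat set \<Rightarrow> (nat \<Rightarrow> nat \<Rightarrow> real) \<Rightarrow> real" where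
  "mean_weight d f I G = (\<integral>x. f (logit d G I x) \<partial>std_gaussian d)"

lemma integrable_weight_logit:
  assumes f: "smooth_weight C K f" and I: "I \<subseteq> {1..d}"
  shows "integrable (std_gaussian d) (\<lambda>x. f (logit d G I x))"
proof (rule all_moments_integrable, rule std_gaussian.all_moments_bounded)
  show "(\<lambda>x. f (logit d G I x)) \<in> borel_measurable (std_gaussian d)"
  proof (rule measurable_smooth_weight[OF f])
    have [measurable]: "(\<lambda>x. x k) \<in> borel_measurable (std_gaussian d)" if "k \<in> I" for k
      using that I by (intro measurable_std_gaussian_component) auto
    show "(\<lambda>x. logit d G I x c) \<in> borel_measurable (std_gaussian d)" for c
      unfolding logit_def by measurable
  qed
  show "\<bar>f (logit d G I x)\<bar> \<le> 1" for x by (rule smooth_weightD(4)[OF f])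
qed

text \<open>The term of first order in the \<open>k\<close>-th column vanishes by the symmetry \<open>x\<^sub>k \<mapsto> - x\<^sub>k\<close>. Summed over
  the \<open>d\<close> columns, a bound \<open>O(1 / sqrt d)\<close> per column would not give concentration.\<close>

lemma mean_weight_remove:
  assumes f: "smooth_weight C K f" and K: "K \<ge> 0" and d: "d \<ge> 1" and k: "k \<in> {1..d}"
  shows "\<bar>mean_weight d f {1..d} G - mean_weight d f ({1..d} - {k}) G\<bar> \<le> K / (2 * real d) * (l1 C (G k))\<^sup>2"
proof -
  let ?S = "std_gaussian d" and ?J = "{1..d} - {k}"
  define u where "u = (\<lambda>c. G k c / sqrt (real d))"
  define z where "z = (\<lambda>x. logit d G ?J x)"
  have lz: "logit d G {1..d} x = (\<lambda>c. z x c + x k * u c)" for x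
    unfolding logit_def[abs_def] z_def u_def using k
    by (intro ext, subst sum.remove[of _ k]) (auto simp: field_simps)
  have zr: "z (x(k := y)) = z x" for x y
    unfolding z_def logit_def[abs_def] by (intro ext arg_cong2[where f = divide] sum.cong) auto
  have lz': "logit d G {1..d} (x(k := - x k)) = (\<lambda>c. z x c - x k * u c)" for x
    unfolding lz zr by simp
  \<comment> \<open>Negating the k-th column of \<open>G\<close> has the same effect as reflecting
    x_k, so integrability of the reflected weight is an instance of
    \<open>integrable_weight_logit\<close>.\<close>
  have lzm: "logit d (G(k := (\<lambda>c. - G k c))) {1..d} x = (\<lambda>c. z x c - x k * u c)" for x
    unfolding logit_def[abs_def] z_def u_def using k
    by (intro ext, subst sum.remove[of _ k]) (auto simp: field_simps)
  note i1 = integrable_weight_logit[OF f, of "{1..d}" d G, unfolded lz]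
  have i2: "integrable ?S (\<lambda>x. f (\<lambda>c. z x c - x k * u c))"
    using integrable_weight_logit[OF f, of "{1..d}" d "G(k := (\<lambda>c. - G k c))"] unfolding lzm by simp
  have i3: "integrable ?S (\<lambda>x. f (z x))"
    unfolding z_def by (rule integrable_weight_logit[OF f]) auto
  have refl: "(\<integral>x. f (\<lambda>c. z x c - x k * u c) \<partial>?S) = (\<integral>x. f (\<lambda>c. z x c + x k * u c) \<partial>?S)"
    using integral_std_gaussian_reflect[OF k, of "\<lambda>x. f (logit d G {1..d} x)"] i1 i2
    unfolding lz' unfolding lz by simp
  have u1: "(l1 C u)\<^sup>2 = (l1 C (G k))\<^sup>2 / real d"
  proof -
    have "u = (\<lambda>c. (1 / sqrt (real d)) * G k c)" by (simp add: u_def)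
    then have "l1 C u = \<bar>1 / sqrt (real d)\<bar> * l1 C (G k)" by (simp only: l1_cmult)
    then show ?thesis by (simp add: power_divide)
  qed
  have i4: "integrable ?S (\<lambda>x. (x k)\<^sup>2)"
    by (intro all_moments_integrable std_gaussian.all_moments_power all_moments_coord k)
  \<comment> \<open>By reflection the mean weight equals the average over both signs of x_k; its
    double minus twice the reduced mean is a second difference, whence the 1/2 in the bound.\<close>
  have "2 * (mean_weight d f {1..d} G - mean_weight d f ?J G)
      = (\<integral>x. f (\<lambda>c. z x c + x k * u c) + f (\<lambda>c. z x c - x k * u c) - 2 * f (z x) \<partial>?S)"
    unfolding mean_weight_def lz z_def[symmetric] using i1 i2 i3 refl by simp
  then have "\<bar>2 * (mean_weight d f {1..d} G - mean_weight d f ?J G)\<bar>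
      \<le> (\<integral>x. \<bar>f (\<lambda>c. z x c + x k * u c) + f (\<lambda>c. z x c - x k * u c) - 2 * f (z x)\<bar> \<partial>?S)"
    using integral_abs_bound by simp
  also have "\<dots> \<le> (\<integral>x. K * (l1 C u)\<^sup>2 * (x k)\<^sup>2 \<partial>?S)"
  proof (rule integral_mono)
    show "\<bar>f (\<lambda>c. z x c + x k * u c) + f (\<lambda>c. z x c - x k * u c) - 2 * f (z x)\<bar> \<le> K * (l1 C u)\<^sup>2 * (x k)\<^sup>2" for x
      using smooth_weightD(6)[OF f, of "z x" "\<lambda>c. x k * u c"] by (simp only: l1_cmult) (simp add: power_mult_distrib mult_ac)
    show "integrable ?S (\<lambda>x. \<bar>f (\<lambda>c. z x c + x k * u c) + f (\<lambda>c. z x c - x k * u c) - 2 * f (z x)\<bar>)"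
      using i1 i2 i3 by simp
    show "integrable ?S (\<lambda>x. K * (l1 C u)\<^sup>2 * (x k)\<^sup>2)" using i4 by simp
  qed
  also have "\<dots> = K * (l1 C u)\<^sup>2"
    using integral_component[OF k, of "\<lambda>y. y\<^sup>2"] by simp
  finally show ?thesis unfolding u1 abs_mult by (simp add: mult.commute)
qed

lemma all_moments_l1: "all_moments (std_gaussian C) (l1 C)"
  unfolding l1_def[abs_def] by (intro std_gaussian.all_moments_sum all_moments_abs all_moments_coord)

lemma measurable_l1 [measurable]: "l1 C \<in> borel_measurable (std_gaussian C)"
  by (rule all_moments_measurable[OF all_moments_l1])

lemma measurable_mean_weight:
  assumes f: "smooth_weight C K f" and I: "I \<subseteq> {1..d}"
  shows "mean_weight d f I \<in> borel_measurable (Pi\<^sub>M {1..d} (\<lambda>_. std_gaussian C))"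
proof -
  have "(\<lambda>p. f (logit d (fst p) I (snd p))) \<in> borel_measurable (Pi\<^sub>M {1..d} (\<lambda>_. std_gaussian C) \<Otimes>\<^sub>M std_gaussian d)"
  proof (rule measurable_smooth_weight[OF f])
    fix c assume c: "c \<in> {1..C}"
    have G: "(\<lambda>p. fst p k c) \<in> borel_measurable (Pi\<^sub>M {1..d} (\<lambda>_. std_gaussian C) \<Otimes>\<^sub>M std_gaussian d)" if "k \<in> I" for k
    proof -
      have "(\<lambda>p. fst p k) \<in> measurable (Pi\<^sub>M {1..d} (\<lambda>_. std_gaussian C) \<Otimes>\<^sub>M std_gaussian d) (std_gaussian C)"
        by (rule measurable_compose[OF measurable_fst measurable_component_singleton]) (use that I in auto)
      then show ?thesis by (rule measurable_compose[OF _ measurable_std_gaussian_component[OF c]])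
    qed
    have x: "(\<lambda>p. snd p k) \<in> borel_measurable (Pi\<^sub>M {1..d} (\<lambda>_. std_gaussian C) \<Otimes>\<^sub>M std_gaussian d)" if "k \<in> I" for k
      by (rule measurable_compose[OF measurable_snd measurable_std_gaussian_component]) (use that I in auto)
    show "(\<lambda>p. logit d (fst p) I (snd p) c) \<in> borel_measurable (Pi\<^sub>M {1..d} (\<lambda>_. std_gaussian C) \<Otimes>\<^sub>M std_gaussian d)"
      unfolding logit_def using G x by measurable
  qed
  then show ?thesis
    unfolding mean_weight_def[abs_def]
    by (intro std_gaussian.borel_measurable_lebesgue_integral) (simp add: split_beta')
qed

lemma abs_mean_weight_le:
  assumes f: "smooth_weight C K f"
  shows "\<bar>mean_weight d f I G\<bar> \<le> 1"
\<comment> \<open>A non-integrable section has integral 0 by convention and obeys the bound as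
  well.\<close>
proof (cases "integrable (std_gaussian d) (\<lambda>x. f (logit d G I x))")
  case True
  have "0 \<le> mean_weight d f I G" unfolding mean_weight_def
    using smooth_weightD(2)[OF f] by (intro Bochner_Integration.integral_nonneg) auto
  moreover have "mean_weight d f I G \<le> (\<integral>x. 1 \<partial>std_gaussian d)" unfolding mean_weight_def
    using smooth_weightD(3)[OF f] True by (intro integral_mono) auto
  ultimately show ?thesis by (simp add: std_gaussian.prob_space)
qed (simp add: mean_weight_def not_integrable_integral_eq)

text \<open>By \<open>mean_weight_remove\<close> a column matters only to order 1/d, so its sixth
  moment is O(d^-6), and the d columns together give d^3 d^-6.\<close>

lemma mean_weight_concentration:
  assumes f: "smooth_weight C K f" and K: "K \<ge> 0" and d: "d \<ge> 1"
  shows "(\<integral>G. (mean_weight d f {1..d} G - (\<integral>G. mean_weight d f {1..d} G \<partial>Pi\<^sub>M {1..d} (\<lambda>_. std_gaussian C))) ^ 6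
      \<partial>Pi\<^sub>M {1..d} (\<lambda>_. std_gaussian C)) \<le> 4000000 * (K ^ 6 * (\<integral>g. l1 C g ^ 12 \<partial>std_gaussian C)) / real d ^ 3"
proof -
  let ?Q = "Pi\<^sub>M {1..d} (\<lambda>_. std_gaussian C)"
  interpret Q: prob_space ?Q by (intro prob_space_PiM prob_space_std_gaussian)
  define m where "m = (\<integral>g. l1 C g ^ 12 \<partial>std_gaussian C)"
  have m: "m \<ge> 0" by (simp add: m_def)
  have am: "all_moments ?Q (mean_weight d f I)" if "I \<subseteq> {1..d}" for I
    using Q.all_moments_bounded[OF measurable_mean_weight[OF f that] abs_mean_weight_le[OF f]] .
  have main: "(\<integral>G. (mean_weight d f {1..d} G - mean_weight d f ({1..d} - {k}) G) ^ 6 \<partial>?Q) \<le> K ^ 6 * m / real d ^ 6"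
    if k: "k \<in> {1..d}" for k
  proof -
    have lm: "all_moments ?Q (\<lambda>G. l1 C (G k))"
      by (intro all_moments_PiM_component prob_space_std_gaussian k all_moments_l1)
    have "(\<integral>G. (mean_weight d f {1..d} G - mean_weight d f ({1..d} - {k}) G) ^ 6 \<partial>?Q)
      \<le> (\<integral>G. (K / (2 * real d)) ^ 6 * l1 C (G k) ^ 12 \<partial>?Q)"
    proof (intro integral_mono all_moments_integrable Q.all_moments_power Q.all_moments_diff am Q.all_moments_cmult lm)
      fix G
      have "\<bar>mean_weight d f {1..d} G - mean_weight d f ({1..d} - {k}) G\<bar> ^ 6 \<le> (K / (2 * real d) * (l1 C (G k))\<^sup>2) ^ 6"
        by (intro power_mono mean_weight_remove f K d k) simp
      also have "\<dots> = (K / (2 * real d)) ^ 6 * l1 C (G k) ^ 12"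
        unfolding power_mult_distrib by (simp flip: power_mult)
      finally show "(mean_weight d f {1..d} G - mean_weight d f ({1..d} - {k}) G) ^ 6 \<le> (K / (2 * real d)) ^ 6 * l1 C (G k) ^ 12"
        by (simp add: power_even_abs)
    qed auto
    also have "\<dots> = (K / (2 * real d)) ^ 6 * m"
      unfolding m_def integral_mult_right_zero
      by (intro arg_cong2[where f = "(*)"] refl integral_PiM_component[where f = "\<lambda>g. l1 C g ^ 12"] prob_space_std_gaussian k) measurable
    also have "\<dots> \<le> (K / real d) ^ 6 * m"
      using K m d by (intro mult_right_mono power_mono divide_left_mono) auto
    finally show ?thesis by (simp add: power_divide)
  qed
  have "(\<integral>G. (mean_weight d f {1..d} G - (\<integral>G. mean_weight d f {1..d} G \<partial>?Q)) ^ 6 \<partial>?Q)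
     \<le> 4000000 * real (card {1..d}) ^ 3 * (K ^ 6 * m / real d ^ 6)"
  proof (rule PiM_sixth_moment)
    fix k assume k: "k \<in> {1..d}"
    show "\<exists>G. L6 ?Q G \<and> (\<forall>x\<in>space ?Q. \<forall>t\<in>space (std_gaussian C). G (x(k := t)) = G x) \<and>
       (\<integral>x. (mean_weight d f {1..d} x - G x) ^ 6 \<partial>?Q) \<le> K ^ 6 * m / real d ^ 6"
    proof (intro exI[of _ "mean_weight d f ({1..d} - {k})"] conjI ballI)
      show "mean_weight d f ({1..d} - {k}) (x(k := t)) = mean_weight d f ({1..d} - {k}) x" for x t
        unfolding mean_weight_def logit_def[abs_def]
        by (intro Bochner_Integration.integral_cong refl arg_cong[where f = f] ext arg_cong2[where f = divide] sum.cong) auto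
    qed (rule all_moments_L6[OF am] main[OF k], simp?)+
  qed (rule finite_atLeastAtMost prob_space_std_gaussian all_moments_L6[OF am[OF subset_refl]])+
  also have "\<dots> = 4000000 * (K ^ 6 * m) / real d ^ 3"
  proof -
    have "a * real d ^ 3 * (x / real d ^ 6) = a * x / real d ^ 3" for a x
      using d power_add[of "real d" 3 3] by (simp add: field_simps)
    moreover have "real (card {1..d}) = real d" by simp
    ultimately show ?thesis by (simp only:)
  qed
  finally show ?thesis by (simp add: m_def)
qed

text \<open>The first-difference bound with displacement (s - 1) z. The factor \<open>s\<close> will
  be |x| / sqrt d, the standard deviation of the logits at fixed x.\<close>

lemma smooth_weight_scale:
  assumes f: "smooth_weight C K f" and s: "s \<ge> 0"
  shows "\<bar>(\<integral>z. f (\<lambda>c. s * z c) \<partial>std_gaussian C) - (\<integral>z. f z \<partial>std_gaussian C)\<bar>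
    \<le> K * \<bar>s - 1\<bar> * (\<integral>g. l1 C g \<partial>std_gaussian C)"
proof -
  have m: "(\<lambda>z. f (\<lambda>c. t * z c)) \<in> borel_measurable (std_gaussian C)" for t
    by (rule measurable_smooth_weight[OF f]) measurable
  have i: "integrable (std_gaussian C) (\<lambda>z. f (\<lambda>c. t * z c))" for t
    by (rule all_moments_integrable[OF std_gaussian.all_moments_bounded[OF m smooth_weightD(4)[OF f]]])
  note i1 = i[of 1, simplified]
  have "\<bar>(\<integral>z. f (\<lambda>c. s * z c) \<partial>std_gaussian C) - (\<integral>z. f z \<partial>std_gaussian C)\<bar>
     = \<bar>\<integral>z. f (\<lambda>c. s * z c) - f z \<partial>std_gaussian C\<bar>" using i[of s] i1 by simp
  also have "\<dots> \<le> (\<integral>z. \<bar>f (\<lambda>c. s * z c) - f z\<bar> \<partial>std_gaussian C)" by (rule integral_abs_bound)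
  also have "\<dots> \<le> (\<integral>z. K * \<bar>s - 1\<bar> * l1 C z \<partial>std_gaussian C)"
  proof (rule integral_mono)
    fix z
    have "(\<lambda>c. z c + (s - 1) * z c) = (\<lambda>c::nat. s * z c)" by (simp add: left_diff_distrib)
    then show "\<bar>f (\<lambda>c. s * z c) - f z\<bar> \<le> K * \<bar>s - 1\<bar> * l1 C z"
      using smooth_weightD(5)[OF f, of z "\<lambda>c. (s - 1) * z c"] by (simp add: l1_cmult mult.assoc)
  qed (use i[of s] i1 all_moments_integrable[OF all_moments_l1] in auto)
  finally show ?thesis by simp
qed

lemma sqrt_minus_one_le: "t \<ge> 0 \<Longrightarrow> \<bar>sqrt t - 1\<bar> \<le> \<bar>t - 1\<bar>"
proof -
  assume t: "t \<ge> 0"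
  have "\<bar>sqrt t - 1\<bar> * 1 \<le> \<bar>sqrt t - 1\<bar> * (sqrt t + 1)" using t by (intro mult_left_mono) auto
  also have "\<dots> = \<bar>(sqrt t - 1) * (sqrt t + 1)\<bar>" using t by (simp add: abs_mult)
  also have "(sqrt t - 1) * (sqrt t + 1) = t - 1" using t by (simp add: algebra_simps)
  finally show ?thesis by simp
qed

subsection \<open>Almost sure convergence along a cone\<close>

lemma tendsto_zero_power6D:
  fixes f :: "nat \<Rightarrow> real"
  assumes "(\<lambda>k. f k ^ 6) \<longlonglongrightarrow> 0" shows "f \<longlonglongrightarrow> 0"
proof -
  have "(\<lambda>k. root 6 (f k ^ 6)) \<longlonglongrightarrow> root 6 0" by (intro tendsto_intros assms)
  moreover have "root 6 (x ^ 6) = \<bar>x\<bar>" for x :: real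
    using real_root_power_cancel[of 6 "\<bar>x\<bar>"] by (simp add: power_even_abs)
  ultimately show ?thesis by (simp add: tendsto_rabs_zero_iff)
qed

text \<open>The sequence of pairs \<open>(d k, N k)\<close> is arbitrary, so all pairs in a cone have to be controlled
  simultaneously. There are \<open>O(N)\<close> of them for each \<open>N\<close>, which is why the sixth moment is needed.\<close>

lemma (in prob_space) AE_tendsto_cone:
  fixes Z :: "nat \<Rightarrow> nat \<Rightarrow> 'a \<Rightarrow> real" and d N :: "nat \<Rightarrow> nat"
  assumes meas: "\<And>d N. d \<ge> 1 \<Longrightarrow> N \<ge> 1 \<Longrightarrow> Z d N \<in> borel_measurable M"
    and B: "\<And>d N. d \<ge> 1 \<Longrightarrow> N \<ge> 1 \<Longrightarrow> real d \<le> c * real N \<Longrightarrow> real N \<le> c * real d \<Longrightarrow>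
       (\<integral>\<^sup>+\<omega>. ennreal (Z d N \<omega> ^ 6) \<partial>M) \<le> ennreal (B / real N ^ 3)"
    and c: "c \<ge> 0" and B0: "B \<ge> 0"
    and cone: "eventually (\<lambda>k. d k \<ge> 1 \<and> N k \<ge> 1 \<and> real (d k) \<le> c * real (N k) \<and> real (N k) \<le> c * real (d k)) sequentially"
    and N: "filterlim N at_top sequentially"
  shows "AE \<omega> in M. (\<lambda>k. Z (d k) (N k) \<omega>) \<longlonglongrightarrow> 0"
proof -
  \<comment> \<open>The dimensions admissible at sample size n, at most c n of them.\<close>
  define S where "S = (\<lambda>n. {d. d \<ge> 1 \<and> real d \<le> c * real n \<and> real n \<le> c * real d})"
  have S_sub: "S n \<subseteq> {1..nat \<lfloor>c * real n\<rfloor>}" for n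
    unfolding S_def by (auto simp: le_nat_iff le_floor_iff)
  then have fin: "finite (S n)" for n by (rule finite_subset) simp
  have card: "real (card (S n)) \<le> c * real n" for n
  proof -
    have "card (S n) \<le> nat \<lfloor>c * real n\<rfloor>" using card_mono[OF _ S_sub[of n]] by simp
    then show ?thesis using c by (simp add: le_nat_iff le_floor_iff)
  qed
  \<comment> \<open>All pairs of sample size Suc n at once. Its expectation is at most c N * B / N^3
    with N = Suc n, which is summable; the shift keeps N positive.\<close>
  define w where "w = (\<lambda>n \<omega>. \<Sum>d\<in>S (Suc n). Z d (Suc n) \<omega> ^ 6)"
  have w0: "0 \<le> w n \<omega>" for n \<omega> by (simp add: w_def sum_nonneg)
  have wm [measurable]: "w n \<in> borel_measurable M" for n
    unfolding w_def by (intro borel_measurable_sum borel_measurable_power meas) (auto simp: S_def)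
  have wi: "(\<integral>\<^sup>+\<omega>. ennreal (w n \<omega>) \<partial>M) \<le> ennreal (c * B * (1 / real (Suc n) ^ 2))" for n
  proof -
    let ?n = "Suc n"
    have "(\<integral>\<^sup>+\<omega>. ennreal (w n \<omega>) \<partial>M) = (\<Sum>d\<in>S ?n. \<integral>\<^sup>+\<omega>. ennreal (Z d ?n \<omega> ^ 6) \<partial>M)"
      unfolding w_def
      by (subst sum_ennreal[symmetric], simp, subst nn_integral_sum)
         (auto intro!: measurable_compose[OF _ measurable_ennreal] borel_measurable_power meas simp: S_def)
    also have "\<dots> \<le> (\<Sum>d\<in>S ?n. ennreal (B / real ?n ^ 3))"
      by (intro sum_mono B) (auto simp: S_def)
    also have "\<dots> = ennreal (real (card (S ?n)) * (B / real ?n ^ 3))"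
      by (simp only: sum_constant ennreal_mult'[OF of_nat_0_le_iff] ennreal_of_nat_eq_real_of_nat)
    also have "\<dots> \<le> ennreal ((c * real ?n) * (B / real ?n ^ 3))"
      using B0 by (intro ennreal_leI mult_right_mono card) auto
    also have "(c * real ?n) * (B / real ?n ^ 3) = c * B * (1 / real ?n ^ 2)"
      by (simp add: power2_eq_square power3_eq_cube field_simps del: of_nat_Suc)
    finally show ?thesis .
  qed
  have sm: "summable (\<lambda>n. c * B * (1 / real (Suc n) ^ 2))"
  proof -
    have "summable (\<lambda>n. inverse (real n ^ 2))" by (rule inverse_power_summable) simp
    then have "summable (\<lambda>n. inverse (real (Suc n) ^ 2))" by (subst summable_Suc_iff)
    then show ?thesis by (intro summable_mult) (simp add: inverse_eq_divide)
  qed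
  have "(\<integral>\<^sup>+\<omega>. (\<Sum>n. ennreal (w n \<omega>)) \<partial>M) = (\<Sum>n. \<integral>\<^sup>+\<omega>. ennreal (w n \<omega>) \<partial>M)"
    by (rule nn_integral_suminf) measurable
  also have "\<dots> \<le> (\<Sum>n. ennreal (c * B * (1 / real (Suc n) ^ 2)))"
    by (intro suminf_le wi) auto
  also have "\<dots> = ennreal (\<Sum>n. c * B * (1 / real (Suc n) ^ 2))"
    using sm c B0 by (intro suminf_ennreal2) auto
  also have "\<dots> < \<infinity>" by simp
  finally have "(\<integral>\<^sup>+\<omega>. (\<Sum>n. ennreal (w n \<omega>)) \<partial>M) \<noteq> \<infinity>" by simp
  then have "AE \<omega> in M. (\<Sum>n. ennreal (w n \<omega>)) \<noteq> \<infinity>"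
    by (intro nn_integral_noteq_infinite) measurable
  then show ?thesis
  proof eventually_elim
    fix \<omega> assume "(\<Sum>n. ennreal (w n \<omega>)) \<noteq> \<infinity>"
    then have "summable (\<lambda>n. w n \<omega>)" by (intro summable_suminf_not_top w0) simp
    then have "(\<lambda>n. w n \<omega>) \<longlonglongrightarrow> 0" by (rule summable_LIMSEQ_zero)
    then have "(\<lambda>n. w (n - 1) \<omega>) \<longlonglongrightarrow> 0" by (subst filterlim_sequentially_Suc[symmetric]) simp
    then have lim: "(\<lambda>k. w (N k - 1) \<omega>) \<longlonglongrightarrow> 0" by (rule filterlim_compose[OF _ N])
    have "(\<lambda>k. Z (d k) (N k) \<omega> ^ 6) \<longlonglongrightarrow> 0"
    proof (rule Lim_null_comparison[OF _ lim])
      show "eventually (\<lambda>k. norm (Z (d k) (N k) \<omega> ^ 6) \<le> w (N k - 1) \<omega>) sequentially"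
        using cone
      proof eventually_elim
        case (elim k)
        then have "d k \<in> S (N k)" by (simp add: S_def)
        then have "Z (d k) (N k) \<omega> ^ 6 \<le> (\<Sum>d\<in>S (N k). Z d (N k) \<omega> ^ 6)"
          using fin by (intro member_le_sum[of _ _ "\<lambda>d. Z d (N k) \<omega> ^ 6"]) auto
        then show ?case using elim by (simp add: w_def)
      qed
    qed
    then show "(\<lambda>k. Z (d k) (N k) \<omega>) \<longlonglongrightarrow> 0" by (rule tendsto_zero_power6D)
  qed
qed

section \<open>Hessian blocks as smooth weights, and exchangeability of the classes\<close>

definition block_weight :: "nat \<Rightarrow> nat \<Rightarrow> nat \<Rightarrow> (nat \<Rightarrow> real) \<Rightarrow> real" where
  "block_weight C i j z = softmax C z i * (if i = j then 1 - softmax C z i else softmax C z j)"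

text \<open>312 = 2 * 12 + 2 * 12^2, from two factors with constant 12.\<close>

lemma smooth_block_weight:
  assumes "i \<in> {1..C}" "j \<in> {1..C}"
  shows "smooth_weight C 312 (block_weight C i j)"
proof (cases "i = j")
  case True
  then show ?thesis
    using smooth_weight_mult[OF smooth_weight_softmax smooth_weight_one_minus[OF smooth_weight_softmax], of i C i] assms
    by (simp add: block_weight_def[abs_def])
next
  case False
  then show ?thesis
    using smooth_weight_mult[OF smooth_weight_softmax smooth_weight_softmax, of i C j] assms
    by (simp add: block_weight_def[abs_def])
qed

lemma sum_swap3:
  "(\<Sum>a\<in>A. \<Sum>b\<in>B. \<Sum>n\<in>I. t a b n) = (\<Sum>n\<in>I. \<Sum>a\<in>A. \<Sum>b\<in>B. t a b n)"
proof -
  have "(\<Sum>a\<in>A. \<Sum>b\<in>B. \<Sum>n\<in>I. t a b n) = (\<Sum>a\<in>A. \<Sum>n\<in>I. \<Sum>b\<in>B. t a b n)"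
    by (intro sum.cong refl sum.swap)
  also have "\<dots> = (\<Sum>n\<in>I. \<Sum>a\<in>A. \<Sum>b\<in>B. t a b n)" by (rule sum.swap)
  finally show ?thesis .
qed

text \<open>The Gram identity: the squared Frobenius norm of sum_n p_n x_n x_n^T is the sum of p_n
  p_m (x_n . x_m)^2. Squaring also absorbs the minus sign of the off-diagonal blocks, which
  \<open>block_weight\<close> omits.\<close>

lemma frobenius_hessian_block:
  assumes i: "i \<in> {1..C}" and j: "j \<in> {1..C}"
  shows "1 / real d * (frobenius_norm d d (hessian_block (ce_loss C d N x y) V i j))\<^sup>2
    = block_energy d N (\<lambda>x. block_weight C i j (\<lambda>c. dot d (V c) x)) {1..N} x"
proof -
  define p where "p = (\<lambda>n. block_weight C i j (\<lambda>c. dot d (V c) (x n)))"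
  define H where "H = hessian_block (ce_loss C d N x y) V i j"
  have H: "(H a b)\<^sup>2 = (1 / real N)\<^sup>2 * (\<Sum>n\<in>{1..N}. p n * (x n a * x n b))\<^sup>2" if ab: "a \<in> {1..d}" "b \<in> {1..d}" for a b
  proof (cases "i = j")
    case True
    then show ?thesis unfolding H_def p_def
      by (simp add: hessian_block_ce_loss_diag[OF ab j] block_weight_def softmax_prob_eq power_mult_distrib mult.assoc power_divide del: One_nat_def)
  next
    case False
    then show ?thesis unfolding H_def p_def
      by (simp add: hessian_block_ce_loss_off_diag[OF ab i j] block_weight_def softmax_prob_eq power_mult_distrib mult.assoc power_divide del: One_nat_def)
  qed
  have "(frobenius_norm d d H)\<^sup>2 = (\<Sum>a\<in>{1..d}. \<Sum>b\<in>{1..d}. (H a b)\<^sup>2)"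
    by (simp add: frobenius_norm_def sum_nonneg)
  also have "\<dots> = (\<Sum>a\<in>{1..d}. \<Sum>b\<in>{1..d}. (1 / real N)\<^sup>2 * (\<Sum>n\<in>{1..N}. p n * (x n a * x n b))\<^sup>2)"
    by (intro sum.cong refl H)
  also have "\<dots> = (1 / real N)\<^sup>2 * (\<Sum>a\<in>{1..d}. \<Sum>b\<in>{1..d}. \<Sum>n\<in>{1..N}. \<Sum>m\<in>{1..N}.
      p n * p m * ((x n a * x m a) * (x n b * x m b)))"
    by (simp add: power2_eq_square sum_product sum_distrib_left mult_ac)
  also have "(\<Sum>a\<in>{1..d}. \<Sum>b\<in>{1..d}. \<Sum>n\<in>{1..N}. \<Sum>m\<in>{1..N}. p n * p m * ((x n a * x m a) * (x n b * x m b)))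
    = (\<Sum>n\<in>{1..N}. \<Sum>m\<in>{1..N}. \<Sum>a\<in>{1..d}. \<Sum>b\<in>{1..d}. p n * p m * ((x n a * x m a) * (x n b * x m b)))"
    by (subst sum_swap3) (intro sum.cong refl sum_swap3)
  also have "\<dots> = (\<Sum>n\<in>{1..N}. \<Sum>m\<in>{1..N}. p n * p m * (dot d (x n) (x m))\<^sup>2)"
  proof -
    have "(dot d u v)\<^sup>2 = (\<Sum>a\<in>{1..d}. \<Sum>b\<in>{1..d}. (u a * v a) * (u b * v b))" for u v
      by (simp add: dot_def power2_eq_square sum_product)
    then show ?thesis by (simp only: sum_distrib_left)
  qed
  finally show ?thesis by (simp add: block_energy_def H_def p_def power_divide)
qed

lemma integral_std_gaussian_permute:
  fixes f :: "(nat \<Rightarrow> real) \<Rightarrow> real"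
  assumes f: "smooth_weight C K f" and p: "p permutes {1..C}"
  shows "(\<integral>z. f (\<lambda>c. z (p c)) \<partial>std_gaussian C) = (\<integral>z. f z \<partial>std_gaussian C)"
proof -
  let ?r = "\<lambda>z. \<lambda>n\<in>{1..C}. z (p n)"
  have d: "distr (std_gaussian C) (std_gaussian C) ?r = std_gaussian C"
    using distr_PiM_reindex[of "{1..C}" "\<lambda>_. gauss" p "{1..C}"] prob_space_gauss permutes_inj_on[OF p] permutes_in_image[OF p]
    by (auto simp: std_gaussian_def simp del: One_nat_def)
  have r: "?r \<in> measurable (std_gaussian C) (std_gaussian C)"
    unfolding std_gaussian_def using permutes_in_image[OF p]
    by (intro measurable_restrict measurable_component_singleton) auto
  have fm: "f \<in> borel_measurable (std_gaussian C)" by (rule measurable_smooth_weight[OF f]) measurable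
  have "(\<integral>z. f z \<partial>std_gaussian C) = (\<integral>z. f (?r z) \<partial>std_gaussian C)"
    using integral_distr[OF r fm, unfolded d] .
  also have "\<dots> = (\<integral>z. f (\<lambda>c. z (p c)) \<partial>std_gaussian C)"
    by (intro Bochner_Integration.integral_cong refl smooth_weight_cong[OF f]) simp
  finally show ?thesis ..
qed

lemma softmax_permute:
  assumes "p permutes {1..C}"
  shows "softmax C (\<lambda>c. z (p c)) i = softmax C z (p i)"
  unfolding softmax_def using sum.permute[OF assms, of "\<lambda>c. exp (z c)"] by (simp add: comp_def)

lemma h1_eq_block_weight: "h1 C = block_weight C 1 1"
  by (simp add: fun_eq_iff h1_def block_weight_def softmax_def)

lemma h2_eq_block_weight: "h2 C = block_weight C 1 2"
  by (simp add: fun_eq_iff h2_def block_weight_def softmax_def exp_add power2_eq_square)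

text \<open>The functions g are defined through coordinates 1 and 2 only; invariance of the Gaussian
  under permutations carries them to arbitrary i and j.\<close>

lemma block_weight_limits:
  assumes C: "C \<ge> 2" and i: "i \<in> {1..C}" and j: "j \<in> {1..C}"
  shows "\<gamma> * (\<integral>z. (block_weight C i j z)\<^sup>2 \<partial>std_gaussian C) + (\<integral>z. block_weight C i j z \<partial>std_gaussian C)\<^sup>2
    = (if i = j then g_diag \<gamma> C else g_off \<gamma> C)"
proof -
  define q where "q = Transposition.transpose 1 i"
  \<comment> \<open>A permutation with 1 going to i and \<open>m\<close> going to j. For distinct i
    and j, the inner swap sends 2 to \<open>q j\<close>, which q sends to j; it fixes 1 because
    \<open>q j\<close> is not 1.\<close>
  define p where "p = (if i = j then q else q \<circ> Transposition.transpose 2 (q j))"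
  define m :: nat where "m = (if i = j then 1 else 2)"
  have m: "1 \<in> {1..C}" "m \<in> {1..C}" using C by (auto simp: m_def)
  have q: "q permutes {1..C}" unfolding q_def using i C by (intro permutes_swap_id) auto
  have p: "p permutes {1..C}"
  proof (cases "i = j")
    case False
    have "Transposition.transpose 2 (q j) permutes {1..C}"
      using permutes_in_image[OF q, of j] j C by (intro permutes_swap_id) auto
    then show ?thesis using False q by (auto simp: p_def intro: permutes_compose)
  qed (use q in \<open>simp add: p_def del: One_nat_def\<close>)
  have qi: "q 1 = i" "q i = 1" and qj: "q (q j) = j" by (simp_all add: q_def)
  have p1: "p 1 = i"
  proof (cases "i = j")
    case False
    then have "q j \<noteq> 1" using qi qj by metis
    then show ?thesis using False qi by (simp add: p_def Transposition.transpose_def)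
  qed (use qi in \<open>simp add: p_def\<close>)
  have p2: "p m = j" using p1 qj by (cases "i = j") (simp_all add: p_def m_def)
  have "m = 1 \<longleftrightarrow> i = j" by (simp add: m_def)
  then have key: "block_weight C i j z = block_weight C 1 m (\<lambda>c. z (p c))" for z
    unfolding block_weight_def softmax_permute[OF p] p1 p2 by auto
  have "(\<integral>z. block_weight C i j z \<partial>std_gaussian C) = (\<integral>z. block_weight C 1 m z \<partial>std_gaussian C)"
    unfolding key by (rule integral_std_gaussian_permute[OF smooth_block_weight[OF m] p])
  moreover have "(\<integral>z. (block_weight C i j z)\<^sup>2 \<partial>std_gaussian C) = (\<integral>z. (block_weight C 1 m z)\<^sup>2 \<partial>std_gaussian C)"
    unfolding key power2_eq_square
    by (rule integral_std_gaussian_permute[OF smooth_weight_mult[OF smooth_block_weight[OF m] smooth_block_weight[OF m]] p]) simp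
  ultimately show ?thesis
    by (simp add: g_diag_def g_off_def h1_eq_block_weight h2_eq_block_weight m_def del: One_nat_def)
qed

subsection \<open>Laws of Gaussian matrices\<close>

lemma (in prob_space) indep_vars_reindex_inj:
  assumes X: "indep_vars M' X I" and f: "inj_on f J" "f ` J \<subseteq> I"
  shows "indep_vars (\<lambda>j. M' (f j)) (\<lambda>j. X (f j)) J"
proof -
  have "indep_vars (\<lambda>j. Pi\<^sub>M {f j} M') (\<lambda>j \<omega>. restrict (\<lambda>i. X i \<omega>) {f j}) J"
    by (rule indep_vars_restrict[OF X]) (use f in \<open>auto simp: disjoint_family_on_def inj_on_def\<close>)
  then have "indep_vars (\<lambda>j. M' (f j)) (\<lambda>j \<omega>. (restrict (\<lambda>i. X i \<omega>) {f j}) (f j)) J"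
    by (rule indep_vars_compose2[where Y = "\<lambda>j g. g (f j)"]) auto
  then show ?thesis by simp
qed

text \<open>The transposition makes the columns of V the rows of the new matrix, so that results on
  rows apply to them.\<close>

lemma (in prob_space) iid_gaussian_matrix_transpose:
  assumes W: "iid_gaussian_matrix m n \<sigma> W" and \<sigma>: "\<sigma> > 0"
  shows "iid_gaussian_matrix n m 1 (\<lambda>\<omega> s r. W \<omega> r s / \<sigma>)"
  unfolding iid_gaussian_matrix_def
proof (intro conjI ballI)
  fix s r assume "s \<in> {1..n}" "r \<in> {1..m}"
  then have "distributed M lborel (\<lambda>\<omega>. W \<omega> r s) (normal_density 0 \<sigma>)"
    using W by (auto simp: iid_gaussian_matrix_def)
  from normal_density_affine[OF this \<sigma>, of "1 / \<sigma>" 0]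
  show "distributed M lborel (\<lambda>\<omega>. W \<omega> r s / \<sigma>) std_normal_density" using \<sigma> by simp
next
  have "indep_vars (\<lambda>_. borel) (\<lambda>(r, s) \<omega>. W \<omega> r s) ({1..m} \<times> {1..n})"
    using W by (simp add: iid_gaussian_matrix_def)
  then have "indep_vars (\<lambda>_. borel) (\<lambda>j. (\<lambda>(r, s) \<omega>. W \<omega> r s) (prod.swap j)) ({1..n} \<times> {1..m})"
    by (rule indep_vars_reindex_inj[where f = prod.swap]) auto
  then have "indep_vars (\<lambda>_. borel) (\<lambda>j \<omega>. (\<lambda>(r, s) \<omega>. W \<omega> r s) (prod.swap j) \<omega> / \<sigma>) ({1..n} \<times> {1..m})"
    by (rule indep_vars_compose2[where Y = "\<lambda>j x. x / \<sigma>"]) auto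
  then show "indep_vars (\<lambda>_. borel) (\<lambda>(s, r) \<omega>. W \<omega> r s / \<sigma>) ({1..n} \<times> {1..m})"
    by (simp add: split_beta')
qed

lemma (in prob_space) iid_gaussian_matrix_rows:
  assumes W: "iid_gaussian_matrix m n 1 W"
  shows indep_vars_rows: "indep_vars (\<lambda>_. Pi\<^sub>M {1..n} (\<lambda>_. borel)) (\<lambda>r \<omega>. \<lambda>s\<in>{1..n}. W \<omega> r s) {1..m}"
    and indep_vars_row: "r \<in> {1..m} \<Longrightarrow> indep_vars (\<lambda>_. borel) (\<lambda>s \<omega>. W \<omega> r s) {1..n}"
    and distributed_entry: "r \<in> {1..m} \<Longrightarrow> s \<in> {1..n} \<Longrightarrow> distributed M lborel (\<lambda>\<omega>. W \<omega> r s) std_normal_density"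
proof -
  have i: "indep_vars (\<lambda>_. borel) (\<lambda>(r, s) \<omega>. W \<omega> r s) ({1..m} \<times> {1..n})"
    using W by (simp add: iid_gaussian_matrix_def)
  have "indep_vars (\<lambda>r. Pi\<^sub>M ({r} \<times> {1..n}) (\<lambda>_. borel))
     (\<lambda>r \<omega>. restrict (\<lambda>j. (\<lambda>(r, s) \<omega>. W \<omega> r s) j \<omega>) ({r} \<times> {1..n})) {1..m}"
    by (rule indep_vars_restrict[OF i]) (auto simp: disjoint_family_on_def)
  then have "indep_vars (\<lambda>_. Pi\<^sub>M {1..n} (\<lambda>_. borel))
     (\<lambda>r \<omega>. \<lambda>s\<in>{1..n}. (restrict (\<lambda>j. (\<lambda>(r, s) \<omega>. W \<omega> r s) j \<omega>) ({r} \<times> {1..n})) (r, s)) {1..m}"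
    by (rule indep_vars_compose2[where Y = "\<lambda>r g. \<lambda>s\<in>{1..n}. g (r, s)"])
       (intro measurable_restrict measurable_component_singleton, auto)
  then show "indep_vars (\<lambda>_. Pi\<^sub>M {1..n} (\<lambda>_. borel)) (\<lambda>r \<omega>. \<lambda>s\<in>{1..n}. W \<omega> r s) {1..m}"
    by (simp cong: restrict_cong)
  show "indep_vars (\<lambda>_. borel) (\<lambda>s \<omega>. W \<omega> r s) {1..n}" if "r \<in> {1..m}"
  proof -
    have "Pair r ` {1..n} \<subseteq> {1..m} \<times> {1..n}" using that by auto
    from indep_vars_reindex_inj[OF i _ this] show ?thesis by (simp add: inj_on_def)
  qed
  show "distributed M lborel (\<lambda>\<omega>. W \<omega> r s) std_normal_density" if "r \<in> {1..m}" "s \<in> {1..n}"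
    using W that by (simp add: iid_gaussian_matrix_def)
qed

lemma (in prob_space) distr_borel_std_normal:
  "distributed M lborel X std_normal_density \<Longrightarrow> distr M borel X = gauss"
  by (simp add: distributed_distr_eq_density[symmetric] cong: distr_cong)

lemma (in prob_space) distr_row:
  assumes W: "iid_gaussian_matrix m n 1 W" and n: "n \<ge> 1" and r: "r \<in> {1..m}"
  shows "distr M (std_gaussian n) (\<lambda>\<omega>. \<lambda>s\<in>{1..n}. W \<omega> r s) = std_gaussian n"
proof -
  have "distr M (Pi\<^sub>M {1..n} (\<lambda>_. borel)) (\<lambda>\<omega>. \<lambda>s\<in>{1..n}. W \<omega> r s) = Pi\<^sub>M {1..n} (\<lambda>s. distr M borel (\<lambda>\<omega>. W \<omega> r s))"
    using indep_vars_row[OF W r] n distributed_entry[OF W r]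
    by (subst (asm) indep_vars_iff_distr_eq_PiM') (auto simp: distributed_def simp del: One_nat_def)
  also have "\<dots> = std_gaussian n"
    unfolding std_gaussian_def by (intro PiM_cong refl distr_borel_std_normal distributed_entry[OF W r])
  finally show ?thesis by (simp add: sets_std_gaussian cong: distr_cong del: One_nat_def)
qed

lemma measurable_rows:
  assumes "\<And>r s. r \<in> {1..m} \<Longrightarrow> s \<in> {1..n} \<Longrightarrow> (\<lambda>\<omega>. W \<omega> r s) \<in> borel_measurable M"
  shows "(\<lambda>\<omega>. \<lambda>r\<in>{1..m}. \<lambda>s\<in>{1..n}. W \<omega> r s) \<in> measurable M (Pi\<^sub>M {1..m} (\<lambda>_. std_gaussian n))"
proof (rule measurable_restrict)
  fix r assume "r \<in> {1..m}"
  then show "(\<lambda>\<omega>. \<lambda>s\<in>{1..n}. W \<omega> r s) \<in> measurable M (std_gaussian n)"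
    unfolding measurable_cong_sets[OF refl sets_std_gaussian] by (intro measurable_restrict assms)
qed

lemma (in prob_space) distr_rows:
  assumes W: "iid_gaussian_matrix m n 1 W" and n: "n \<ge> 1" and m: "m \<ge> 1"
  shows "distr M (Pi\<^sub>M {1..m} (\<lambda>_. std_gaussian n)) (\<lambda>\<omega>. \<lambda>r\<in>{1..m}. \<lambda>s\<in>{1..n}. W \<omega> r s) = Pi\<^sub>M {1..m} (\<lambda>_. std_gaussian n)"
proof -
  let ?B = "Pi\<^sub>M {1..n} (\<lambda>_. borel) :: (nat \<Rightarrow> real) measure"
  have rv: "(\<lambda>\<omega>. \<lambda>s\<in>{1..n}. W \<omega> r s) \<in> measurable M ?B" if "r \<in> {1..m}" for r
    using indep_vars_rows[OF W] that by (simp add: indep_vars_def del: One_nat_def)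
  have s: "sets (Pi\<^sub>M {1..m} (\<lambda>_. ?B)) = sets (Pi\<^sub>M {1..m} (\<lambda>_. std_gaussian n))"
    by (intro sets_PiM_cong refl sets_std_gaussian[symmetric])
  have "distr M (Pi\<^sub>M {1..m} (\<lambda>_. ?B)) (\<lambda>\<omega>. \<lambda>r\<in>{1..m}. \<lambda>s\<in>{1..n}. W \<omega> r s)
      = Pi\<^sub>M {1..m} (\<lambda>r. distr M ?B (\<lambda>\<omega>. \<lambda>s\<in>{1..n}. W \<omega> r s))"
    using indep_vars_rows[OF W] m rv by (subst (asm) indep_vars_iff_distr_eq_PiM') auto
  also have "\<dots> = Pi\<^sub>M {1..m} (\<lambda>_. std_gaussian n)"
  proof (intro PiM_cong refl)
    fix r assume "r \<in> {1..m}"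
    from distr_row[OF W n this] show "distr M ?B (\<lambda>\<omega>. \<lambda>s\<in>{1..n}. W \<omega> r s) = std_gaussian n"
      using distr_cong[OF refl sets_std_gaussian[of n] refl, of M] by metis
  qed
  finally show ?thesis using distr_cong[OF refl s refl, of M] by metis
qed

text \<open>For fixed u the rows yield independent normals of variance |u|^2. This is the law of the
  logits at fixed x, with V random.\<close>

lemma (in prob_space) distr_rows_dot:
  assumes W: "iid_gaussian_matrix m n 1 W" and m: "m \<ge> 1"
  shows "distr M (Pi\<^sub>M {1..m} (\<lambda>_. borel)) (\<lambda>\<omega>. \<lambda>r\<in>{1..m}. \<Sum>s\<in>{1..n}. u s * W \<omega> r s)
    = distr (std_gaussian m) (Pi\<^sub>M {1..m} (\<lambda>_. borel)) (\<lambda>z. \<lambda>r\<in>{1..m}. sqrt (\<Sum>s\<in>{1..n}. (u s)\<^sup>2) * z r)"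
proof -
  define t where "t = sqrt (\<Sum>s\<in>{1..n}. (u s)\<^sup>2)"
  have "indep_vars (\<lambda>_. borel) (\<lambda>r \<omega>. \<Sum>s\<in>{1..n}. u s * (\<lambda>s\<in>{1..n}. W \<omega> r s) s) {1..m}"
    by (rule indep_vars_compose2[where Y = "\<lambda>r g. \<Sum>s\<in>{1..n}. u s * g s", OF indep_vars_rows[OF W]]) measurable
  then have i: "indep_vars (\<lambda>_. borel) (\<lambda>r \<omega>. \<Sum>s\<in>{1..n}. u s * W \<omega> r s) {1..m}" by simp
  have d: "distr M borel (\<lambda>\<omega>. \<Sum>s\<in>{1..n}. u s * W \<omega> r s) = distr gauss borel (\<lambda>z. t * z)" if r: "r \<in> {1..m}" for r
    unfolding t_def by (rule distr_lin_comb_std_normal[OF _ indep_vars_row[OF W r] distributed_entry[OF W r]]) auto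
  have "distr M (Pi\<^sub>M {1..m} (\<lambda>_. borel)) (\<lambda>\<omega>. \<lambda>r\<in>{1..m}. \<Sum>s\<in>{1..n}. u s * W \<omega> r s)
     = Pi\<^sub>M {1..m} (\<lambda>r. distr M borel (\<lambda>\<omega>. \<Sum>s\<in>{1..n}. u s * W \<omega> r s))"
  proof -
    have "random_variable borel (\<lambda>\<omega>. \<Sum>s\<in>{1..n}. u s * W \<omega> r s)" if "r \<in> {1..m}" for r
      using i that by (simp add: indep_vars_def del: One_nat_def)
    then show ?thesis using i m by (subst (asm) indep_vars_iff_distr_eq_PiM') auto
  qed
  also have "\<dots> = Pi\<^sub>M {1..m} (\<lambda>r. distr gauss borel (\<lambda>z. t * z))" by (intro PiM_cong refl d)
  also have "\<dots> = Pi\<^sub>M {1..m} (\<lambda>r. distr (std_gaussian m) borel (\<lambda>z. t * z r))"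
  proof (intro PiM_cong refl)
    fix r assume r: "r \<in> {1..m}"
    have "gauss = distr (std_gaussian m) borel (\<lambda>z. z r)"
      by (rule std_gaussian.distr_borel_std_normal[OF distributed_std_gaussian_component[OF r], symmetric])
    then have "distr gauss borel (\<lambda>z. t * z) = distr (distr (std_gaussian m) borel (\<lambda>z. z r)) borel (\<lambda>z. t * z)" by simp
    also have "\<dots> = distr (std_gaussian m) borel (\<lambda>z. t * z r)"
      using r by (subst distr_distr) (auto simp: comp_def)
    finally show "distr gauss borel (\<lambda>z. t * z) = distr (std_gaussian m) borel (\<lambda>z. t * z r)" .
  qed
  also have "\<dots> = distr (std_gaussian m) (Pi\<^sub>M {1..m} (\<lambda>_. borel)) (\<lambda>z. \<lambda>r\<in>{1..m}. t * z r)"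
  proof -
    have "std_gaussian.indep_vars m (\<lambda>_. borel) (\<lambda>r z. t * z r) {1..m}"
      by (rule std_gaussian.indep_vars_compose2[where Y = "\<lambda>r x. t * x", OF indep_vars_std_gaussian]) measurable
    then show ?thesis
      using m by (subst (asm) std_gaussian.indep_vars_iff_distr_eq_PiM') auto
  qed
  finally show ?thesis unfolding t_def .
qed

subsection \<open>The Gaussian model\<close>

locale gaussian_model = prob_space +
  fixes C d N :: nat and X V :: "'a \<Rightarrow> nat \<Rightarrow> nat \<Rightarrow> real"
  assumes C: "C \<ge> 1" and d: "d \<ge> 1" and N: "N \<ge> 1"
    and X: "iid_gaussian_matrix N d 1 X" and V: "iid_gaussian_matrix C d (sqrt (1 / real d)) V"
    and XV: "indep_matrices N d X C d V"
begin

abbreviation data :: "(nat \<Rightarrow> nat \<Rightarrow> real) measure" where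
  "data \<equiv> Pi\<^sub>M {1..N} (\<lambda>_. std_gaussian d)"

abbreviation params :: "(nat \<Rightarrow> nat \<Rightarrow> real) measure" where
  "params \<equiv> Pi\<^sub>M {1..d} (\<lambda>_. std_gaussian C)"

definition cols :: "'a \<Rightarrow> nat \<Rightarrow> nat \<Rightarrow> real" where
  "cols \<omega> = (\<lambda>n\<in>{1..N}. \<lambda>k\<in>{1..d}. X \<omega> n k)"

text \<open>Dividing by the standard deviation and transposing gives the matrix \<open>G\<close> of
  \<open>logit\<close>; the restrictions place it in the product space.\<close>

definition pars :: "'a \<Rightarrow> nat \<Rightarrow> nat \<Rightarrow> real" where
  "pars \<omega> = (\<lambda>k\<in>{1..d}. \<lambda>c\<in>{1..C}. V \<omega> c k / sqrt (1 / real d))"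

sublocale data: prob_space data
  by (intro prob_space_PiM prob_space_std_gaussian)

sublocale params: prob_space params
  by (intro prob_space_PiM prob_space_std_gaussian)

sublocale DP: pair_prob_space data params ..

lemma \<sigma>_pos: "sqrt (1 / real d) > 0"
  using d by simp

lemma distr_cols: "distr M data cols = data"
  unfolding cols_def[abs_def] by (rule distr_rows[OF X d N])

lemma distr_pars: "distr M params pars = params"
  unfolding pars_def[abs_def] by (rule distr_rows[OF iid_gaussian_matrix_transpose[OF V \<sigma>_pos] C d])

lemma V_entry [measurable]: "c \<in> {1..C} \<Longrightarrow> k \<in> {1..d} \<Longrightarrow> (\<lambda>\<omega>. V \<omega> c k) \<in> borel_measurable M"
  using V by (auto simp: iid_gaussian_matrix_def distributed_def)

lemma X_entry [measurable]: "n \<in> {1..N} \<Longrightarrow> k \<in> {1..d} \<Longrightarrow> (\<lambda>\<omega>. X \<omega> n k) \<in> borel_measurable M"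
  using X by (auto simp: iid_gaussian_matrix_def distributed_def)

lemma measurable_cols [measurable]: "cols \<in> measurable M data"
  unfolding cols_def[abs_def] by (rule measurable_rows) (rule X_entry)

lemma measurable_pars [measurable]: "pars \<in> measurable M params"
  unfolding pars_def[abs_def] by (rule measurable_rows) (intro borel_measurable_divide V_entry borel_measurable_const)

lemma measurable_curry_matrix:
  assumes "\<And>r s. r \<in> {1..m} \<Longrightarrow> s \<in> {1..n} \<Longrightarrow> j r s \<in> A"
  shows "(\<lambda>e. \<lambda>r\<in>{1..m}. \<lambda>s\<in>{1..n}. e (j r s) / t) \<in> measurable (Pi\<^sub>M A (\<lambda>_. borel)) (Pi\<^sub>M {1..m} (\<lambda>_. std_gaussian n))"
  by (rule measurable_rows) (intro borel_measurable_divide borel_measurable_const measurable_component_singleton assms)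

text \<open>Independence in this form replaces conditioning: a statement given V is one about the
  inner integral over \<open>data\<close> with \<open>G\<close> frozen.\<close>

lemma distr_cols_pars: "distr M (data \<Otimes>\<^sub>M params) (\<lambda>\<omega>. (cols \<omega>, pars \<omega>)) = data \<Otimes>\<^sub>M params"
proof -
  let ?A = "{1..N} \<times> {1..d}" and ?B = "{1..C} \<times> {1..d}"
  have "indep_var (Pi\<^sub>M ?A (\<lambda>_. borel)) (\<lambda>\<omega>. matrix_entries N d (X \<omega>)) (Pi\<^sub>M ?B (\<lambda>_. borel)) (\<lambda>\<omega>. matrix_entries C d (V \<omega>))"
    using XV by (simp add: indep_matrices_def)
  from indep_var_compose[OF this measurable_curry_matrix[of N d "\<lambda>n k. (n, k)" _ 1]
      measurable_curry_matrix[of d C "\<lambda>k c. (c, k)" _ "sqrt (1 / real d)"]]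
  have "indep_var data ((\<lambda>e. \<lambda>r\<in>{1..N}. \<lambda>s\<in>{1..d}. e (r, s) / 1) \<circ> (\<lambda>\<omega>. matrix_entries N d (X \<omega>)))
     params ((\<lambda>e. \<lambda>r\<in>{1..d}. \<lambda>s\<in>{1..C}. e (s, r) / sqrt (1 / real d)) \<circ> (\<lambda>\<omega>. matrix_entries C d (V \<omega>)))"
    by auto
  moreover have "(\<lambda>e. \<lambda>r\<in>{1..N}. \<lambda>s\<in>{1..d}. e (r, s) / 1) \<circ> (\<lambda>\<omega>. matrix_entries N d (X \<omega>)) = cols"
    by (auto simp: fun_eq_iff cols_def matrix_entries_def restrict_def)
  moreover have "(\<lambda>e. \<lambda>r\<in>{1..d}. \<lambda>s\<in>{1..C}. e (s, r) / sqrt (1 / real d)) \<circ> (\<lambda>\<omega>. matrix_entries C d (V \<omega>)) = pars"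
    by (auto simp: fun_eq_iff pars_def matrix_entries_def restrict_def)
  ultimately have "indep_var data cols params pars" by simp
  then show ?thesis unfolding indep_var_distribution_eq distr_cols distr_pars by simp
qed

lemma logit_pars:
  assumes "c \<in> {1..C}" shows "logit d (pars \<omega>) {1..d} x c = dot d (V \<omega> c) x"
proof -
  have "logit d (pars \<omega>) {1..d} x c = (\<Sum>k\<in>{1..d}. sqrt (real d) * (V \<omega> c k * x k)) / sqrt (real d)"
    unfolding logit_def pars_def using assms
    by (intro arg_cong2[where f = divide] sum.cong refl) (simp add: real_sqrt_divide)
  also have "\<dots> = dot d (V \<omega> c) x"
    using d by (simp add: dot_def flip: sum_distrib_left)
  finally show ?thesis .
qed

lemma weight_logit_pars:
  assumes f: "smooth_weight C K f"
  shows "f (logit d (pars \<omega>) {1..d} x) = f (\<lambda>c. dot d (V \<omega> c) x)"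
  by (rule smooth_weight_cong[OF f logit_pars])

definition energy :: "((nat \<Rightarrow> real) \<Rightarrow> real) \<Rightarrow> (nat \<Rightarrow> nat \<Rightarrow> real) \<Rightarrow> (nat \<Rightarrow> nat \<Rightarrow> real) \<Rightarrow> real" where
  "energy f x G = block_energy d N (\<lambda>v. f (logit d G {1..d} v)) {1..N} x"

lemma energy_cols_pars:
  assumes f: "smooth_weight C K f"
  shows "energy f (cols \<omega>) (pars \<omega>) = block_energy d N (\<lambda>x. f (\<lambda>c. dot d (V \<omega> c) x)) {1..N} (X \<omega>)"
proof -
  have "dot d (V \<omega> c) (cols \<omega> n) = dot d (V \<omega> c) (X \<omega> n)" if "n \<in> {1..N}" for c n
    using that by (simp add: dot_def cols_def)
  moreover have "dot d (cols \<omega> n) (cols \<omega> m) = dot d (X \<omega> n) (X \<omega> m)" if "n \<in> {1..N}" "m \<in> {1..N}" for n m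
    using that by (simp add: dot_def cols_def)
  ultimately show ?thesis
    unfolding energy_def block_energy_def weight_logit_pars[OF f]
    by (intro arg_cong2[where f = divide] sum.cong refl) simp
qed

lemma gaussian_data_logit:
  assumes f: "smooth_weight C K f"
  shows "gaussian_data d N (\<lambda>v. f (logit d G {1..d} v))"
  using integrable_weight_logit[OF f, of "{1..d}" d G] smooth_weightD(2,3)[OF f] d N
  by unfold_locales auto

lemma measurable_energy:
  assumes f: "smooth_weight C K f"
  shows "case_prod (energy f) \<in> borel_measurable (data \<Otimes>\<^sub>M params)"
proof -
  have x: "(\<lambda>p. fst p n k) \<in> borel_measurable (data \<Otimes>\<^sub>M params)" if "n \<in> {1..N}" "k \<in> {1..d}" for n k
  proof -
    have "(\<lambda>p. fst p n) \<in> measurable (data \<Otimes>\<^sub>M params) (std_gaussian d)"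
      by (rule measurable_compose[OF measurable_fst measurable_component_singleton]) (rule that)
    then show ?thesis by (rule measurable_compose[OF _ measurable_std_gaussian_component[OF that(2)]])
  qed
  have G: "(\<lambda>p. snd p k c) \<in> borel_measurable (data \<Otimes>\<^sub>M params)" if "k \<in> {1..d}" "c \<in> {1..C}" for k c
  proof -
    have "(\<lambda>p. snd p k) \<in> measurable (data \<Otimes>\<^sub>M params) (std_gaussian C)"
      by (rule measurable_compose[OF measurable_snd measurable_component_singleton]) (rule that)
    then show ?thesis by (rule measurable_compose[OF _ measurable_std_gaussian_component[OF that(2)]])
  qed
  have w: "(\<lambda>p. f (logit d (snd p) {1..d} (fst p n))) \<in> borel_measurable (data \<Otimes>\<^sub>M params)" if "n \<in> {1..N}" for n
  proof (rule measurable_smooth_weight[OF f])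
    show "(\<lambda>p. logit d (snd p) {1..d} (fst p n) c) \<in> borel_measurable (data \<Otimes>\<^sub>M params)" if "c \<in> {1..C}" for c
      unfolding logit_def using x[OF \<open>n \<in> {1..N}\<close>] G that
      by (intro borel_measurable_divide borel_measurable_sum borel_measurable_times borel_measurable_const) auto
  qed
  have dt: "(\<lambda>p. dot d (fst p n) (fst p m)) \<in> borel_measurable (data \<Otimes>\<^sub>M params)" if "n \<in> {1..N}" "m \<in> {1..N}" for n m
    by (rule measurable_dot) (intro x that; assumption)+
  show ?thesis
    unfolding split_beta' energy_def block_energy_def
    by (intro borel_measurable_divide borel_measurable_sum borel_measurable_times borel_measurable_power
          borel_measurable_const w dt)
qed

text \<open>Tonelli on the product law: the inner integral is bounded by
  \<open>block_energy_concentration\<close> for every \<open>G\<close>, uniformly, and averaging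
  over \<open>G\<close> changes nothing.\<close>

lemma energy_concentration:
  assumes f: "smooth_weight C K f" and c: "real d \<le> c * real N"
  shows "(\<integral>\<^sup>+\<omega>. ennreal ((energy f (cols \<omega>) (pars \<omega>) - (\<integral>x. energy f x (pars \<omega>) \<partial>data)) ^ 6) \<partial>M)
    \<le> ennreal (4000000 * (2048 * (c ^ 6 * gauss_moment 24 + (gauss_moment 12)\<^sup>2)) / real N ^ 3)" (is "_ \<le> ?B")
proof -
  note me [measurable] = measurable_energy[OF f]
  have me': "(\<lambda>(G, x). energy f x G) \<in> borel_measurable (params \<Otimes>\<^sub>M data)"
    using measurable_compose[OF measurable_pair_swap' me] by (simp add: split_beta')
  have mi: "(\<lambda>G. \<integral>x. energy f x G \<partial>data) \<in> borel_measurable params"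
    by (rule data.borel_measurable_lebesgue_integral[OF me'])
  define Z where "Z = (\<lambda>p. ennreal ((energy f (fst p) (snd p) - (\<integral>x. energy f x (snd p) \<partial>data)) ^ 6))"
  have Z: "Z \<in> borel_measurable (data \<Otimes>\<^sub>M params)"
    unfolding Z_def using me measurable_compose[OF measurable_snd mi]
    by (intro measurable_compose[OF _ measurable_ennreal] borel_measurable_power borel_measurable_diff)
       (simp_all add: split_beta')
  have cp: "(\<lambda>\<omega>. (cols \<omega>, pars \<omega>)) \<in> measurable M (data \<Otimes>\<^sub>M params)" by measurable
  have "(\<integral>\<^sup>+\<omega>. Z (cols \<omega>, pars \<omega>) \<partial>M) = (\<integral>\<^sup>+p. Z p \<partial>(data \<Otimes>\<^sub>M params))"
    by (subst distr_cols_pars[symmetric], subst nn_integral_distr[OF cp]) (use Z in auto)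
  also have "\<dots> = (\<integral>\<^sup>+G. (\<integral>\<^sup>+x. Z (x, G) \<partial>data) \<partial>params)"
    by (rule DP.nn_integral_snd[symmetric]) (rule Z)
  also have "\<dots> \<le> (\<integral>\<^sup>+G. ?B \<partial>params)"
  proof (rule nn_integral_mono)
    fix G
    interpret g: gaussian_data d N "\<lambda>v. f (logit d G {1..d} v)" by (rule gaussian_data_logit[OF f])
    have "(\<integral>\<^sup>+x. Z (x, G) \<partial>data) = ennreal (\<integral>x. (energy f x G - (\<integral>x. energy f x G \<partial>data)) ^ 6 \<partial>data)"
      unfolding Z_def fst_conv snd_conv energy_def
      by (intro nn_integral_eq_integral all_moments_integrable data.all_moments_power data.all_moments_diff
           g.all_moments_block_energy data.all_moments_const AE_I2 power6_nonneg subset_refl)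
    also have "\<dots> \<le> ?B"
      unfolding energy_def by (intro ennreal_leI g.block_energy_concentration c)
    finally show "(\<integral>\<^sup>+x. Z (x, G) \<partial>data) \<le> ?B" .
  qed
  also have "\<dots> = ?B" by (simp add: params.emeasure_space_1 del: One_nat_def)
  finally show ?thesis by (simp add: Z_def)
qed

lemma measurable_energy_dev:
  assumes f: "smooth_weight C K f"
  shows "(\<lambda>\<omega>. energy f (cols \<omega>) (pars \<omega>) - (\<integral>x. energy f x (pars \<omega>) \<partial>data)) \<in> borel_measurable M"
proof -
  note me [measurable] = measurable_energy[OF f]
  have me': "(\<lambda>(G, x). energy f x G) \<in> borel_measurable (params \<Otimes>\<^sub>M data)"
    using measurable_compose[OF measurable_pair_swap' me] by (simp add: split_beta')
  have "(\<lambda>G. \<integral>x. energy f x G \<partial>data) \<in> borel_measurable params"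
    by (rule data.borel_measurable_lebesgue_integral[OF me'])
  then have "(\<lambda>\<omega>. \<integral>x. energy f x (pars \<omega>) \<partial>data) \<in> borel_measurable M"
    by (rule measurable_compose[OF measurable_pars])
  moreover have "(\<lambda>\<omega>. case_prod (energy f) (cols \<omega>, pars \<omega>)) \<in> borel_measurable M"
    by (rule measurable_compose[OF _ me]) measurable
  ultimately show ?thesis by simp
qed

lemma energy_expectation_approx:
  assumes f: "smooth_weight C K f"
  shows "\<bar>(\<integral>x. energy f x G \<partial>data) - real d / real N * mean_weight d (\<lambda>z. f z * f z) {1..d} G - (mean_weight d f {1..d} G)\<^sup>2\<bar>
    \<le> (6 * (real d / real N) + 6) / sqrt (real d) + 1 / real N"
proof -
  interpret g: gaussian_data d N "\<lambda>v. f (logit d G {1..d} v)" by (rule gaussian_data_logit[OF f])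
  show ?thesis using g.block_energy_expectation_approx by (simp add: energy_def mean_weight_def power2_eq_square)
qed

lemma mean_weight_pars_concentration:
  assumes f: "smooth_weight C K f" and K: "K \<ge> 0"
  shows "(\<integral>\<^sup>+\<omega>. ennreal ((mean_weight d f {1..d} (pars \<omega>) - (\<integral>G. mean_weight d f {1..d} G \<partial>params)) ^ 6) \<partial>M)
    \<le> ennreal (4000000 * (K ^ 6 * (\<integral>g. l1 C g ^ 12 \<partial>std_gaussian C)) / real d ^ 3)"
proof -
  let ?m = "\<integral>G. mean_weight d f {1..d} G \<partial>params"
  have m: "mean_weight d f {1..d} \<in> borel_measurable params" by (rule measurable_mean_weight[OF f subset_refl])
  have "(\<integral>\<^sup>+\<omega>. ennreal ((mean_weight d f {1..d} (pars \<omega>) - ?m) ^ 6) \<partial>M)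
     = (\<integral>\<^sup>+G. ennreal ((mean_weight d f {1..d} G - ?m) ^ 6) \<partial>distr M params pars)"
    using m by (subst nn_integral_distr[OF measurable_pars]) (auto simp del: One_nat_def)
  also have "\<dots> = (\<integral>\<^sup>+G. ennreal ((mean_weight d f {1..d} G - ?m) ^ 6) \<partial>params)" by (simp only: distr_pars)
  also have "\<dots> = ennreal (\<integral>G. (mean_weight d f {1..d} G - ?m) ^ 6 \<partial>params)"
    by (intro nn_integral_eq_integral all_moments_integrable params.all_moments_power params.all_moments_diff
           params.all_moments_bounded[OF m abs_mean_weight_le[OF f]] params.all_moments_const AE_I2 power6_nonneg)
  also have "\<dots> \<le> ennreal (4000000 * (K ^ 6 * (\<integral>g. l1 C g ^ 12 \<partial>std_gaussian C)) / real d ^ 3)"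
    by (intro ennreal_leI mean_weight_concentration f K d)
  finally show ?thesis .
qed

lemma integral_weight_dot:
  assumes f: "smooth_weight C K f"
  shows "(\<integral>\<omega>. f (\<lambda>c. dot d (V \<omega> c) x) \<partial>M) = (\<integral>z. f (\<lambda>c. sqrt (sqnorm d x / real d) * z c) \<partial>std_gaussian C)"
proof -
  let ?\<sigma> = "sqrt (1 / real d)" and ?B = "Pi\<^sub>M {1..C} (\<lambda>_. borel) :: (nat \<Rightarrow> real) measure"
  let ?t = "sqrt (sqnorm d x / real d)"
  have fm: "f \<in> borel_measurable ?B" by (rule smooth_weightD(1)[OF f])
  \<comment> \<open>The second application, with standard deviation 1, undoes the transposition and
    leaves only the normalization.\<close>
  have W: "iid_gaussian_matrix C d 1 (\<lambda>\<omega> c k. V \<omega> c k / ?\<sigma>)"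
    using iid_gaussian_matrix_transpose[OF iid_gaussian_matrix_transpose[OF V \<sigma>_pos]] by simp
  have s: "(\<Sum>k\<in>{1..d}. ?\<sigma> * x k * (V \<omega> c k / ?\<sigma>)) = dot d (V \<omega> c) x" for \<omega> c
    unfolding dot_def using d by (intro sum.cong refl) (simp add: mult.commute)
  have t: "sqrt (\<Sum>k\<in>{1..d}. (?\<sigma> * x k)\<^sup>2) = ?t"
    unfolding sqnorm_def by (simp add: power_mult_distrib sum_divide_distrib)
  have D: "distr M ?B (\<lambda>\<omega>. \<lambda>c\<in>{1..C}. dot d (V \<omega> c) x) = distr (std_gaussian C) ?B (\<lambda>z. \<lambda>c\<in>{1..C}. ?t * z c)"
    using distr_rows_dot[OF W C, of "\<lambda>k. ?\<sigma> * x k"] unfolding s t .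
  have r: "f (\<lambda>c\<in>{1..C}. z c) = f z" for z by (rule smooth_weight_cong[OF f]) simp
  have "(\<integral>\<omega>. f (\<lambda>c. dot d (V \<omega> c) x) \<partial>M) = (\<integral>\<omega>. f (\<lambda>c\<in>{1..C}. dot d (V \<omega> c) x) \<partial>M)" by (simp only: r)
  also have "\<dots> = (\<integral>y. f y \<partial>distr M ?B (\<lambda>\<omega>. \<lambda>c\<in>{1..C}. dot d (V \<omega> c) x))"
    by (rule integral_distr[OF _ fm, symmetric]) (intro measurable_restrict, unfold dot_def, measurable)
  also have "\<dots> = (\<integral>z. f (\<lambda>c\<in>{1..C}. ?t * z c) \<partial>std_gaussian C)"
    unfolding D by (rule integral_distr[OF _ fm]) measurable
  finally show ?thesis by (simp only: r)
qed

text \<open>Exchanging the integrals puts V inside: at fixed x the logits are i.i.d. normal with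
  variance |x|^2 / d. Replacing that variance by 1 costs a multiple of the mean deviation of |x|^2 /
  d.\<close>

lemma mean_weight_expectation:
  assumes f: "smooth_weight C K f" and K: "K \<ge> 0"
  shows "\<bar>(\<integral>G. mean_weight d f {1..d} G \<partial>params) - (\<integral>z. f z \<partial>std_gaussian C)\<bar>
    \<le> K * (\<integral>g. l1 C g \<partial>std_gaussian C) * (2 / sqrt (real d))"
proof -
  let ?S = "std_gaussian d"
  interpret MS: pair_prob_space M ?S ..
  define L where "L = (\<integral>g. l1 C g \<partial>std_gaussian C)"
  have L: "L \<ge> 0" unfolding L_def by (intro Bochner_Integration.integral_nonneg l1_nonneg)
  define F where "F = (\<lambda>\<omega> x. f (\<lambda>c. dot d (V \<omega> c) x))"
  have Fm: "case_prod F \<in> borel_measurable (M \<Otimes>\<^sub>M ?S)"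
    unfolding F_def split_beta'
  proof (rule measurable_smooth_weight[OF f], rule measurable_dot)
    show "(\<lambda>p. V (fst p) c k) \<in> borel_measurable (M \<Otimes>\<^sub>M ?S)" if "c \<in> {1..C}" "k \<in> {1..d}" for c k
      using measurable_compose[OF measurable_fst V_entry[OF that]] .
    show "(\<lambda>p. snd p k) \<in> borel_measurable (M \<Otimes>\<^sub>M ?S)" if "k \<in> {1..d}" for k
      using measurable_compose[OF measurable_snd measurable_std_gaussian_component[OF that]] .
  qed
  have Fi: "integrable (M \<Otimes>\<^sub>M ?S) (case_prod F)"
    by (rule all_moments_integrable[OF MS.P.all_moments_bounded[OF Fm, of 1]])
       (auto simp: F_def smooth_weightD(4)[OF f])
  have "(\<integral>G. mean_weight d f {1..d} G \<partial>params) = (\<integral>\<omega>. mean_weight d f {1..d} (pars \<omega>) \<partial>M)"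
    using integral_distr[OF measurable_pars measurable_mean_weight[OF f subset_refl]] by (simp only: distr_pars)
  also have "\<dots> = (\<integral>\<omega>. (\<integral>x. F \<omega> x \<partial>?S) \<partial>M)"
    unfolding mean_weight_def weight_logit_pars[OF f] F_def ..
  also have "\<dots> = (\<integral>x. (\<integral>\<omega>. F \<omega> x \<partial>M) \<partial>?S)" by (rule MS.Fubini_integral[OF Fi, symmetric])
  finally have e: "(\<integral>G. mean_weight d f {1..d} G \<partial>params) = (\<integral>x. (\<integral>\<omega>. F \<omega> x \<partial>M) \<partial>?S)" .
  have i: "integrable ?S (\<lambda>x. \<integral>\<omega>. F \<omega> x \<partial>M)" by (rule MS.integrable_snd[OF Fi])
  let ?e = "\<integral>z. f z \<partial>std_gaussian C"
  have "\<bar>(\<integral>x. (\<integral>\<omega>. F \<omega> x \<partial>M) \<partial>?S) - ?e\<bar> = \<bar>\<integral>x. (\<integral>\<omega>. F \<omega> x \<partial>M) - ?e \<partial>?S\<bar>"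
    using i by (simp add: std_gaussian.prob_space)
  also have "\<dots> \<le> (\<integral>x. \<bar>(\<integral>\<omega>. F \<omega> x \<partial>M) - ?e\<bar> \<partial>?S)" by (rule integral_abs_bound)
  also have "\<dots> \<le> (\<integral>x. K * L * \<bar>sqnorm d x / real d - 1\<bar> \<partial>?S)"
  proof (rule integral_mono)
    fix x
    have "\<bar>(\<integral>\<omega>. F \<omega> x \<partial>M) - ?e\<bar> \<le> K * \<bar>sqrt (sqnorm d x / real d) - 1\<bar> * L"
      unfolding F_def integral_weight_dot[OF f] L_def
      by (rule smooth_weight_scale[OF f]) (simp add: sqnorm_nonneg)
    also have "\<dots> \<le> K * \<bar>sqnorm d x / real d - 1\<bar> * L"
      using K L by (intro mult_right_mono mult_left_mono sqrt_minus_one_le) (auto simp: sqnorm_nonneg)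
    finally show "\<bar>(\<integral>\<omega>. F \<omega> x \<partial>M) - ?e\<bar> \<le> K * L * \<bar>sqnorm d x / real d - 1\<bar>" by (simp add: mult_ac)
  next
    show "integrable ?S (\<lambda>x. \<bar>(\<integral>\<omega>. F \<omega> x \<partial>M) - ?e\<bar>)" using i by simp
    show "integrable ?S (\<lambda>x. K * L * \<bar>sqnorm d x / real d - 1\<bar>)"
      by (intro all_moments_integrable std_gaussian.all_moments_cmult all_moments_abs all_moments_sqnorm_dev)
  qed
  also have "\<dots> = K * L * (\<integral>x. \<bar>sqnorm d x / real d - 1\<bar> \<partial>?S)" by simp
  also have "\<dots> \<le> K * L * (2 / sqrt (real d))"
    using K L by (intro mult_left_mono sqnorm_mean_dev d) auto
  finally show ?thesis unfolding e L_def .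
qed

end

text \<open>The energy \<open>E\<close> is decomposed as (E - A) + r + (d/N) (Y f2 + m f2) + (Y f +
  m f)^2. Here E - A is the fluctuation over the data, r the error of the conditional expectation, Y
  the fluctuation of a conditional mean over V, and m its mean. Only E - A and Y need almost sure
  arguments.\<close>

lemma (in prob_space) block_energy_AE_tendsto:
  fixes X V :: "nat \<Rightarrow> nat \<Rightarrow> 'a \<Rightarrow> nat \<Rightarrow> nat \<Rightarrow> real" and d N :: "nat \<Rightarrow> nat"
  assumes C: "C \<ge> 1"
    and X: "\<And>d N. iid_gaussian_matrix N d 1 (X d N)"
    and V: "\<And>d N. iid_gaussian_matrix C d (sqrt (1 / real d)) (V d N)"
    and XV: "\<And>d N. indep_matrices N d (X d N) C d (V d N)"
    and \<gamma>: "\<gamma> > 0"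
    and d: "filterlim d at_top sequentially" and N: "filterlim N at_top sequentially"
    and dN: "(\<lambda>k. real (d k) / real (N k)) \<longlonglongrightarrow> \<gamma>"
    and f: "smooth_weight C K f" and K: "K \<ge> 0"
  shows "AE \<omega> in M. (\<lambda>k. block_energy (d k) (N k) (\<lambda>x. f (\<lambda>c. dot (d k) (V (d k) (N k) \<omega> c) x)) {1..N k} (X (d k) (N k) \<omega>))
     \<longlonglongrightarrow> \<gamma> * (\<integral>z. (f z)\<^sup>2 \<partial>std_gaussian C) + (\<integral>z. f z \<partial>std_gaussian C)\<^sup>2"
proof -
  define K2 where "K2 = 2 * K + 2 * K\<^sup>2"
  \<comment> \<open>The square of the weight is again a smooth weight, so its conditional mean is
    covered by the same concentration result.\<close>
  define f2 where "f2 = (\<lambda>z. f z * f z)"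
  have f2: "smooth_weight C K2 f2" unfolding K2_def f2_def by (rule smooth_weight_mult[OF f f K])
  have K2: "K2 \<ge> 0" using K by (simp add: K2_def)
  have model: "gaussian_model M C d N (X d N) (V d N)" if "d \<ge> 1" "N \<ge> 1" for d N
    by unfold_locales (use C X V XV that in auto)
  \<comment> \<open>Chosen so that the cone contains all pairs with d/N between \<gamma>/2 and 2
    \<gamma>, hence eventually the whole sequence.\<close>
  define c where "c = max (2 * \<gamma>) (2 / \<gamma>)"
  have c: "c \<ge> 0" "2 * \<gamma> \<le> c" "2 / \<gamma> \<le> c" using \<gamma> by (auto simp: c_def)
  have ev1: "eventually (\<lambda>k. d k \<ge> 1 \<and> N k \<ge> 1) sequentially"
    using d N by (auto simp: filterlim_at_top eventually_conj_iff)
  have cone: "eventually (\<lambda>k. d k \<ge> 1 \<and> N k \<ge> 1 \<and> real (d k) \<le> c * real (N k) \<and> real (N k) \<le> c * real (d k)) sequentially"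
  proof -
    have "eventually (\<lambda>k. real (d k) / real (N k) < 2 * \<gamma>) sequentially"
      using order_tendstoD(2)[OF dN, of "2 * \<gamma>"] \<gamma> by simp
    moreover have "eventually (\<lambda>k. \<gamma> / 2 < real (d k) / real (N k)) sequentially"
      using order_tendstoD(1)[OF dN, of "\<gamma> / 2"] \<gamma> by simp
    ultimately show ?thesis using ev1
    proof eventually_elim
      case (elim k)
      then have p: "real (N k) > 0" "real (d k) > 0" by auto
      have "real (d k) \<le> (2 * \<gamma>) * real (N k)" using elim p by (simp add: divide_less_eq)
      also have "\<dots> \<le> c * real (N k)" using c by (intro mult_right_mono) auto
      finally have 1: "real (d k) \<le> c * real (N k)" .
      have "real (N k) \<le> (2 / \<gamma>) * real (d k)" using elim p \<gamma> by (simp add: field_simps)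
      also have "\<dots> \<le> c * real (d k)" using c by (intro mult_right_mono) auto
      finally show ?case using 1 elim by simp
    qed
  qed
  define E where "E = (\<lambda>d N \<omega>. block_energy d N (\<lambda>x. f (\<lambda>c. dot d (V d N \<omega> c) x)) {1..N} (X d N \<omega>))"
  define P where "P = (\<lambda>d N. gaussian_model.pars C d (V d N))"
  define A where "A = (\<lambda>d N \<omega>. \<integral>x. gaussian_model.energy d N f x (P d N \<omega>) \<partial>Pi\<^sub>M {1..N} (\<lambda>_. std_gaussian d))"
  define m where "m = (\<lambda>g (d::nat). \<integral>G. mean_weight d g {1..d} G \<partial>Pi\<^sub>M {1..d} (\<lambda>_. std_gaussian C))"
  define Y where "Y = (\<lambda>g d N \<omega>. mean_weight d g {1..d} (P d N \<omega>) - m g d)"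
  have lim1: "AE \<omega> in M. (\<lambda>k. E (d k) (N k) \<omega> - A (d k) (N k) \<omega>) \<longlonglongrightarrow> 0"
  proof (rule AE_tendsto_cone[OF _ _ c(1) _ cone N])
    fix d N :: nat assume dN: "d \<ge> 1" "N \<ge> 1"
    interpret g: gaussian_model M C d N "X d N" "V d N" by (rule model[OF dN])
    have eq: "E d N \<omega> - A d N \<omega> = g.energy f (g.cols \<omega>) (g.pars \<omega>) - (\<integral>x. g.energy f x (g.pars \<omega>) \<partial>Pi\<^sub>M {1..N} (\<lambda>_. std_gaussian d))" for \<omega>
      unfolding E_def A_def P_def g.energy_cols_pars[OF f] ..
    show "(\<lambda>\<omega>. E d N \<omega> - A d N \<omega>) \<in> borel_measurable M"
      unfolding eq by (rule g.measurable_energy_dev[OF f])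
    show "(\<integral>\<^sup>+\<omega>. ennreal ((E d N \<omega> - A d N \<omega>) ^ 6) \<partial>M)
        \<le> ennreal (4000000 * (2048 * (c ^ 6 * gauss_moment 24 + (gauss_moment 12)\<^sup>2)) / real N ^ 3)"
      if "real d \<le> c * real N"
      unfolding eq by (rule g.energy_concentration[OF f that])
  next
    show "0 \<le> 4000000 * (2048 * (c ^ 6 * gauss_moment 24 + (gauss_moment 12)\<^sup>2))"
      by (intro mult_nonneg_nonneg add_nonneg_nonneg gauss_moment_even_nonneg) auto
  qed
  have limY: "AE \<omega> in M. (\<lambda>k. Y g (d k) (N k) \<omega>) \<longlonglongrightarrow> 0" if g: "smooth_weight C L g" "L \<ge> 0" for g L
  proof -
    define B where "B = 4000000 * (L ^ 6 * (\<integral>g. l1 C g ^ 12 \<partial>std_gaussian C))"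
    have B: "B \<ge> 0" unfolding B_def using g(2)
      by (intro mult_nonneg_nonneg Bochner_Integration.integral_nonneg zero_le_power l1_nonneg) auto
    show ?thesis
    proof (rule AE_tendsto_cone[OF _ _ c(1) _ cone N])
      fix d N :: nat assume dN: "d \<ge> 1" "N \<ge> 1"
      interpret g: gaussian_model M C d N "X d N" "V d N" by (rule model[OF dN])
      show "Y g d N \<in> borel_measurable M"
        unfolding Y_def P_def
        by (intro borel_measurable_diff borel_measurable_const
              measurable_compose[OF g.measurable_pars measurable_mean_weight[OF g(1) subset_refl]])
      show "(\<integral>\<^sup>+\<omega>. ennreal (Y g d N \<omega> ^ 6) \<partial>M) \<le> ennreal (B * c ^ 3 / real N ^ 3)"
        if le: "real N \<le> c * real d"
      proof -
        have "(\<integral>\<^sup>+\<omega>. ennreal (Y g d N \<omega> ^ 6) \<partial>M) \<le> ennreal (B / real d ^ 3)"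
          unfolding Y_def P_def m_def B_def by (rule g.mean_weight_pars_concentration[OF g])
        \<comment> \<open>The bound for Y decays in d; the half N \<le> c d of the cone converts it
          into decay in N.\<close>
        also have "B / real d ^ 3 \<le> B * c ^ 3 / real N ^ 3"
        proof -
          have "real N ^ 3 \<le> (c * real d) ^ 3" using le by (intro power_mono) auto
          then have "B * real N ^ 3 \<le> B * c ^ 3 * real d ^ 3"
            using B by (simp add: power_mult_distrib mult_left_mono mult.assoc)
          then show ?thesis using dN by (simp add: divide_le_eq le_divide_eq mult.commute mult.left_commute)
        qed
        finally show ?thesis by (simp add: ennreal_leI)
      qed
    next
      show "0 \<le> B * c ^ 3" using B c by simp
    qed
  qed
  have sq: "filterlim (\<lambda>k. sqrt (real (d k))) at_top sequentially"
    by (intro filterlim_compose[OF sqrt_at_top] filterlim_compose[OF filterlim_real_sequentially d])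
  have inv_sq: "(\<lambda>k. b / sqrt (real (d k))) \<longlonglongrightarrow> 0" for b
    by (intro tendsto_divide_0[OF tendsto_const] filterlim_at_top_imp_at_infinity sq)
  have limm: "(\<lambda>k. m g (d k)) \<longlonglongrightarrow> (\<integral>z. g z \<partial>std_gaussian C)" if g: "smooth_weight C L g" "L \<ge> 0" for g L
  proof -
    let ?b = "L * (\<integral>g. l1 C g \<partial>std_gaussian C) * 2"
    have "(\<lambda>k. m g (d k) - (\<integral>z. g z \<partial>std_gaussian C)) \<longlonglongrightarrow> 0"
    proof (rule Lim_null_comparison[OF _ inv_sq[of ?b]])
      show "eventually (\<lambda>k. norm (m g (d k) - (\<integral>z. g z \<partial>std_gaussian C)) \<le> ?b / sqrt (real (d k))) sequentially"
        using ev1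
      proof eventually_elim
        case (elim k)
        then interpret g: gaussian_model M C "d k" "N k" "X (d k) (N k)" "V (d k) (N k)" by (intro model) auto
        show ?case using g.mean_weight_expectation[OF g] by (simp add: m_def)
      qed
    qed
    then show ?thesis by (rule LIM_zero_cancel)
  qed
  define r where "r = (\<lambda>k \<omega>. A (d k) (N k) \<omega> - real (d k) / real (N k) * mean_weight (d k) f2 {1..d k} (P (d k) (N k) \<omega>)
      - (mean_weight (d k) f {1..d k} (P (d k) (N k) \<omega>))\<^sup>2)"
  \<comment> \<open>Valid for every outcome, because the expectation estimate is uniform in
    \<open>G\<close>.\<close>
  have limr: "(\<lambda>k. r k \<omega>) \<longlonglongrightarrow> 0" for \<omega>
  proof (rule Lim_null_comparison)
    show "eventually (\<lambda>k. norm (r k \<omega>) \<le> (6 * (real (d k) / real (N k)) + 6) * (1 / sqrt (real (d k))) + 1 / real (N k)) sequentially"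
      using ev1
    proof eventually_elim
      case (elim k)
      then interpret g: gaussian_model M C "d k" "N k" "X (d k) (N k)" "V (d k) (N k)" by (intro model) auto
      show ?case using g.energy_expectation_approx[OF f, of "g.pars \<omega>"] by (simp add: r_def A_def P_def f2_def)
    qed
    have "(\<lambda>k. 1 / real (N k)) \<longlonglongrightarrow> 0"
      by (intro tendsto_divide_0[OF tendsto_const] filterlim_at_top_imp_at_infinity
             filterlim_compose[OF filterlim_real_sequentially N])
    then have "(\<lambda>k. (6 * (real (d k) / real (N k)) + 6) * (1 / sqrt (real (d k))) + 1 / real (N k)) \<longlonglongrightarrow> (6 * \<gamma> + 6) * 0 + 0"
      by (intro tendsto_intros dN inv_sq)
    then show "(\<lambda>k. (6 * (real (d k) / real (N k)) + 6) * (1 / sqrt (real (d k))) + 1 / real (N k)) \<longlonglongrightarrow> 0" by simp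
  qed
  show ?thesis
    using lim1 limY[OF f K] limY[OF f2 K2]
  proof eventually_elim
    case (elim \<omega>)
    have "(\<lambda>k. (E (d k) (N k) \<omega> - A (d k) (N k) \<omega>) + r k \<omega>
        + real (d k) / real (N k) * (Y f2 (d k) (N k) \<omega> + m f2 (d k))
        + (Y f (d k) (N k) \<omega> + m f (d k))\<^sup>2)
      \<longlonglongrightarrow> 0 + 0 + \<gamma> * (0 + (\<integral>z. f2 z \<partial>std_gaussian C)) + (0 + (\<integral>z. f z \<partial>std_gaussian C))\<^sup>2"
      by (intro tendsto_intros elim limr dN limm[OF f K] limm[OF f2 K2])
    then show ?case
      by (simp add: r_def Y_def E_def f2_def power2_eq_square)
  qed
qed

theorem theorem1:
  fixes M :: "'a measure"
    and C :: nat
    and X V :: "nat \<Rightarrow> nat \<Rightarrow> 'a \<Rightarrow> nat \<Rightarrow> nat \<Rightarrow> real"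
    and y :: "nat \<Rightarrow> nat \<Rightarrow> 'a \<Rightarrow> nat \<Rightarrow> nat"
    and \<gamma> :: real
    and d N :: "nat \<Rightarrow> nat"
  assumes "prob_space M"
    and "C \<ge> 2"
    and "\<And>d N. prob_space.iid_gaussian_matrix M N d 1 (X d N)"
    and "\<And>d N. prob_space.iid_gaussian_matrix M C d (sqrt (1 / real d)) (V d N)"
    and "\<And>d N. prob_space.indep_matrices M N d (X d N) C d (V d N)"
    and "\<And>d N \<omega> n. n \<in> {1..N} \<Longrightarrow> y d N \<omega> n \<in> {1..C}"
    and "\<gamma> > 0"
    and "filterlim d at_top sequentially"
    and "filterlim N at_top sequentially"
    and "(\<lambda>k. real (d k) / real (N k)) \<longlonglongrightarrow> \<gamma>"
  shows "(AE \<omega> in M.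
            (\<forall>i\<in>{1..C}.
               (\<lambda>k. 1 / real (d k) *
                  (frobenius_norm (d k) (d k)
                     (hessian_block
                        (ce_loss C (d k) (N k) (X (d k) (N k) \<omega>) (y (d k) (N k) \<omega>))
                        (V (d k) (N k) \<omega>) i i))\<^sup>2)
               \<longlonglongrightarrow> g_diag \<gamma> C) \<and>
            (\<forall>i\<in>{1..C}. \<forall>j\<in>{1..C}. i \<noteq> j \<longrightarrow>
               (\<lambda>k. 1 / real (d k) *
                  (frobenius_norm (d k) (d k)
                     (hessian_block
                        (ce_loss C (d k) (N k) (X (d k) (N k) \<omega>) (y (d k) (N k) \<omega>))
                        (V (d k) (N k) \<omega>) i j))\<^sup>2)
               \<longlonglongrightarrow> g_off \<gamma> C)) \<and>
         (\<lambda>C'. (real C')\<^sup>2 * g_diag \<gamma> C') \<longlonglongrightarrow> \<gamma> * exp 1 + 1 \<and>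
         (\<lambda>C'. (real C') ^ 4 * g_off \<gamma> C') \<longlonglongrightarrow> \<gamma> * (exp 1)\<^sup>2 + 1"
proof -
  interpret prob_space M by fact
  let ?L = "\<lambda>i j \<omega> k. 1 / real (d k) *
     (frobenius_norm (d k) (d k)
        (hessian_block (ce_loss C (d k) (N k) (X (d k) (N k) \<omega>) (y (d k) (N k) \<omega>)) (V (d k) (N k) \<omega>) i j))\<^sup>2"
  \<comment> \<open>There are finitely many pairs (i, j), so one null set serves them all.\<close>
  have "AE \<omega> in M. \<forall>i\<in>{1..C}. \<forall>j\<in>{1..C}. ?L i j \<omega> \<longlonglongrightarrow> (if i = j then g_diag \<gamma> C else g_off \<gamma> C)"
  proof (intro AE_finite_allI finite_atLeastAtMost)
    fix i j assume ij: "i \<in> {1..C}" "j \<in> {1..C}"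
    have "C \<ge> 1" using assms(2) by simp
    from block_energy_AE_tendsto[OF this assms(3-5,7-10) smooth_block_weight[OF ij]]
    show "AE \<omega> in M. ?L i j \<omega> \<longlonglongrightarrow> (if i = j then g_diag \<gamma> C else g_off \<gamma> C)"
      unfolding block_weight_limits[OF assms(2) ij] frobenius_hessian_block[OF ij] by simp
  qed
  then have "AE \<omega> in M. (\<forall>i\<in>{1..C}. ?L i i \<omega> \<longlonglongrightarrow> g_diag \<gamma> C) \<and>
      (\<forall>i\<in>{1..C}. \<forall>j\<in>{1..C}. i \<noteq> j \<longrightarrow> ?L i j \<omega> \<longlonglongrightarrow> g_off \<gamma> C)"
    by eventually_elim (auto split: if_splits)
  then show ?thesis using g_diag_asymptotics[of \<gamma>] g_off_asymptotics[of \<gamma>] by blast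
qed

end
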